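(* Let $m\ge 1$ and $G\in \overline{W}(P_m)$. Then $\operatorname{reg}\bigl(I(G)^{[k]}\bigr)=2k+\left\lfloor \frac{m-k}{2} \right\rfloor$ for each $1\le k\le\nu(G)= m$.
   Context: All graphs are finite and simple. Fix a field $\mathbb{K}$. For a graph $G$ with vertex set $V(G)$ (vertices are identified with indeterminates), $R=\mathbb{K}[x\mid x\in V(G)]$ and $I(G)=\langle xy\mid \{x,y\}\in E(G)\rangle\subseteq R$ is the edge ideal. A $k$-matching of $G$ is a set of $k$ pairwise disjoint edges; $\nu(G)$ is the maximum cardinality of a matching. The $k$-th square-free power $I(G)^{[k]}$ is the ideal of $R$ generated by the square-free monomials of $I(G)^k$; equivalently it is generated by the products $\prod_{x\in \bigcup_{e\in M}e}x$ over all $k$-matchings $M$ of $G$. For a nonzero graded ideal $J\subseteq R$ with graded Betti numbers $\beta_{i,j}(J)$ (of $J$ as an $R$-module), $\operatorname{reg}(J)=\max\{j-i\mid \beta_{i,j}(J)\ne 0\}$. For positive integers $m,r_1,\dots,r_m$, let $G_{1,m,r_1,\dots,r_m}$ be the graph with vertex set $\{x_i,y_{i,j}\mid 1\le i\le m,\ 1\le j\le r_i\}$ and edges $\{x_i,x_{i+1}\}$ ($1\le i\le m-1$) and $\{x_i,y_{i,j}\}$ ($1\le i\le m$, $1\le j\le r_i$). That is, it is a path on $m$ vertices with $r_i\ge1$ whiskers at the $i$-th vertex. Then $\overline{W}(P_m)$ is the class of all graphs $G$ with $G\cong G_{1,m,r_1,\dots,r_m}$ for some $r_1,\dots,r_m\ge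 1$. *)

theory Defs
  imports Complex_Main "HOL-Library.Poly_Mapping" "HOL-Library.Disjoint_Sets"
begin

section \<open>Polynomial rings and their ideals\<close>

text \<open>
  Elements of \<open>('v, 'k) mpoly\<close> are polynomials over \<open>'k\<close> whose indeterminates are arbitrary
  elements of \<open>'v\<close>.  The ring \<open>K[x | x \<in> V]\<close> is the subset \<open>poly_ring V\<close>; all notions
  below are relative to it.
\<close>

type_synonym ('v, 'k) mpoly = "('v \<Rightarrow>\<^sub>0 nat) \<Rightarrow>\<^sub>0 'k"

definition poly_ring :: "'v set \<Rightarrow> ('v, 'k::field) mpoly set" where
  "poly_ring V = {p. \<forall>t\<in>Poly_Mapping.keys p. Poly_Mapping.keys t \<subseteq> V}"

definition var :: "'v \<Rightarrow> ('v, 'k::field) mpoly" where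
  "var x = Poly_Mapping.single (Poly_Mapping.single x 1) 1"

definition mon_degree :: "('v \<Rightarrow>\<^sub>0 nat) \<Rightarrow> nat" where
  "mon_degree t = (\<Sum>x\<in>Poly_Mapping.keys t. Poly_Mapping.lookup t x)"

text \<open>Degrees are integers; a negative degree leaves only the zero polynomial.\<close>

definition homogeneous :: "int \<Rightarrow> ('v, 'k::field) mpoly \<Rightarrow> bool" where
  "homogeneous e p \<longleftrightarrow> (\<forall>t\<in>Poly_Mapping.keys p. int (mon_degree t) = e)"

definition ideal_gen :: "'v set \<Rightarrow> ('v, 'k::field) mpoly set \<Rightarrow> ('v, 'k) mpoly set" where
  "ideal_gen V S =
     {\<Sum>f\<in>A. q f * f | A q. finite A \<and> A \<subseteq> S \<and> q ` A \<subseteq> poly_ring V}"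

definition ideal_power :: "'v set \<Rightarrow> ('v, 'k::field) mpoly set \<Rightarrow> nat \<Rightarrow> ('v, 'k) mpoly set" where
  "ideal_power V I k = ideal_gen V {\<Prod>i<k. f i | f. \<forall>i<k. f i \<in> I}"

definition sqfree_monomials :: "('v, 'k::field) mpoly set" where
  "sqfree_monomials = {Poly_Mapping.single t 1 | t. \<forall>x. Poly_Mapping.lookup t x \<le> 1}"

definition sqfree_power :: "'v set \<Rightarrow> ('v, 'k::field) mpoly set \<Rightarrow> nat \<Rightarrow> ('v, 'k) mpoly set" where
  "sqfree_power V I k = ideal_gen V (sqfree_monomials \<inter> ideal_power V I k)"


section \<open>Minimal graded free resolutions and regularity\<close>

text \<open>
  The data of a complex \<open>\<dots> \<rightarrow> F\<^sub>1 \<rightarrow> F\<^sub>0 \<rightarrow> R\<close> of graded free modules with chosen bases: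
  \<open>F\<^sub>i\<close> is the direct sum of the modules \<open>R(-shift i s)\<close> over \<open>s < rank i\<close>, that is, its basis
  element number \<open>s\<close> lives in degree \<open>shift i s\<close>.  The map \<open>F\<^sub>0 \<rightarrow> R\<close> sends basis element
  \<open>t\<close> to \<open>aug t\<close>, and \<open>diff i s t\<close> is the entry in row \<open>s\<close> and column \<open>t\<close> of the matrix of
  \<open>F\<^sub>i\<^sub>+\<^sub>1 \<rightarrow> F\<^sub>i\<close>.  Values at indices outside the ranks are irrelevant.
\<close>

record (overloaded) ('v, 'k) free_complex =
  rank :: "nat \<Rightarrow> nat"
  shift :: "nat \<Rightarrow> nat \<Rightarrow> int"
  aug :: "nat \<Rightarrow> ('v, 'k) mpoly"
  diff :: "nat \<Rightarrow> nat \<Rightarrow> nat \<Rightarrow> ('v, 'k) mpoly"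

definition free_mod ::
  "'v set \<Rightarrow> ('v, 'k::field) free_complex \<Rightarrow> nat \<Rightarrow> (nat \<Rightarrow> ('v, 'k) mpoly) set" where
  "free_mod V F i =
     {v. (\<forall>s<rank F i. v s \<in> poly_ring V) \<and> (\<forall>s\<ge>rank F i. v s = 0)}"

definition aug_map ::
  "('v, 'k::field) free_complex \<Rightarrow> (nat \<Rightarrow> ('v, 'k) mpoly) \<Rightarrow> ('v, 'k) mpoly" where
  "aug_map F v = (\<Sum>t<rank F 0. aug F t * v t)"

definition diff_map ::
  "('v, 'k::field) free_complex \<Rightarrow> nat \<Rightarrow> (nat \<Rightarrow> ('v, 'k) mpoly) \<Rightarrow> nat \<Rightarrow> ('v, 'k) mpoly" where
  "diff_map F i v =
     (\<lambda>s. if s < rank F i then \<Sum>t<rank F (Suc i). diff F i s t * v t else 0)"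

definition graded_free_resolution ::
  "'v set \<Rightarrow> ('v, 'k::field) mpoly set \<Rightarrow> ('v, 'k) free_complex \<Rightarrow> bool" where
  "graded_free_resolution V J F \<longleftrightarrow>
     (\<forall>t<rank F 0. aug F t \<in> poly_ring V \<and> homogeneous (shift F 0 t) (aug F t)) \<and>
     (\<forall>i. \<forall>s<rank F i. \<forall>t<rank F (Suc i).
        diff F i s t \<in> poly_ring V \<and>
        homogeneous (shift F (Suc i) t - shift F i s) (diff F i s t)) \<and>
     aug_map F ` free_mod V F 0 = J \<and>
     diff_map F 0 ` free_mod V F 1 = {v \<in> free_mod V F 0. aug_map F v = 0} \<and>
     (\<forall>i. diff_map F (Suc i) ` free_mod V F (Suc (Suc i)) =
        {v \<in> free_mod V F (Suc i). diff_map F i v = (\<lambda>_. 0)})"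

text \<open>Minimality: the image of \<open>F\<^sub>i\<^sub>+\<^sub>1\<close> lies in \<open>\<mm>F\<^sub>i\<close>, where \<open>\<mm>\<close> is generated by the variables.\<close>

definition minimal_graded_free_resolution ::
  "'v set \<Rightarrow> ('v, 'k::field) mpoly set \<Rightarrow> ('v, 'k) free_complex \<Rightarrow> bool" where
  "minimal_graded_free_resolution V J F \<longleftrightarrow>
     graded_free_resolution V J F \<and>
     (\<forall>i. \<forall>s<rank F i. \<forall>t<rank F (Suc i). diff F i s t \<in> ideal_gen V (var ` V))"

text \<open>
  The description is meaningful for finite \<open>V\<close> and a graded ideal \<open>J\<close> of \<open>poly_ring V\<close>: then a
  minimal graded free resolution exists and its ranks and shifts do not depend on the choice.
\<close>

definition betti :: "'v set \<Rightarrow> ('v, 'k::field) mpoly set \<Rightarrow> nat \<Rightarrow> int \<Rightarrow> nat" where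
  "betti V J i j =
     (THE n. \<exists>F. minimal_graded_free_resolution V J F \<and>
                 n = card {s. s < rank F i \<and> shift F i s = j})"

definition reg :: "'v set \<Rightarrow> ('v, 'k::field) mpoly set \<Rightarrow> int" where
  "reg V J = Max {j - int i | i j. betti V J i j \<noteq> 0}"


section \<open>Graphs\<close>

type_synonym 'v graph = "'v set \<times> 'v set set"

abbreviation verts :: "'v graph \<Rightarrow> 'v set" where "verts \<equiv> fst"
abbreviation edges :: "'v graph \<Rightarrow> 'v set set" where "edges \<equiv> snd"

definition simple_graph :: "'v graph \<Rightarrow> bool" where
  "simple_graph G \<longleftrightarrow> finite (verts G) \<and> (\<forall>e\<in>edges G. e \<subseteq> verts G \<and> card e = 2)"

definition graph_iso :: "'v graph \<Rightarrow> 'w graph \<Rightarrow> bool" where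
  "graph_iso G H \<longleftrightarrow>
     (\<exists>f. bij_betw f (verts G) (verts H) \<and>
          (\<forall>u\<in>verts G. \<forall>v\<in>verts G. {u, v} \<in> edges G \<longleftrightarrow> {f u, f v} \<in> edges H))"

definition matching :: "'v graph \<Rightarrow> 'v set set \<Rightarrow> bool" where
  "matching G M \<longleftrightarrow> M \<subseteq> edges G \<and> disjoint M"

definition matching_number :: "'v graph \<Rightarrow> nat" where
  "matching_number G = Max {card M | M. matching G M}"

definition edge_ideal :: "'v graph \<Rightarrow> ('v, 'k::field) mpoly set" where
  "edge_ideal G = ideal_gen (verts G) {var x * var y | x y. {x, y} \<in> edges G}"

datatype whisker_vertex = X nat | Y nat nat

definition whiskered_path :: "nat \<Rightarrow> (nat \<Rightarrow> nat) \<Rightarrow> whisker_vertex graph" where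
  "whiskered_path m r =
     (X ` {1..m} \<union> {Y i j | i j. i \<in> {1..m} \<and> j \<in> {1..r i}},
      {{X i, X (Suc i)} | i. 1 \<le> i \<and> i < m} \<union>
      {{X i, Y i j} | i j. i \<in> {1..m} \<and> j \<in> {1..r i}})"

definition whiskered_paths :: "nat \<Rightarrow> 'v graph set" where
  "whiskered_paths m =
     {G. simple_graph G \<and>
         (\<exists>r. (\<forall>i\<in>{1..m}. r i \<ge> 1) \<and> graph_iso G (whiskered_path m r))}"

end

theory Submission
  imports Defs "HOL-Library.Function_Algebras"
begin

text \<open>
  The graded Betti numbers of an ideal \<open>J\<close> are the dimensions of the graded pieces of the Koszul
  homology of \<open>J\<close>: dimension shifting along a minimal resolution identifies the free generators
  in homological degree \<open>i\<close> with Koszul homology in degree \<open>i\<close>.  Conversely, a minimal resolution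
  is built by lifting bases of Koszul homology; it is finitely generated because the Koszul
  homology of a squarefree monomial ideal lives in squarefree multidegrees.  In the squarefree
  multidegree \<open>\<sigma>\<close> one finds the simplicial chains of the sets \<open>S \<subseteq> \<sigma>\<close> for which \<open>\<sigma> - S\<close> still
  contains a \<open>k\<close>-matching.

  The upper bound is an induction on the length of the path that splits off the last spine vertex,
  then its whiskers, then the previous spine vertex; in each case both pieces are complexes of
  shorter paths.  The lower bound is attained on the first \<open>k\<close> spine vertices with one whisker each,
  together with \<open>\<lfloor>(m - k) / 2\<rfloor>\<close> whisker edges, pairwise at distance at least two and away from the
  rest.
\<close>

text \<open>Betti numbers are definite descriptions over all minimal resolutions, so existence of
  one and independence of the choice both have to be proved; counting generators by Koszul homology,
  which refers to the ideal alone, settles both. A class in multidegree \<sigma> carried by sets of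
  size \<open>i\<close> contributes to the Betti number with indices \<open>i\<close> and
  \<open>card \<sigma>\<close>. Hence the combinatorial goal is exactness at \<open>i\<close>
  whenever \<open>i + reg_bound m k < card \<sigma>\<close>, together with one failure at equality.

  The bound 2k + floor((n - k)/2) fits two moves: passing from (n, k) to (n - 1, k - 1) lowers it by
  2, passing from (n, k) to (n - 2, k) lowers it by 1. The obstacle is that faces avoiding the last
  spine vertex leave that vertex available to the matching, which is not the situation of a shorter
  path. It is therefore decomposed further, until this vertex lies in a forced leaf edge or is
  isolated.

  The lower bound uses the upper one: a distant whisker edge raises the degree of a class by one
  because the competing complex, for k - 1, is exact.\<close>

abbreviation lookup where "lookup \<equiv> Poly_Mapping.lookup"

abbreviation keys where "keys \<equiv> Poly_Mapping.keys"

abbreviation single where "single \<equiv> Poly_Mapping.single"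

section \<open>Simplicial chains and acyclicity\<close>

text \<open>The swap rule makes the two orders of removing a pair of elements cancel. The same signs
  serve the simplicial and the Koszul differential, so that comparing the two introduces no further
  signs.\<close>

locale sign_function =
  fixes V :: "'v set" and sg :: "'v \<Rightarrow> 'v set \<Rightarrow> 'k::field"
  assumes finite_V: "finite V"
    and sg_sq: "sg x S * sg x S = 1"
    and sg_swap: "\<lbrakk>S \<subseteq> V; x \<in> V; z \<in> V; x \<noteq> z; x \<notin> S; z \<notin> S\<rbrakk> \<Longrightarrow>
        sg z (insert x S) * sg x S = - (sg x (insert z S) * sg z S)"
begin

lemma sg_sq_left [simp]: "sg x S * (sg x S * a) = a"
  by (metis mult.assoc mult_1 sg_sq)

lemma sg_nonzero [simp]: "sg x S \<noteq> 0"
  using sg_sq by (metis mult_zero_left zero_neq_one)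

text \<open>Grading by cardinality puts the empty set in degree 0, so this is the reduced
  (augmented) complex shifted by one. The degree is an integer because the splitting lemmas pass to
  \<open>i - 1\<close>.\<close>

definition schain :: "'v set \<Rightarrow> ('v set \<Rightarrow> bool) \<Rightarrow> int \<Rightarrow> ('v set \<Rightarrow> 'k) set" where
  "schain \<sigma> \<Psi> i = {f. \<forall>S. f S \<noteq> 0 \<longrightarrow> S \<subseteq> \<sigma> \<and> int (card S) = i \<and> \<Psi> S}"

definition sdiff :: "'v set \<Rightarrow> ('v set \<Rightarrow> 'k) \<Rightarrow> 'v set \<Rightarrow> 'k" where
  "sdiff \<sigma> f S = (\<Sum>x\<in>\<sigma> - S. sg x S * f (insert x S))"

definition acyclic_at :: "'v set \<Rightarrow> ('v set \<Rightarrow> bool) \<Rightarrow> int \<Rightarrow> bool" where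
  "acyclic_at \<sigma> \<Psi> i \<longleftrightarrow>
     (\<forall>f\<in>schain \<sigma> \<Psi> i. (\<forall>S. sdiff \<sigma> f S = 0) \<longrightarrow> (\<exists>g\<in>schain \<sigma> \<Psi> (i + 1). \<forall>S. sdiff \<sigma> g S = f S))"

text \<open>The chain f + x g with f and g living on sets that avoid x. The sign is chosen so that
  removing x from x g returns g itself.\<close>

definition cone_chain :: "'v \<Rightarrow> ('v set \<Rightarrow> 'k) \<Rightarrow> ('v set \<Rightarrow> 'k) \<Rightarrow> 'v set \<Rightarrow> 'k" where
  "cone_chain x f g S = (if x \<in> S then sg x (S - {x}) * g (S - {x}) else f S)"

lemma cone_chain_apply:
  shows "x \<notin> S \<Longrightarrow> cone_chain x f g S = f S"
    and "x \<notin> S \<Longrightarrow> cone_chain x f g (insert x S) = sg x S * g S"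
  by (simp_all add: cone_chain_def)

lemma schain_D:
  assumes "f \<in> schain \<sigma> \<Psi> i"
  shows "\<not> S \<subseteq> \<sigma> \<Longrightarrow> f S = 0" "int (card S) \<noteq> i \<Longrightarrow> f S = 0" "\<not> \<Psi> S \<Longrightarrow> f S = 0"
  using assms unfolding schain_def by blast+

lemma schain_zero [simp]: "(\<lambda>_. 0) \<in> schain \<sigma> \<Psi> i"
  by (simp add: schain_def)

lemma schain_add: "f \<in> schain \<sigma> \<Psi> i \<Longrightarrow> g \<in> schain \<sigma> \<Psi> i \<Longrightarrow> (\<lambda>S. f S + g S) \<in> schain \<sigma> \<Psi> i"
  unfolding schain_def by (smt (verit) add.left_neutral add.right_neutral mem_Collect_eq)

lemma schain_minus: "f \<in> schain \<sigma> \<Psi> i \<Longrightarrow> (\<lambda>S. - f S) \<in> schain \<sigma> \<Psi> i"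
  unfolding schain_def by simp

lemma schain_mono: "f \<in> schain \<sigma> \<Psi> i \<Longrightarrow> (\<And>S. S \<subseteq> \<sigma> \<Longrightarrow> \<Psi> S \<Longrightarrow> \<Phi> S) \<Longrightarrow> f \<in> schain \<sigma> \<Phi> i"
  unfolding schain_def by blast

lemma sdiff_zero [simp]: "sdiff \<sigma> (\<lambda>_. 0) S = 0"
  by (simp add: sdiff_def)

lemma sdiff_add: "sdiff \<sigma> (\<lambda>S. f S + g S) S = sdiff \<sigma> f S + sdiff \<sigma> g S"
  by (simp add: sdiff_def algebra_simps sum.distrib)

lemma sdiff_minus: "sdiff \<sigma> (\<lambda>S. - f S) S = - sdiff \<sigma> f S"
  by (simp add: sdiff_def sum_negf)

lemma acyclic_at_cong:
  assumes "\<And>S. S \<subseteq> \<sigma> \<Longrightarrow> \<Psi> S = \<Phi> S"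
  shows "acyclic_at \<sigma> \<Psi> i = acyclic_at \<sigma> \<Phi> i"
proof -
  have "schain \<sigma> \<Psi> j = schain \<sigma> \<Phi> j" for j
    using assms unfolding schain_def by blast
  then show ?thesis
    by (simp add: acyclic_at_def)
qed

lemma acyclic_at_empty:
  assumes "\<And>S. S \<subseteq> \<sigma> \<Longrightarrow> \<not> \<Psi> S"
  shows "acyclic_at \<sigma> \<Psi> i"
proof -
  have "f = (\<lambda>_. 0)" if "f \<in> schain \<sigma> \<Psi> i" for f
    using that assms unfolding schain_def by blast
  then show ?thesis
    unfolding acyclic_at_def by (metis schain_zero sdiff_zero)
qed

text \<open>The mapping cone formula d(f + x g) = (d f + g) - x (d g). At sets without x, removal of
  x adds the summand g; at sets with x, every other removal passes x and changes sign by the swap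
  rule.\<close>

lemma sdiff_cone_chain:
  assumes "\<sigma> \<subseteq> V" "x \<in> \<sigma>"
    and f: "f \<in> schain (\<sigma> - {x}) \<Psi> i" and g: "g \<in> schain (\<sigma> - {x}) \<Phi> j"
  shows "sdiff \<sigma> (cone_chain x f g) =
    cone_chain x (\<lambda>S. sdiff (\<sigma> - {x}) f S + g S) (\<lambda>S. - sdiff (\<sigma> - {x}) g S)"
proof
  fix S
  have fin: "finite \<sigma>"
    using assms(1) finite_V finite_subset by blast
  show "sdiff \<sigma> (cone_chain x f g) S =
    cone_chain x (\<lambda>S. sdiff (\<sigma> - {x}) f S + g S) (\<lambda>S. - sdiff (\<sigma> - {x}) g S) S"
  proof (cases "x \<in> S")
    case False
    have eq: "\<sigma> - S = insert x (\<sigma> - {x} - S)"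
      using False assms(2) by blast
    have "sdiff \<sigma> (cone_chain x f g) S = sg x S * cone_chain x f g (insert x S) +
      (\<Sum>z\<in>\<sigma> - {x} - S. sg z S * cone_chain x f g (insert z S))"
      unfolding sdiff_def eq using fin by (subst sum.insert) auto
    also have "sg x S * cone_chain x f g (insert x S) = g S"
      using False by (simp add: cone_chain_def)
    also have "(\<Sum>z\<in>\<sigma> - {x} - S. sg z S * cone_chain x f g (insert z S)) = sdiff (\<sigma> - {x}) f S"
      unfolding sdiff_def by (rule sum.cong) (use False in \<open>auto simp: cone_chain_def\<close>)
    finally show ?thesis
      using False by (simp add: cone_chain_apply add.commute)
  next
    case True
    define T where "T = S - {x}"
    have T: "S = insert x T" "x \<notin> T"
      using True by (auto simp: T_def)
    show ?thesis
    proof (cases "T \<subseteq> \<sigma> - {x}")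
      case sub: True
      have "sdiff \<sigma> (cone_chain x f g) S =
        (\<Sum>z\<in>\<sigma> - {x} - T. sg z (insert x T) * (sg x (insert z T) * g (insert z T)))"
        unfolding sdiff_def
      proof (rule sum.cong)
        fix z assume "z \<in> \<sigma> - {x} - T"
        then have "insert z S - {x} = insert z T"
          using T by auto
        then show "sg z S * cone_chain x f g (insert z S) =
            sg z (insert x T) * (sg x (insert z T) * g (insert z T))"
          using T by (simp add: cone_chain_def)
      qed (use T in auto)
      also have "\<dots> = (\<Sum>z\<in>\<sigma> - {x} - T. - sg x T * (sg z T * g (insert z T)))"
      proof (rule sum.cong)
        fix z assume z: "z \<in> \<sigma> - {x} - T"
        then have "sg z (insert x T) * sg x T = - (sg x (insert z T) * sg z T)"
          using assms(1,2) sub T by (intro sg_swap) auto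
        \<comment> \<open>Signs square to one, so multiplying by these two factors moves the signs
          of x to the other side of the swap rule.\<close>
        then have "(sg z (insert x T) * sg x T) * (sg x T * sg x (insert z T)) =
            - (sg x (insert z T) * sg z T) * (sg x T * sg x (insert z T))"
          by simp
        moreover have "(sg z (insert x T) * sg x T) * (sg x T * sg x (insert z T)) =
            sg z (insert x T) * sg x (insert z T)"
          by (simp add: mult.assoc)
        moreover have "- (sg x (insert z T) * sg z T) * (sg x T * sg x (insert z T)) =
            - (sg x (insert z T) * (sg x (insert z T) * (sg z T * sg x T)))"
          by (simp add: mult.commute mult.left_commute mult.assoc del: sg_sq_left)
        ultimately have "sg z (insert x T) * sg x (insert z T) = - (sg z T * sg x T)"
          by simp
        then show "sg z (insert x T) * (sg x (insert z T) * g (insert z T)) =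
            - sg x T * (sg z T * g (insert z T))"
          by (simp add: mult.assoc[symmetric])
      qed simp
      also have "\<dots> = sg x T * - sdiff (\<sigma> - {x}) g T"
        by (simp add: sdiff_def sum_distrib_left[symmetric] sum_negf)
      finally show ?thesis
        using T by (simp add: cone_chain_apply)
    next
      case False
      have 1: "cone_chain x f g (insert z S) = 0" for z
      proof -
        have "\<not> insert z S - {x} \<subseteq> \<sigma> - {x}"
          using False by (auto simp: T_def)
        then show ?thesis
          using True schain_D(1)[OF g] by (simp add: cone_chain_def)
      qed
      have 2: "g (insert z T) = 0" for z
        using False schain_D(1)[OF g] by blast
      show ?thesis
        using True 2 by (simp add: sdiff_def 1) (simp add: cone_chain_def sdiff_def 2 T_def[symmetric])
    qed
  qed
qed

lemma cone_chain_eq_iff: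
  assumes "\<And>S. x \<in> S \<Longrightarrow> f S = 0" "\<And>S. x \<in> S \<Longrightarrow> f' S = 0"
    "\<And>S. x \<in> S \<Longrightarrow> g S = 0" "\<And>S. x \<in> S \<Longrightarrow> g' S = 0"
  shows "cone_chain x f g = cone_chain x f' g' \<longleftrightarrow> f = f' \<and> g = g'"
proof
  assume eq: "cone_chain x f g = cone_chain x f' g'"
  have "f S = f' S" for S
    using fun_cong[OF eq, of S] assms by (cases "x \<in> S") (auto simp: cone_chain_def)
  moreover have "g S = g' S" for S
    using fun_cong[OF eq, of "insert x S"] assms by (cases "x \<in> S") (auto simp: cone_chain_def)
  ultimately show "f = f' \<and> g = g'"
    by blast
qed simp

lemma sdiff_avoid:
  assumes "f \<in> schain (\<sigma> - {x}) \<Psi> i" "x \<in> S"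
  shows "sdiff \<tau> f S = 0" "f S = 0"
proof -
  have "f (insert z S) = 0" for z
    using assms(2) by (intro schain_D(1)[OF assms(1)]) blast
  then show "sdiff \<tau> f S = 0"
    by (simp add: sdiff_def)
  show "f S = 0"
    using assms(2) by (intro schain_D(1)[OF assms(1)]) blast
qed

lemma cone_chain_schain:
  assumes "\<sigma> \<subseteq> V" "x \<in> \<sigma>" and "f \<in> schain (\<sigma> - {x}) \<Psi> i"
    and "g \<in> schain (\<sigma> - {x}) (\<lambda>S. \<Psi> (insert x S)) (i - 1)"
  shows "cone_chain x f g \<in> schain \<sigma> \<Psi> i"
  unfolding schain_def
proof (clarify)
  fix S assume nz: "cone_chain x f g S \<noteq> 0"
  show "S \<subseteq> \<sigma> \<and> int (card S) = i \<and> \<Psi> S"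
  proof (cases "x \<in> S")
    case True
    then have "g (S - {x}) \<noteq> 0"
      using nz by (auto simp: cone_chain_def)
    then have *: "S - {x} \<subseteq> \<sigma> - {x} \<and> int (card (S - {x})) = i - 1 \<and> \<Psi> (insert x (S - {x}))"
      using schain_D[OF assms(4), of "S - {x}"] by blast
    then have "S \<subseteq> \<sigma>"
      using assms(2) by fast
    then have "finite S"
      using finite_subset[OF subset_trans[OF _ assms(1)] finite_V] by simp
    then have "card S = Suc (card (S - {x}))"
      using card_Suc_Diff1[OF _ True] by simp
    then show ?thesis
      using * True \<open>S \<subseteq> \<sigma>\<close> by (simp add: insert_absorb)
  next
    case False
    then have "f S \<noteq> 0"
      using nz by (auto simp: cone_chain_def)
    then show ?thesis
      using assms(3) unfolding schain_def by auto
  qed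
qed

lemma schain_cases:
  assumes "\<sigma> \<subseteq> V" "x \<in> \<sigma>" "h \<in> schain \<sigma> \<Psi> i"
  obtains f g where "f \<in> schain (\<sigma> - {x}) \<Psi> i"
    "g \<in> schain (\<sigma> - {x}) (\<lambda>S. \<Psi> (insert x S)) (i - 1)" "h = cone_chain x f g"
proof
  show "(\<lambda>S. if x \<in> S then 0 else h S) \<in> schain (\<sigma> - {x}) \<Psi> i"
    using assms(3) by (auto simp: schain_def)
  show "(\<lambda>S. if x \<in> S then 0 else sg x S * h (insert x S)) \<in>
      schain (\<sigma> - {x}) (\<lambda>S. \<Psi> (insert x S)) (i - 1)"
    unfolding schain_def
  proof (clarify)
    fix S assume "(if x \<in> S then 0 else sg x S * h (insert x S)) \<noteq> 0"
    then have S: "x \<notin> S" "h (insert x S) \<noteq> 0"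
      by (auto split: if_splits)
    then have *: "insert x S \<subseteq> \<sigma>" "int (card (insert x S)) = i" "\<Psi> (insert x S)"
      using schain_D[OF assms(3)] by blast+
    then have "finite S"
      using assms(1) finite_V finite_subset by (metis finite_insert)
    then show "S \<subseteq> \<sigma> - {x} \<and> int (card S) = i - 1 \<and> \<Psi> (insert x S)"
      using S * by auto
  qed
  show "h = cone_chain x (\<lambda>S. if x \<in> S then 0 else h S)
      (\<lambda>S. if x \<in> S then 0 else sg x S * h (insert x S))"
    by (rule ext) (simp add: cone_chain_def insert_absorb)
qed

lemma sdiff_cone_chain_eq_iff:
  assumes "\<sigma> \<subseteq> V" "x \<in> \<sigma>" "f \<in> schain (\<sigma> - {x}) \<Psi> i" "g \<in> schain (\<sigma> - {x}) \<Phi> j"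
    and "\<And>S. x \<in> S \<Longrightarrow> f' S = 0" "\<And>S. x \<in> S \<Longrightarrow> g' S = 0"
  shows "(\<forall>S. sdiff \<sigma> (cone_chain x f g) S = cone_chain x f' g' S) \<longleftrightarrow>
    (\<forall>S. sdiff (\<sigma> - {x}) f S + g S = f' S) \<and> (\<forall>S. - sdiff (\<sigma> - {x}) g S = g' S)"
proof -
  have "(\<forall>S. sdiff \<sigma> (cone_chain x f g) S = cone_chain x f' g' S) \<longleftrightarrow>
    sdiff \<sigma> (cone_chain x f g) = cone_chain x f' g'"
    by auto
  also have "\<dots> \<longleftrightarrow> (\<lambda>S. sdiff (\<sigma> - {x}) f S + g S) = f' \<and> (\<lambda>S. - sdiff (\<sigma> - {x}) g S) = g'"
    unfolding sdiff_cone_chain[OF assms(1-4)]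
    by (rule cone_chain_eq_iff) (use assms(5,6) sdiff_avoid[OF assms(3)] sdiff_avoid[OF assms(4)] in auto)
  finally show ?thesis
    by (auto simp: fun_eq_iff)
qed

lemma cone_chain_zero [simp]: "cone_chain x (\<lambda>_. 0) (\<lambda>_. 0) = (\<lambda>_. 0)"
  by (auto simp: cone_chain_def)

lemma sdiff_cone_chain_eq_0_iff:
  assumes "\<sigma> \<subseteq> V" "x \<in> \<sigma>" "f \<in> schain (\<sigma> - {x}) \<Psi> i" "g \<in> schain (\<sigma> - {x}) \<Phi> j"
  shows "(\<forall>S. sdiff \<sigma> (cone_chain x f g) S = 0) \<longleftrightarrow>
    (\<forall>S. sdiff (\<sigma> - {x}) f S + g S = 0) \<and> (\<forall>S. sdiff (\<sigma> - {x}) g S = 0)"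
  using sdiff_cone_chain_eq_iff[OF assms, of "\<lambda>_. 0" "\<lambda>_. 0"] by simp

text \<open>Exactness of H_i(deletion) -> H_i -> H_(i-1)(link). In a cycle f0 + x f1 the part f1
  bounds some g1 in the link, and g1 corrects f0 to a cycle of the deletion, filled there by g0;
  then g0 - x g1 fills the original cycle.\<close>

lemma acyclic_at_split:
  assumes "\<sigma> \<subseteq> V" "x \<in> \<sigma>" and down: "\<And>S. \<Psi> (insert x S) \<Longrightarrow> \<Psi> S"
    and del: "acyclic_at (\<sigma> - {x}) \<Psi> i"
    and link: "acyclic_at (\<sigma> - {x}) (\<lambda>S. \<Psi> (insert x S)) (i - 1)"
  shows "acyclic_at \<sigma> \<Psi> i"
  unfolding acyclic_at_def
proof (intro ballI impI)
  fix h assume h: "h \<in> schain \<sigma> \<Psi> i" "\<forall>S. sdiff \<sigma> h S = 0"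
  obtain f0 f1 where f0: "f0 \<in> schain (\<sigma> - {x}) \<Psi> i"
    and f1: "f1 \<in> schain (\<sigma> - {x}) (\<lambda>S. \<Psi> (insert x S)) (i - 1)" and heq: "h = cone_chain x f0 f1"
    using schain_cases[OF assms(1,2) h(1)] by metis
  have cyc: "\<forall>S. sdiff (\<sigma> - {x}) f0 S + f1 S = 0" "\<forall>S. sdiff (\<sigma> - {x}) f1 S = 0"
    using h(2) sdiff_cone_chain_eq_0_iff[OF assms(1,2) f0 f1] unfolding heq by blast+
  obtain g1 where g1: "g1 \<in> schain (\<sigma> - {x}) (\<lambda>S. \<Psi> (insert x S)) i"
    and g1': "\<forall>S. sdiff (\<sigma> - {x}) g1 S = f1 S"
    using link f1 cyc(2) unfolding acyclic_at_def by fastforce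
  have "(\<lambda>S. f0 S + g1 S) \<in> schain (\<sigma> - {x}) \<Psi> i"
    using schain_add f0 schain_mono[OF g1] down by blast
  moreover have "\<forall>S. sdiff (\<sigma> - {x}) (\<lambda>S. f0 S + g1 S) S = 0"
    using cyc(1) g1' by (simp add: sdiff_add)
  ultimately obtain g0 where g0: "g0 \<in> schain (\<sigma> - {x}) \<Psi> (i + 1)"
    and g0': "\<forall>S. sdiff (\<sigma> - {x}) g0 S = f0 S + g1 S"
    using del unfolding acyclic_at_def by blast
  have g1m: "(\<lambda>S. - g1 S) \<in> schain (\<sigma> - {x}) (\<lambda>S. \<Psi> (insert x S)) (i + 1 - 1)"
    using schain_minus[OF g1] by simp
  show "\<exists>g\<in>schain \<sigma> \<Psi> (i + 1). \<forall>S. sdiff \<sigma> g S = h S"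
  proof
    show "cone_chain x g0 (\<lambda>S. - g1 S) \<in> schain \<sigma> \<Psi> (i + 1)"
      by (rule cone_chain_schain[OF assms(1,2) g0 g1m])
    show "\<forall>S. sdiff \<sigma> (cone_chain x g0 (\<lambda>S. - g1 S)) S = h S"
      unfolding heq
      by (subst sdiff_cone_chain_eq_iff[OF assms(1,2) g0 g1m])
        (use sdiff_avoid(2)[OF f0] sdiff_avoid(2)[OF f1] g0' g1' in \<open>auto simp: sdiff_minus\<close>)
  qed
qed

text \<open>Exactness of H_i(link) -> H_i(deletion) -> H_i. If g0 + x g1 fills a cycle of the
  deletion, then g1 is a cycle of the link; writing g1 = d w there, g0 + w is a filling that avoids
  x.\<close>

lemma acyclic_at_deletion:
  assumes "\<sigma> \<subseteq> V" "x \<in> \<sigma>" and down: "\<And>S. \<Psi> (insert x S) \<Longrightarrow> \<Psi> S"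
    and ac: "acyclic_at \<sigma> \<Psi> i"
    and link: "acyclic_at (\<sigma> - {x}) (\<lambda>S. \<Psi> (insert x S)) i"
  shows "acyclic_at (\<sigma> - {x}) \<Psi> i"
  unfolding acyclic_at_def
proof (intro ballI impI)
  fix f assume f: "f \<in> schain (\<sigma> - {x}) \<Psi> i" "\<forall>S. sdiff (\<sigma> - {x}) f S = 0"
  have z: "(\<lambda>_. 0) \<in> schain (\<sigma> - {x}) (\<lambda>S. \<Psi> (insert x S)) (i - 1)"
    by simp
  have "cone_chain x f (\<lambda>_. 0) \<in> schain \<sigma> \<Psi> i"
    by (rule cone_chain_schain[OF assms(1,2) f(1) z])
  moreover have "\<forall>S. sdiff \<sigma> (cone_chain x f (\<lambda>_. 0)) S = 0"
    using sdiff_cone_chain_eq_0_iff[OF assms(1,2) f(1) z] f(2) by simp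
  ultimately obtain h where h: "h \<in> schain \<sigma> \<Psi> (i + 1)"
    and heq: "\<forall>S. sdiff \<sigma> h S = cone_chain x f (\<lambda>_. 0) S"
    using ac unfolding acyclic_at_def by blast
  obtain g0 g1 where g0: "g0 \<in> schain (\<sigma> - {x}) \<Psi> (i + 1)"
    and g1: "g1 \<in> schain (\<sigma> - {x}) (\<lambda>S. \<Psi> (insert x S)) (i + 1 - 1)" and hc: "h = cone_chain x g0 g1"
    using schain_cases[OF assms(1,2) h] by metis
  have *: "\<forall>S. sdiff (\<sigma> - {x}) g0 S + g1 S = f S" "\<forall>S. - sdiff (\<sigma> - {x}) g1 S = 0"
    using heq sdiff_cone_chain_eq_iff[OF assms(1,2) g0 g1, of f "\<lambda>_. 0"] sdiff_avoid(2)[OF f(1)]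
    unfolding hc by simp_all
  have "g1 \<in> schain (\<sigma> - {x}) (\<lambda>S. \<Psi> (insert x S)) i" "\<forall>S. sdiff (\<sigma> - {x}) g1 S = 0"
    using g1 * by simp_all
  then obtain w where w: "w \<in> schain (\<sigma> - {x}) (\<lambda>S. \<Psi> (insert x S)) (i + 1)"
    and w': "\<forall>S. sdiff (\<sigma> - {x}) w S = g1 S"
    using link unfolding acyclic_at_def by blast
  show "\<exists>g\<in>schain (\<sigma> - {x}) \<Psi> (i + 1). \<forall>S. sdiff (\<sigma> - {x}) g S = f S"
  proof
    show "(\<lambda>S. g0 S + w S) \<in> schain (\<sigma> - {x}) \<Psi> (i + 1)"
      by (rule schain_add[OF g0 schain_mono[OF w down]])
  qed (use * w' in \<open>simp add: sdiff_add\<close>)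
qed

text \<open>Exactness of H_i -> H_(i-1)(link) -> H_(i-1)(deletion). A filling g of the link cycle f
  within the deletion makes x f - g a cycle of the whole complex; the x-part of a filling of that
  cycle bounds f in the link up to sign.\<close>

lemma acyclic_at_link:
  assumes "\<sigma> \<subseteq> V" "x \<in> \<sigma>" and down: "\<And>S. \<Psi> (insert x S) \<Longrightarrow> \<Psi> S"
    and ac: "acyclic_at \<sigma> \<Psi> i"
    and del: "acyclic_at (\<sigma> - {x}) \<Psi> (i - 1)"
  shows "acyclic_at (\<sigma> - {x}) (\<lambda>S. \<Psi> (insert x S)) (i - 1)"
  unfolding acyclic_at_def
proof (intro ballI impI)
  fix f assume f: "f \<in> schain (\<sigma> - {x}) (\<lambda>S. \<Psi> (insert x S)) (i - 1)" "\<forall>S. sdiff (\<sigma> - {x}) f S = 0"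
  obtain g where g: "g \<in> schain (\<sigma> - {x}) \<Psi> i" "\<forall>S. sdiff (\<sigma> - {x}) g S = f S"
    using del schain_mono[OF f(1) down] f(2) unfolding acyclic_at_def by fastforce
  have gm: "(\<lambda>S. - g S) \<in> schain (\<sigma> - {x}) \<Psi> i"
    by (rule schain_minus[OF g(1)])
  have "cone_chain x (\<lambda>S. - g S) f \<in> schain \<sigma> \<Psi> i"
    by (rule cone_chain_schain[OF assms(1,2) gm f(1)])
  moreover have "\<forall>S. sdiff \<sigma> (cone_chain x (\<lambda>S. - g S) f) S = 0"
    using sdiff_cone_chain_eq_0_iff[OF assms(1,2) gm f(1)] f(2) g(2) by (simp add: sdiff_minus)
  ultimately obtain h where h: "h \<in> schain \<sigma> \<Psi> (i + 1)"
    and heq: "\<forall>S. sdiff \<sigma> h S = cone_chain x (\<lambda>S. - g S) f S"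
    using ac unfolding acyclic_at_def by blast
  obtain g0 g1 where g0: "g0 \<in> schain (\<sigma> - {x}) \<Psi> (i + 1)"
    and g1: "g1 \<in> schain (\<sigma> - {x}) (\<lambda>S. \<Psi> (insert x S)) (i + 1 - 1)" and hc: "h = cone_chain x g0 g1"
    using schain_cases[OF assms(1,2) h] by metis
  have "\<forall>S. - sdiff (\<sigma> - {x}) g1 S = f S"
    using heq sdiff_cone_chain_eq_iff[OF assms(1,2) g0 g1, of "\<lambda>S. - g S" f]
      sdiff_avoid(2)[OF gm] sdiff_avoid(2)[OF f(1)]
    unfolding hc by simp
  then show "\<exists>g\<in>schain (\<sigma> - {x}) (\<lambda>S. \<Psi> (insert x S)) (i - 1 + 1). \<forall>S. sdiff (\<sigma> - {x}) g S = f S"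
    using schain_minus[OF g1] by (intro bexI[of _ "\<lambda>S. - g1 S"]) (simp_all add: sdiff_minus)
qed

text \<open>A vertex that may be added to every face is a cone apex. For a cycle f0 + x f1 one has d
  f0 = - f1, hence d(x f0) = f0 - x (d f0) is the cycle itself.\<close>

lemma acyclic_at_cone:
  assumes "\<sigma> \<subseteq> V" "x \<in> \<sigma>"
    and cone: "\<And>S. S \<subseteq> \<sigma> \<Longrightarrow> x \<notin> S \<Longrightarrow> \<Psi> S \<Longrightarrow> \<Psi> (insert x S)"
  shows "acyclic_at \<sigma> \<Psi> i"
  unfolding acyclic_at_def
proof (intro ballI impI)
  fix h assume h: "h \<in> schain \<sigma> \<Psi> i" "\<forall>S. sdiff \<sigma> h S = 0"
  obtain f0 f1 where f0: "f0 \<in> schain (\<sigma> - {x}) \<Psi> i"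
    and f1: "f1 \<in> schain (\<sigma> - {x}) (\<lambda>S. \<Psi> (insert x S)) (i - 1)" and heq: "h = cone_chain x f0 f1"
    using schain_cases[OF assms(1,2) h(1)] by metis
  have cyc: "\<forall>S. sdiff (\<sigma> - {x}) f0 S + f1 S = 0" "\<forall>S. sdiff (\<sigma> - {x}) f1 S = 0"
    using h(2) sdiff_cone_chain_eq_0_iff[OF assms(1,2) f0 f1] unfolding heq by blast+
  have f0': "f0 \<in> schain (\<sigma> - {x}) (\<lambda>S. \<Psi> (insert x S)) (i + 1 - 1)"
    using f0 cone unfolding schain_def by (smt (verit) Diff_subset dual_order.trans mem_Collect_eq
        schain_D(1)[OF f0] subset_Diff_insert)
  have z: "(\<lambda>_. 0) \<in> schain (\<sigma> - {x}) \<Psi> (i + 1)"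
    by simp
  show "\<exists>g\<in>schain \<sigma> \<Psi> (i + 1). \<forall>S. sdiff \<sigma> g S = h S"
  proof
    show "cone_chain x (\<lambda>_. 0) f0 \<in> schain \<sigma> \<Psi> (i + 1)"
      by (rule cone_chain_schain[OF assms(1,2) z f0'])
    show "\<forall>S. sdiff \<sigma> (cone_chain x (\<lambda>_. 0) f0) S = h S"
      unfolding heq
      by (subst sdiff_cone_chain_eq_iff[OF assms(1,2) z f0'])
        (use sdiff_avoid(2)[OF f0] sdiff_avoid(2)[OF f1] cyc(1) in
          \<open>auto simp: add_eq_0_iff\<close>)
  qed
qed

end

text \<open>The usual sign, -1 to the number of elements that precede x. Of two elements exactly one
  precedes the other, so inserting them in the two orders differs by one minus.\<close>

lemma sign_function_exists:
  assumes "finite V"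
  shows "\<exists>sg :: 'v \<Rightarrow> 'v set \<Rightarrow> 'k::field. sign_function V sg"
proof -
  obtain idx :: "'v \<Rightarrow> nat" where idx: "inj_on idx V"
    using finite_imp_inj_to_nat_seg[OF assms] by blast
  define sg :: "'v \<Rightarrow> 'v set \<Rightarrow> 'k" where "sg x S = (-1) ^ card {y \<in> S. idx y < idx x}" for x S
  have step: "sg z (insert x S) = (if idx x < idx z then - sg z S else sg z S)"
    if "S \<subseteq> V" "x \<notin> S" for x z S
  proof -
    have "finite {y \<in> S. idx y < idx z}"
      using that assms finite_subset by fastforce
    moreover have "{y \<in> insert x S. idx y < idx z} =
        (if idx x < idx z then insert x {y \<in> S. idx y < idx z} else {y \<in> S. idx y < idx z})"
      by auto
    ultimately show ?thesis
      using that by (auto simp: sg_def)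
  qed
  have "sign_function V sg"
  proof
    show "sg x S * sg x S = 1" for x S
      by (simp add: sg_def flip: power_add)
    fix S x z assume S: "S \<subseteq> V" "x \<in> V" "z \<in> V" "x \<noteq> z" "x \<notin> S" "z \<notin> S"
    then have "idx x < idx z \<longleftrightarrow> \<not> idx z < idx x"
      using inj_onD[OF idx] by (metis linorder_neqE_nat order_less_asym)
    then show "sg z (insert x S) * sg x S = - (sg x (insert z S) * sg z S)"
      using S step[of S x z] step[of S z x] by (auto simp: mult.commute)
  qed (rule assms)
  then show ?thesis
    by blast
qed

section \<open>Matchings of whiskered paths\<close>

definition has_matching :: "'v set set \<Rightarrow> nat \<Rightarrow> 'v set \<Rightarrow> bool" where
  "has_matching E k \<tau> \<longleftrightarrow> (\<exists>M. M \<subseteq> E \<and> disjoint M \<and> finite M \<and> card M = k \<and> \<Union>M \<subseteq> \<tau>)"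

lemma has_matchingI:
  "M \<subseteq> E \<Longrightarrow> disjoint M \<Longrightarrow> finite M \<Longrightarrow> card M = k \<Longrightarrow> \<Union>M \<subseteq> \<tau> \<Longrightarrow> has_matching E k \<tau>"
  by (auto simp: has_matching_def)

lemma has_matching_mono: "has_matching E k \<tau> \<Longrightarrow> \<tau> \<subseteq> \<tau>' \<Longrightarrow> has_matching E k \<tau>'"
  unfolding has_matching_def by blast

lemma has_matching_0 [simp]: "has_matching E 0 \<tau>"
  by (rule has_matchingI[of "{}"]) (auto simp: disjoint_def)

lemma disjoint_subset: "disjoint M \<Longrightarrow> N \<subseteq> M \<Longrightarrow> disjoint N"
  by (auto simp: disjoint_def)

lemma has_matching_le:
  assumes "M \<subseteq> E" "disjoint M" "finite M" "k \<le> card M" "\<Union>M \<subseteq> \<tau>"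
  shows "has_matching E k \<tau>"
proof -
  obtain N where N: "N \<subseteq> M" "card N = k" "finite N"
    by (rule obtain_subset_with_card_n[OF assms(4)])
  show ?thesis
  proof (rule has_matchingI)
    show "disjoint N"
      by (rule disjoint_subset[OF assms(2) N(1)])
  qed (use N assms in auto)
qed

lemma has_matching_insert:
  assumes "has_matching E k \<tau>" "{u, v} \<in> E" "u \<notin> \<tau>" "v \<notin> \<tau>"
  shows "has_matching E (Suc k) (insert u (insert v \<tau>))"
proof -
  obtain M where M: "M \<subseteq> E" "disjoint M" "finite M" "card M = k" "\<Union>M \<subseteq> \<tau>"
    using assms(1) unfolding has_matching_def by blast
  have "{u, v} \<notin> M"
    using M(5) assms(3) by blast
  moreover have "disjoint (insert {u, v} M)"
    unfolding disjoint_def using M(2,5) assms(3,4) by (auto simp: disjoint_def)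
  ultimately show ?thesis
    using M assms(2) by (intro has_matchingI[of "insert {u, v} M"]) auto
qed

context
  fixes E :: "'v set set"
  assumes card_edge: "\<And>e. e \<in> E \<Longrightarrow> card e = 2"
begin

lemma edge_cases:
  assumes "e \<in> E" "v \<in> e"
  obtains u where "e = {v, u}" "u \<noteq> v"
proof -
  obtain a b where "e = {a, b}" "a \<noteq> b"
    using card_edge[OF assms(1)] by (auto simp: card_2_iff)
  then show ?thesis
    using assms(2) that[of a] that[of b] by auto
qed

lemma has_matching_isolated:
  assumes "\<And>u. u \<in> \<tau> \<Longrightarrow> {v, u} \<notin> E"
  shows "has_matching E k (insert v \<tau>) \<longleftrightarrow> has_matching E k \<tau>"
proof
  assume "has_matching E k (insert v \<tau>)"
  then obtain M where M: "M \<subseteq> E" "disjoint M" "finite M" "card M = k" "\<Union>M \<subseteq> insert v \<tau>"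
    unfolding has_matching_def by blast
  have "v \<notin> e" if "e \<in> M" for e
  proof
    assume "v \<in> e"
    moreover have "e \<in> E"
      using that M(1) by blast
    ultimately obtain u where "e = {v, u}" "u \<noteq> v"
      using edge_cases by metis
    then show False
      using assms[of u] that M(1,5) by blast
  qed
  then show "has_matching E k \<tau>"
    using M by (intro has_matchingI[of M]) auto
qed (auto elim: has_matching_mono)

text \<open>Within the available vertices an edge at the leaf \<open>v\<close> must use
  \<open>w\<close>. Dropping the at most one edge through \<open>w\<close> therefore frees both
  vertices at the cost of a single edge.\<close>

lemma has_matching_leaf:
  assumes "{v, w} \<in> E" "v \<notin> \<tau>" "w \<notin> \<tau>" and leaf: "\<And>u. u \<in> \<tau> \<Longrightarrow> {v, u} \<notin> E"
  shows "has_matching E (Suc k) (insert v (insert w \<tau>)) \<longleftrightarrow> has_matching E k \<tau>"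
proof
  assume "has_matching E (Suc k) (insert v (insert w \<tau>))"
  then obtain M where M: "M \<subseteq> E" "disjoint M" "finite M" "card M = Suc k"
    "\<Union>M \<subseteq> insert v (insert w \<tau>)"
    unfolding has_matching_def by blast
  define N where "N = {e \<in> M. w \<notin> e}"
  have vw: "w \<in> e" if e: "e \<in> M" "v \<in> e" for e
  proof -
    have "e \<in> E"
      using e M(1) by blast
    then obtain u where "e = {v, u}" "u \<noteq> v"
      using edge_cases e(2) by metis
    then show ?thesis
      using leaf[of u] e M(1,5) by blast
  qed
  have "e = e'" if "e \<in> M" "w \<in> e" "e' \<in> M" "w \<in> e'" for e e'
    using M(2) that unfolding disjoint_def by blast
  then have "M - N \<subseteq> {} \<or> (\<exists>e. M - N \<subseteq> {e})"
    unfolding N_def by blast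
  then have "card (M - N) \<le> 1"
    by (metis bot.extremum_uniqueI card.empty card_mono finite.emptyI finite.insertI is_singletonI
        is_singleton_altdef zero_le)
  moreover have "card M \<le> card N + card (M - N)"
    using M(3) by (metis card_Un_le N_def Un_Diff_cancel mem_Collect_eq subsetI sup.absorb_iff2)
  ultimately have "k \<le> card N"
    using M(4) by simp
  moreover have "\<Union>N \<subseteq> \<tau>"
    using M(5) vw unfolding N_def by blast
  ultimately show "has_matching E k \<tau>"
    using M(1,3) disjoint_subset[OF M(2), of N] by (intro has_matching_le[of N]) (auto simp: N_def)
next
  assume "has_matching E k \<tau>"
  then show "has_matching E (Suc k) (insert v (insert w \<tau>))"
    by (rule has_matching_insert) (rule assms)+
qed

lemma has_matching_card:
  assumes "has_matching E k \<tau>" "finite \<tau>"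
  shows "2 * k \<le> card \<tau>"
proof -
  obtain M where M: "M \<subseteq> E" "disjoint M" "finite M" "card M = k" "\<Union>M \<subseteq> \<tau>"
    using assms(1) unfolding has_matching_def by blast
  have fin: "finite e" if "e \<in> M" for e
    using card_edge that M(1) by (metis card.infinite subsetD zero_neq_numeral)
  have "card (\<Union>M) = sum card M"
    using card_Union_disjoint[of M] M(2) fin by (simp add: disjoint_def pairwise_def disjnt_def)
  also have "\<dots> = 2 * k"
    using card_edge M(1,4) by (simp add: subset_iff)
  finally show ?thesis
    using card_mono[OF assms(2) M(5)] by simp
qed

end

context sign_function
begin

text \<open>For k = 0 every subset is a face. A full simplex is a cone unless it is empty, and then
  the bound forces a negative degree, where there are no chains.\<close>

lemma acyclic_at_has_matching_0:
  assumes "\<sigma> \<subseteq> V" "i < int (card \<sigma>)"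
  shows "acyclic_at \<sigma> (\<lambda>S. has_matching E 0 (\<sigma> - S)) i"
proof (cases "\<sigma> = {}")
  case True
  then have "f = (\<lambda>_. 0)" if "f \<in> schain \<sigma> \<Psi> i" for f \<Psi>
    using schain_D(2)[OF that] assms(2) by (intro ext) simp
  then show ?thesis
    unfolding acyclic_at_def by (metis schain_zero sdiff_zero)
next
  case False
  then obtain x where "x \<in> \<sigma>"
    by blast
  then show ?thesis
    by (intro acyclic_at_cone[OF assms(1)]) simp_all
qed

text \<open>No matching uses an isolated vertex, so removing it never destroys one: the vertex is a
  cone apex.\<close>

lemma acyclic_at_isolated:
  assumes "\<And>e. e \<in> E \<Longrightarrow> card e = 2"
    and "\<sigma> \<subseteq> V" "v \<in> \<sigma>" "\<And>u. u \<in> \<sigma> \<Longrightarrow> {v, u} \<notin> E"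
  shows "acyclic_at \<sigma> (\<lambda>S. has_matching E k (\<sigma> - S)) i"
proof (rule acyclic_at_cone[OF assms(2,3)])
  fix S assume S: "S \<subseteq> \<sigma>" "v \<notin> S" "has_matching E k (\<sigma> - S)"
  then have "\<sigma> - S = insert v (\<sigma> - insert v S)"
    using assms(3) by blast
  then show "has_matching E k (\<sigma> - insert v S)"
    using S(3) has_matching_isolated[where E = E and \<tau> = "\<sigma> - insert v S" and v = v and k = k, OF assms(1)] assms(4) by auto
qed

end

section \<open>Exactness above the bound for whiskered paths\<close>

text \<open>\<open>lev\<close> is the index of the spine vertex to which a vertex belongs; the
  induction on the length of the path truncates by it. All whiskers are kept, while
  \<open>y j\<close> singles out one of them at \<open>x j\<close> for the lower bound.\<close>

locale whiskered_path_graph = sign_function V sg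
  for V :: "'v set" and sg :: "'v \<Rightarrow> 'v set \<Rightarrow> 'k::field" +
  fixes E :: "'v set set" and m :: nat and lev :: "'v \<Rightarrow> nat" and x y :: "nat \<Rightarrow> 'v"
  assumes card_E: "e \<in> E \<Longrightarrow> card e = 2"
    and E_sub: "e \<in> E \<Longrightarrow> e \<subseteq> V"
    and lev_range: "v \<in> V \<Longrightarrow> lev v \<in> {1..m}"
    and x_V: "j \<in> {1..m} \<Longrightarrow> x j \<in> V \<and> lev (x j) = j"
    and y_V: "j \<in> {1..m} \<Longrightarrow> y j \<in> V \<and> lev (y j) = j \<and> y j \<noteq> x j"
    and whisker: "v \<in> V \<Longrightarrow> v \<noteq> x (lev v) \<Longrightarrow> {v, x (lev v)} \<in> E"
    and whisker_only: "v \<in> V \<Longrightarrow> v \<noteq> x (lev v) \<Longrightarrow> {v, w} \<in> E \<Longrightarrow> w = x (lev v)"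
    and spine: "1 \<le> j \<Longrightarrow> j < m \<Longrightarrow> {x j, x (Suc j)} \<in> E"
    and spine_only: "{x i, x j} \<in> E \<Longrightarrow> i \<in> {1..m} \<Longrightarrow> j \<in> {1..m} \<Longrightarrow> i = Suc j \<or> j = Suc i"
begin

abbreviation acyc :: "nat \<Rightarrow> 'v set \<Rightarrow> int \<Rightarrow> bool" where
  "acyc k \<sigma> i \<equiv> acyclic_at \<sigma> (\<lambda>S. has_matching E k (\<sigma> - S)) i"

lemma finite_sub: "\<sigma> \<subseteq> V \<Longrightarrow> finite \<sigma>"
  using finite_V by (rule rev_finite_subset)

text \<open>The spine is a vertex cover, since the only neighbour of a whisker is its spine
  vertex.\<close>

lemma edge_meets_spine:
  assumes "e \<in> E" "\<And>v. v \<in> e \<Longrightarrow> lev v \<le> n"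
  obtains j where "j \<in> {1..n}" "x j \<in> e"
proof -
  obtain u v where e: "e = {u, v}"
    using card_E[OF assms(1)] by (auto simp: card_2_iff)
  then have uv: "u \<in> V" "v \<in> V"
    using E_sub assms(1) by auto
  show ?thesis
  proof (cases "u = x (lev u)")
    case True
    then show ?thesis
      using that[of "lev u"] assms(2)[of u] lev_range[OF uv(1)] e by auto
  next
    case False
    then have "v = x (lev u)"
      using whisker_only uv(1) assms(1) e by blast
    then show ?thesis
      using that[of "lev u"] assms(2)[of u] lev_range[OF uv(1)] e by auto
  qed
qed

text \<open>Disjoint edges meet the vertex cover formed by the first \<open>n\<close> spine vertices
  in different vertices.\<close>

lemma has_matching_lev_bound:
  assumes "has_matching E k \<tau>" "\<And>v. v \<in> \<tau> \<Longrightarrow> lev v \<le> n"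
  shows "k \<le> n"
proof -
  obtain M where M: "M \<subseteq> E" "disjoint M" "finite M" "card M = k" "\<Union>M \<subseteq> \<tau>"
    using assms(1) unfolding has_matching_def by blast
  have "\<exists>j. j \<in> {1..n} \<and> x j \<in> e" if "e \<in> M" for e
  proof -
    have "e \<in> E" "\<And>v. v \<in> e \<Longrightarrow> lev v \<le> n"
      using that M(1,5) assms(2) by blast+
    then show ?thesis
      using edge_meets_spine by blast
  qed
  then obtain h where h: "\<And>e. e \<in> M \<Longrightarrow> h e \<in> {1..n} \<and> x (h e) \<in> e"
    by metis
  have "inj_on h M"
    using h M(2) unfolding inj_on_def disjoint_def by (metis disjoint_iff)
  then have "card M \<le> card {1..n}"
    using h by (intro card_inj_on_le[of h]) auto
  then show ?thesis
    using M(4) by simp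
qed

definition reg_bound :: "nat \<Rightarrow> nat \<Rightarrow> int" where
  "reg_bound n k = 2 * int k + int ((n - k) div 2)"

text \<open>The numerical condition is imposed for k \<le> n only, where the subtraction in
  \<open>reg_bound\<close> is a true one. For k > n there is no k-matching, hence no face, and
  exactness holds in every degree.\<close>

definition acyc_upto :: "nat \<Rightarrow> nat \<Rightarrow> bool" where
  "acyc_upto n k \<longleftrightarrow> (\<forall>\<sigma> i. \<sigma> \<subseteq> V \<longrightarrow> (\<forall>v\<in>\<sigma>. lev v \<le> n) \<longrightarrow>
     (k \<le> n \<longrightarrow> i + reg_bound n k < int (card \<sigma>)) \<longrightarrow> acyc k \<sigma> i)"

text \<open>A whisker of level \<open>n\<close> has lost its only neighbour and yields a cone;
  without such whiskers \<sigma> lies in the shorter path already.\<close>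

lemma acyc_avoid_spine:
  assumes ac: "acyc_upto (n - 1) k" and "n = 0 \<or> x n \<notin> \<sigma>" "\<sigma> \<subseteq> V" "\<forall>v\<in>\<sigma>. lev v \<le> n"
    and "k \<le> n - 1 \<Longrightarrow> i + reg_bound (n - 1) k < int (card \<sigma>)"
  shows "acyc k \<sigma> i"
proof (cases "\<forall>v\<in>\<sigma>. lev v \<le> n - 1")
  case True
  then show ?thesis
    using ac assms(3,5) unfolding acyc_upto_def by blast
next
  case False
  then obtain v where v: "v \<in> \<sigma>" "lev v = n" "n \<noteq> 0"
    using assms(4) by force
  then have "v \<noteq> x (lev v)" "v \<in> V"
    using assms(2,3) by auto
  then have "{v, u} \<notin> E" if "u \<in> \<sigma>" for u
    using whisker_only[of v u] that assms(2) v by auto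
  then show ?thesis
    using acyclic_at_isolated[OF card_E assms(3) v(1)] by blast
qed

lemma spine_not_adjacent:
  assumes "n \<in> {1..m}" "u \<in> V" "lev u < n" "u \<noteq> x (n - 1)"
  shows "{x n, u} \<notin> E"
proof
  assume e: "{x n, u} \<in> E"
  show False
  proof (cases "u = x (lev u)")
    case True
    then have "{x n, x (lev u)} \<in> E"
      using e by simp
    then have "n = Suc (lev u) \<or> lev u = Suc n"
      using spine_only[of n "lev u"] assms(1) lev_range[OF assms(2)] by blast
    then show False
      using assms(3,4) True by auto
  next
    case False
    then have "x n = x (lev u)"
      using whisker_only[OF assms(2) False, of "x n"] e by (simp add: insert_commute)
    then show False
      using x_V[OF assms(1)] x_V[OF lev_range[OF assms(2)]] assms(3) by simp
  qed
qed

lemma has_matching_no_neighbour: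
  assumes "n \<in> {1..m}" "\<tau> \<subseteq> V" "\<forall>v\<in>\<tau>. lev v < n" "x (n - 1) \<notin> \<tau>"
  shows "has_matching E k (insert (x n) \<tau>) \<longleftrightarrow> has_matching E k \<tau>"
proof (rule has_matching_isolated[OF card_E])
  fix u assume "u \<in> \<tau>"
  then show "{x n, u} \<notin> E"
    using assms by (intro spine_not_adjacent) auto
qed simp

text \<open>This is the deletion of \<open>x n\<close>: the vertex stays available to the matching
  but is not counted in \<open>card \<sigma>\<close>, whence the nonstrict inequality. Its whiskers
  are split off one at a time, which is the induction on \<open>card \<sigma>\<close>; once they are
  gone, \<open>x n\<close> has at most the neighbour \<open>x (n - 1)\<close>, which is split off
  last.\<close>

lemma acyc_with_spine:
  assumes ac: "\<And>j. acyc_upto (n - 1) j" "\<And>j. acyc_upto (n - 1 - 1) j"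
    and n: "n \<in> {1..m}" and k: "1 \<le> k" "k \<le> n"
    and "x n \<notin> \<sigma>" "\<sigma> \<subseteq> V" "\<forall>v\<in>\<sigma>. lev v \<le> n" "i + reg_bound n k \<le> int (card \<sigma>)"
  shows "acyclic_at \<sigma> (\<lambda>S. has_matching E k (insert (x n) (\<sigma> - S))) i"
  using assms(6-)
proof (induction "card \<sigma>" arbitrary: \<sigma> i rule: less_induct)
  case less
  obtain k' where k': "k = Suc k'"
    using k(1) by (cases k) auto
  note fin = finite_sub[OF less.prems(2)]
  show ?case
  proof (cases "\<exists>v\<in>\<sigma>. lev v = n")
    case True
    then obtain v where v: "v \<in> \<sigma>" "lev v = n"
      by blast
    then have vV: "v \<in> V" "v \<noteq> x n"
      using less.prems by auto
    have card: "int (card (\<sigma> - {v})) = int (card \<sigma>) - 1"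
      using card_Suc_Diff1[OF fin v(1)] by simp
    \<comment> \<open>With \<open>v\<close> still present, the leaf edge from \<open>v\<close> to
      \<open>x n\<close> may be assumed in the matching. This leaves \<open>k - 1\<close> edges on a
      set without \<open>x n\<close>, and \<open>reg_bound (n - 1) (k - 1)\<close> is
      \<open>reg_bound n k - 2\<close>.\<close>
    have "acyclic_at (\<sigma> - {v}) (\<lambda>S. has_matching E k' (\<sigma> - {v} - S)) i"
    proof (rule acyc_avoid_spine[OF ac(1)])
      show "i + reg_bound (n - 1) k' < int (card (\<sigma> - {v}))"
        using less.prems(4) k k' unfolding card reg_bound_def by simp
    qed (use less.prems in auto)
    moreover have "has_matching E k (insert (x n) (\<sigma> - S)) \<longleftrightarrow> has_matching E k' (\<sigma> - {v} - S)"
      if "S \<subseteq> \<sigma> - {v}" for S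
    proof -
      have "insert (x n) (\<sigma> - S) = insert v (insert (x n) (\<sigma> - {v} - S))"
        using that v(1) by blast
      moreover have "{v, x n} \<in> E"
        using whisker[OF vV(1)] v(2) vV(2) by simp
      moreover have "{v, u} \<notin> E" if "u \<in> \<sigma> - {v} - S" for u
        using whisker_only[OF vV(1), of u] v(2) vV(2) that less.prems(1) by auto
      ultimately show ?thesis
        unfolding k' using has_matching_leaf[where v = v and w = "x n" and \<tau> = "\<sigma> - {v} - S" and k = k', OF card_E] less.prems(1) by simp
    qed
    ultimately have del: "acyclic_at (\<sigma> - {v}) (\<lambda>S. has_matching E k (insert (x n) (\<sigma> - S))) i"
      by (subst acyclic_at_cong) auto
    \<comment> \<open>With \<open>v\<close> removed, the situation is the same with one whisker
      less; degree and cardinality both drop by one.\<close>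
    have "acyclic_at (\<sigma> - {v}) (\<lambda>S. has_matching E k (insert (x n) (\<sigma> - {v} - S))) (i - 1)"
    proof (rule less.hyps)
      show "card (\<sigma> - {v}) < card \<sigma>"
        using card by simp
      show "i - 1 + reg_bound n k \<le> int (card (\<sigma> - {v}))"
        using card less.prems(4) by simp
    qed (use less.prems in auto)
    then have link: "acyclic_at (\<sigma> - {v}) (\<lambda>S. has_matching E k (insert (x n) (\<sigma> - insert v S))) (i - 1)"
      by (simp add: Diff_insert2[symmetric])
    show ?thesis
      by (rule acyclic_at_split[OF less.prems(2) v(1) _ del link])
        (erule has_matching_mono, blast)
  next
    case False
    then have low: "\<forall>v\<in>\<sigma>. lev v < n"
      using less.prems(3) by (metis le_neq_implies_less)
    show ?thesis
    proof (cases "n = 1 \<or> x (n - 1) \<notin> \<sigma>")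
      case True
      \<comment> \<open>For n = 1 all levels in \<sigma> would be below 1, so \<sigma> is empty;
        nothing has to be known about \<open>x 0\<close>.\<close>
      have nx: "x (n - 1) \<notin> \<sigma>"
      proof (cases "n = 1")
        case True
        then show ?thesis
          using low lev_range less.prems(2) by fastforce
      qed (use True in simp)
      have "acyc k \<sigma> i"
      proof (rule acyc_avoid_spine[OF ac(2)])
        show "i + reg_bound (n - 1 - 1) k < int (card \<sigma>)" if "k \<le> n - 1 - 1"
        proof -
          \<comment> \<open>The drop by one turns the nonstrict hypothesis into the strict bound
            required for the path shortened by two.\<close>
          have "reg_bound (n - 1 - 1) k + 1 = reg_bound n k"
          proof -
            have "n - k = Suc (Suc (n - 1 - 1 - k))"
              using that k by linarith
            then show ?thesis
              by (simp add: reg_bound_def)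
          qed
          then show ?thesis
            using less.prems(4) by simp
        qed
      qed (use less.prems nx low in auto)
      moreover have "has_matching E k (insert (x n) (\<sigma> - S)) \<longleftrightarrow> has_matching E k (\<sigma> - S)" for S
        by (rule has_matching_no_neighbour[OF n]) (use less.prems low nx in auto)
      ultimately show ?thesis
        by simp
    next
      case False
      define z where "z = x (n - 1)"
      have z: "z \<in> \<sigma>" "n \<noteq> 1"
        using False by (auto simp: z_def)
      have n1: "n - 1 \<in> {1..m}"
        using n z(2) by auto
      have card: "int (card (\<sigma> - {z})) = int (card \<sigma>) - 1"
        using card_Suc_Diff1[OF fin z(1)] by simp
      \<comment> \<open>With \<open>z\<close> present, \<open>x n\<close> is a leaf at
        \<open>z\<close>, and \<open>k - 1\<close> edges have to be found without either spine
        vertex. The bound for (n - 2, k - 1) is at most \<open>reg_bound n k - 2\<close>.\<close>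
      have "acyclic_at (\<sigma> - {z}) (\<lambda>S. has_matching E k' (\<sigma> - {z} - S)) i"
      proof (rule acyc_avoid_spine[OF ac(2)])
        show "i + reg_bound (n - 1 - 1) k' < int (card (\<sigma> - {z}))"
          using less.prems(4) k k' unfolding card reg_bound_def by simp
      qed (use less.prems low in \<open>auto simp: z_def\<close>)
      moreover have "has_matching E k (insert (x n) (\<sigma> - S)) \<longleftrightarrow> has_matching E k' (\<sigma> - {z} - S)"
        if "S \<subseteq> \<sigma> - {z}" for S
      proof -
        have "insert (x n) (\<sigma> - S) = insert (x n) (insert z (\<sigma> - {z} - S))"
          using that z(1) by blast
        moreover have "{x n, z} \<in> E"
          using spine[of "n - 1"] n z(2) by (auto simp: z_def insert_commute)
        moreover have "{x n, u} \<notin> E" if "u \<in> \<sigma> - {z} - S" for u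
          by (rule spine_not_adjacent[OF n]) (use that less.prems(2) low in \<open>auto simp: z_def\<close>)
        ultimately show ?thesis
          unfolding k' using has_matching_leaf[where v = "x n" and w = z and \<tau> = "\<sigma> - {z} - S" and k = k', OF card_E] less.prems(1) by simp
      qed
      ultimately have del: "acyclic_at (\<sigma> - {z}) (\<lambda>S. has_matching E k (insert (x n) (\<sigma> - S))) i"
        by (subst acyclic_at_cong) auto
      \<comment> \<open>With \<open>z\<close> removed, \<open>x n\<close> is isolated, so all
        \<open>k\<close> edges lie in the path shortened by two, whose bound is smaller by
        one.\<close>
      have "acyc k (\<sigma> - {z}) (i - 1)"
      proof (rule acyc_avoid_spine[OF ac(2)])
        show "i - 1 + reg_bound (n - 1 - 1) k < int (card (\<sigma> - {z}))" if "k \<le> n - 1 - 1"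
        proof -
          have "n - k = Suc (Suc (n - 1 - 1 - k))"
            using that k z(2) by linarith
          then have "reg_bound (n - 1 - 1) k + 1 = reg_bound n k"
            by (simp add: reg_bound_def)
          then show ?thesis
            using less.prems(4) card by simp
        qed
      qed (use less.prems low in \<open>auto simp: z_def\<close>)
      moreover have "has_matching E k (insert (x n) (\<sigma> - insert z S)) \<longleftrightarrow> has_matching E k (\<sigma> - {z} - S)" for S
        by (subst has_matching_no_neighbour[OF n])
          (use less.prems low in \<open>auto simp: z_def Diff_insert2[symmetric]\<close>)
      ultimately have link: "acyclic_at (\<sigma> - {z}) (\<lambda>S. has_matching E k (insert (x n) (\<sigma> - insert z S))) (i - 1)"
        by simp
      show ?thesis
        by (rule acyclic_at_split[OF less.prems(2) z(1) _ del link])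
          (erule has_matching_mono, blast)
    qed
  qed
qed

text \<open>The induction is strong because the deletion of \<open>x n\<close> refers back to both n
  - 1 and n - 2. In the link of \<open>x n\<close> this vertex is lost, and the bound for n - 1 does
  not exceed the one for n.\<close>

lemma acyc_upto_all: "n \<le> m \<Longrightarrow> acyc_upto n k"
proof (induction n arbitrary: k rule: less_induct)
  case (less n k)
  show ?case
    unfolding acyc_upto_def
  proof (intro allI impI)
    fix \<sigma> i
    assume \<sigma>: "\<sigma> \<subseteq> V" and lev: "\<forall>v\<in>\<sigma>. lev v \<le> n"
      and bound: "k \<le> n \<longrightarrow> i + reg_bound n k < int (card \<sigma>)"
    consider "k = 0" | "k > n" | "1 \<le> k" "k \<le> n"
      by linarith
    then show "acyc k \<sigma> i"
    proof cases
      case 1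
      then have "i < int (card \<sigma>)"
        using bound by (simp add: reg_bound_def)
      then show ?thesis
        unfolding 1 by (rule acyclic_at_has_matching_0[OF \<sigma>])
    next
      case 2
      have "\<not> has_matching E k (\<sigma> - S)" for S
        using has_matching_lev_bound[of k "\<sigma> - S" n] lev 2 by auto
      then show ?thesis
        by (rule acyclic_at_empty)
    next
      case 3
      then have n: "n \<in> {1..m}"
        using less.prems by auto
      have ac: "acyc_upto (n - 1) j" "acyc_upto (n - 1 - 1) j" for j
        using less.IH[of "n - 1" j] less.IH[of "n - 1 - 1" j] n less.prems by auto
      have b: "i + reg_bound n k < int (card \<sigma>)"
        using bound 3 by simp
      have mono: "reg_bound (n - 1) k \<le> reg_bound n k"
        unfolding reg_bound_def by (simp add: div_le_mono)
      show ?thesis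
      proof (cases "x n \<in> \<sigma>")
        case False
        show ?thesis
          by (rule acyc_avoid_spine[OF ac(1)]) (use False \<sigma> lev b mono in auto)
      next
        case True
        have fin: "finite \<sigma>"
          by (rule finite_sub[OF \<sigma>])
        have "card \<sigma> = Suc (card (\<sigma> - {x n}))"
          using card_Suc_Diff1[OF fin True] by simp
        then have card: "int (card (\<sigma> - {x n})) = int (card \<sigma>) - 1"
          by simp
        have "acyclic_at (\<sigma> - {x n}) (\<lambda>S. has_matching E k (insert (x n) (\<sigma> - {x n} - S))) i"
          by (rule acyc_with_spine[OF ac n]) (use 3 \<sigma> lev b card in auto)
        moreover have "insert (x n) (\<sigma> - {x n} - S) = \<sigma> - S" if "S \<subseteq> \<sigma> - {x n}" for S
          using that True by blast
        ultimately have del: "acyclic_at (\<sigma> - {x n}) (\<lambda>S. has_matching E k (\<sigma> - S)) i"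
          by (subst acyclic_at_cong) auto
        have "acyc k (\<sigma> - {x n}) (i - 1)"
          by (rule acyc_avoid_spine[OF ac(1)]) (use \<sigma> lev b mono card in auto)
        then have link: "acyclic_at (\<sigma> - {x n}) (\<lambda>S. has_matching E k (\<sigma> - insert (x n) S)) (i - 1)"
          by (simp add: Diff_insert2[symmetric])
        show ?thesis
          by (rule acyclic_at_split[OF \<sigma> True _ del link]) (erule has_matching_mono, blast)
      qed
    qed
  qed
qed

lemma acyc_above_bound:
  assumes "\<sigma> \<subseteq> V" "k \<le> m" "i + reg_bound m k < int (card \<sigma>)"
  shows "acyc k \<sigma> i"
  using acyc_upto_all[of m k] assms lev_range unfolding acyc_upto_def by (meson atLeastAtMost_iff subsetD order_refl)

section \<open>A class at the bound, and the matching number\<close>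

definition whiskers :: "nat set \<Rightarrow> 'v set" where
  "whiskers A = x ` A \<union> y ` A"

lemma inj_xy: "inj_on x {1..m}" "inj_on y {1..m}"
  using x_V y_V by (metis inj_onI)+

lemma card_whiskers:
  assumes "A \<subseteq> {1..m}"
  shows "card (whiskers A) = 2 * card A"
proof -
  have fin: "finite A"
    using assms finite_subset by blast
  have "x ` A \<inter> y ` A = {}"
    using assms x_V y_V by (smt (verit) disjoint_iff imageE subsetD)
  then have "card (whiskers A) = card (x ` A) + card (y ` A)"
    unfolding whiskers_def using fin by (intro card_Un_disjoint) auto
  also have "\<dots> = 2 * card A"
    using inj_xy assms by (simp add: card_image inj_on_subset)
  finally show ?thesis .
qed

lemma whiskers_V: "A \<subseteq> {1..m} \<Longrightarrow> whiskers A \<subseteq> V"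
  using x_V y_V by (auto simp: whiskers_def)

lemma lev_whiskers: "A \<subseteq> {1..m} \<Longrightarrow> v \<in> whiskers A \<Longrightarrow> lev v \<in> A"
  using x_V y_V by (auto simp: whiskers_def subset_iff)

lemma xy_edge: "j \<in> {1..m} \<Longrightarrow> {x j, y j} \<in> E"
  using whisker[of "y j"] y_V[of j] by (auto simp: insert_commute)

lemma matching_whiskers:
  assumes "A \<subseteq> {1..m}"
  shows "(\<lambda>j. {x j, y j}) ` A \<subseteq> E" "disjoint ((\<lambda>j. {x j, y j}) ` A)"
    "card ((\<lambda>j. {x j, y j}) ` A) = card A"
proof -
  have eq: "i = j" if ij: "i \<in> A" "j \<in> A" "{x i, y i} \<inter> {x j, y j} \<noteq> {}" for i j
  proof -
    obtain v where "v \<in> {x i, y i}" "v \<in> {x j, y j}"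
      using ij(3) by blast
    moreover have "lev v = i" if "v \<in> {x i, y i}" for v
      using that x_V[of i] y_V[of i] \<open>i \<in> A\<close> assms by auto
    moreover have "lev v = j" if "v \<in> {x j, y j}" for v
      using that x_V[of j] y_V[of j] \<open>j \<in> A\<close> assms by auto
    ultimately show ?thesis
      by metis
  qed
  show "(\<lambda>j. {x j, y j}) ` A \<subseteq> E"
    using xy_edge assms by blast
  show "disjoint ((\<lambda>j. {x j, y j}) ` A)"
    unfolding disjoint_def using eq by blast
  have "inj_on (\<lambda>j. {x j, y j}) A"
    by (rule inj_onI) (use eq in blast)
  then show "card ((\<lambda>j. {x j, y j}) ` A) = card A"
    by (rule card_image)
qed

lemma has_matching_whiskers:
  assumes "A \<subseteq> {1..m}"
  shows "has_matching E (card A) (whiskers A)"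
proof (rule has_matchingI)
  show "finite ((\<lambda>j. {x j, y j}) ` A)"
    using assms finite_subset by blast
qed (use matching_whiskers[OF assms] in \<open>auto simp: whiskers_def\<close>)

text \<open>A k-matching uses up all 2k vertices, so the empty set is the only face, and its class
  in degree 0 has nothing to bound it.\<close>

lemma not_acyc_perfect:
  assumes "k \<le> m"
  shows "\<not> acyc k (whiskers {1..k}) 0"
proof
  let ?\<sigma> = "whiskers {1..k}"
  define f :: "'v set \<Rightarrow> 'k" where "f S = (if S = {} then 1 else 0)" for S
  have A: "{1..k} \<subseteq> {1..m}"
    using assms by simp
  assume "acyc k ?\<sigma> 0"
  moreover have "f \<in> schain ?\<sigma> (\<lambda>S. has_matching E k (?\<sigma> - S)) 0"
    using has_matching_whiskers[OF A] by (auto simp: f_def schain_def)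
  moreover have "\<forall>S. sdiff ?\<sigma> f S = 0"
    by (simp add: sdiff_def f_def)
  ultimately obtain g where g: "g \<in> schain ?\<sigma> (\<lambda>S. has_matching E k (?\<sigma> - S)) (0 + 1)"
    and "\<forall>S. sdiff ?\<sigma> g S = f S"
    unfolding acyclic_at_def by blast
  then have "sdiff ?\<sigma> g {} = 1"
    by (simp add: f_def)
  then obtain v where v: "v \<in> ?\<sigma>" "g {v} \<noteq> 0"
    unfolding sdiff_def by (metis (no_types, lifting) Diff_empty mult_zero_right sum.neutral zero_neq_one)
  then have hm: "has_matching E k (?\<sigma> - {v})"
    using schain_D(3)[OF g] by blast
  have fin: "finite ?\<sigma>"
    by (rule finite_sub[OF whiskers_V[OF A]])
  have "2 * k \<le> card (?\<sigma> - {v})"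
    by (rule has_matching_card[OF card_E hm]) (use fin in auto)
  moreover have "card ?\<sigma> = Suc (card (?\<sigma> - {v}))"
    using card_Suc_Diff1[OF fin v(1)] by simp
  ultimately show False
    using card_whiskers[OF A] by simp
qed

text \<open>The levels 1, ..., k followed by k + 2, k + 4, ..., k + 2s. The gaps separate the
  \<open>s\<close> additional whisker edges from each other and from the initial block.\<close>

definition spread :: "nat \<Rightarrow> nat \<Rightarrow> nat set" where
  "spread k s = {1..k} \<union> (\<lambda>l. k + 2 * l) ` {1..s}"

lemma spread_sub: "spread k s \<subseteq> {1..k + 2 * s}"
  by (auto simp: spread_def)

lemma card_spread: "card (spread k s) = k + s"
proof -
  have "card (spread k s) = card {1..k} + card ((\<lambda>l. k + 2 * l) ` {1..s})"
    unfolding spread_def by (rule card_Un_disjoint) auto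
  also have "card ((\<lambda>l. k + 2 * l) ` {1..s}) = s"
    by (subst card_image) (auto simp: inj_on_def)
  finally show ?thesis
    by simp
qed

lemma spread_Suc: "spread k (Suc s) = insert (k + 2 * Suc s) (spread k s)"
  by (auto simp: spread_def atLeastAtMostSuc_conv)

text \<open>Let \<open>v\<close>, \<open>w\<close> be the ends of the last whisker edge and suppose
  exactness one degree higher on \<sigma>. Without \<open>v\<close>, the vertex \<open>w\<close> is
  a cone apex, so exactness passes to the deletion of \<open>v\<close>. There the deletion of
  \<open>w\<close> is the complex for k - 1 on \<tau>, exact by the upper bound; hence the link of
  \<open>w\<close> would be exact. Since \<open>v\<close> is isolated from \<tau>, that link is the
  complex for k on \<tau>, which contradicts the induction hypothesis.\<close>

lemma not_acyc_spread:
  assumes "1 \<le> k" "k + 2 * s \<le> m"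
  shows "\<not> acyc k (whiskers (spread k s)) (int s)"
  using assms(2)
proof (induction s)
  case 0
  then show ?case
    using not_acyc_perfect[of k] by (simp add: spread_def)
next
  case (Suc s)
  define n where "n = k + 2 * Suc s"
  define \<tau> where "\<tau> = whiskers (spread k s)"
  define \<sigma> where "\<sigma> = whiskers (spread k (Suc s))"
  define v where "v = x n"
  define w where "w = y n"
  have n: "n \<in> {1..m}"
    using Suc.prems assms(1) by (simp add: n_def)
  have sub: "spread k s \<subseteq> {1..m}" "spread k (Suc s) \<subseteq> {1..m}"
    using spread_sub[of k s] spread_sub[of k "Suc s"] Suc.prems by fastforce+
  have lev\<tau>: "lev u \<le> k + 2 * s" if "u \<in> \<tau>" for u
    using lev_whiskers[OF sub(1), of u] that spread_sub[of k s] by (auto simp: \<tau>_def)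
  have \<sigma>: "\<sigma> = insert v (insert w \<tau>)"
    by (auto simp: \<sigma>_def \<tau>_def v_def w_def whiskers_def spread_Suc n_def)
  have lev: "lev v = n" "lev w = n" "v \<noteq> w"
    using x_V[OF n] y_V[OF n] by (auto simp: v_def w_def)
  have new: "v \<notin> \<tau>" "w \<notin> \<tau>"
    using lev lev\<tau>[of v] lev\<tau>[of w] by (auto simp: n_def)
  have V: "\<sigma> \<subseteq> V" "\<tau> \<subseteq> V"
    unfolding \<sigma>_def \<tau>_def by (rule whiskers_V[OF sub(2)], rule whiskers_V[OF sub(1)])
  have d1: "\<sigma> - {v} = insert w \<tau>" and d2: "insert w \<tau> - {w} = \<tau>"
    using \<sigma> new lev(3) by auto
  have wV: "w \<in> V" "w \<noteq> x (lev w)"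
    using y_V[OF n] by (auto simp: w_def)
  have w_only: "{w, u} \<notin> E" if "u \<noteq> v" for u
    using whisker_only[OF wV, of u] that lev(2) by (auto simp: v_def)
  have vw: "{w, v} \<in> E"
    using xy_edge[OF n] by (simp add: v_def w_def insert_commute)
  \<comment> \<open>The level n - 1 is one of the gaps; this separates the new edge from
    \<tau>.\<close>
  have "x (n - 1) \<notin> \<tau>"
  proof
    assume a: "x (n - 1) \<in> \<tau>"
    have "n - 1 \<in> {1..m}"
      using n by (auto simp: n_def)
    then show False
      using lev\<tau>[OF a] x_V[of "n - 1"] by (simp add: n_def)
  qed
  then have iso: "has_matching E k (insert v (\<tau> - S)) \<longleftrightarrow> has_matching E k (\<tau> - S)" for S
    unfolding v_def by (intro has_matching_no_neighbour[OF n]) (use V lev\<tau> in \<open>fastforce simp: n_def\<close>)+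
  show ?case
  proof
    assume "acyc k (whiskers (spread k (Suc s))) (int (Suc s))"
    then have ac: "acyc k \<sigma> (int s + 1)"
      by (simp add: \<sigma>_def algebra_simps)
    obtain k' where k': "k = Suc k'"
      using assms(1) by (cases k) auto
    have "acyc k (insert w \<tau>) (int s + 1)"
    proof (rule acyclic_at_isolated[where v = w, OF card_E])
      show "{w, u} \<notin> E" if "u \<in> insert w \<tau>" for u
        by (rule w_only) (use that new lev(3) in auto)
    qed (use V \<sigma> in auto)
    then have "acyclic_at (\<sigma> - {v}) (\<lambda>S. has_matching E k (\<sigma> - insert v S)) (int s + 1)"
      unfolding d1[symmetric] by (simp add: Diff_insert2[symmetric])
    then have 1: "acyclic_at (insert w \<tau>) (\<lambda>S. has_matching E k (\<sigma> - S)) (int s + 1)"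
      unfolding d1[symmetric]
      by (intro acyclic_at_deletion[OF V(1) _ _ ac]) (use \<sigma> in \<open>auto elim: has_matching_mono\<close>)
    have "acyc k' \<tau> (int s)"
    proof -
      have "acyc_upto (k + 2 * s) k'"
        using acyc_upto_all Suc.prems by simp
      \<comment> \<open>The left side equals 2k + 2s - 2, two below the number of vertices of
        \<tau>.\<close>
      moreover have "int s + reg_bound (k + 2 * s) k' < int (card \<tau>)"
        unfolding \<tau>_def card_whiskers[OF sub(1)] card_spread by (simp add: reg_bound_def k')
      ultimately show ?thesis
        using V(2) lev\<tau> unfolding acyc_upto_def by blast
    qed
    moreover have "has_matching E k (\<sigma> - S) \<longleftrightarrow> has_matching E k' (\<tau> - S)" if "S \<subseteq> \<tau>" for S
    proof -
      have "\<sigma> - S = insert w (insert v (\<tau> - S))"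
        using that \<sigma> new by blast
      show ?thesis
        unfolding k' \<open>\<sigma> - S = insert w (insert v (\<tau> - S))\<close>
      proof (intro has_matching_leaf[OF card_E vw])
        show "{w, u} \<notin> E" if "u \<in> \<tau> - S" for u
          by (rule w_only) (use that new in auto)
      qed (use new in auto)
    qed
    ultimately have 2: "acyclic_at (insert w \<tau> - {w}) (\<lambda>S. has_matching E k (\<sigma> - S)) (int s + 1 - 1)"
      unfolding d2 by (subst acyclic_at_cong) auto
    have "acyclic_at \<tau> (\<lambda>S. has_matching E k (\<sigma> - insert w S)) (int s)"
    proof -
      have "insert w \<tau> \<subseteq> V"
        using V(1) \<sigma> by simp
      have "acyclic_at (insert w \<tau> - {w}) (\<lambda>S. has_matching E k (\<sigma> - insert w S)) (int s + 1 - 1)"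
        by (rule acyclic_at_link[OF \<open>insert w \<tau> \<subseteq> V\<close> _ _ 1 2]) (simp, erule has_matching_mono, blast)
      then show ?thesis
        unfolding d2 by simp
    qed
    moreover have "has_matching E k (\<sigma> - insert w S) \<longleftrightarrow> has_matching E k (\<tau> - S)" if "S \<subseteq> \<tau>" for S
    proof -
      have "\<sigma> - insert w S = insert v (\<tau> - S)"
        using that \<sigma> new lev(3) by blast
      then show ?thesis
        using iso by simp
    qed
    ultimately have "acyc k \<tau> (int s)"
      by (subst acyclic_at_cong) auto
    then show False
      using Suc by (simp add: \<tau>_def)
  qed
qed

text \<open>With s = (m - k) div 2 there are 2k + 2s vertices while \<open>reg_bound m k\<close> is
  2k + s, so the class in degree s sits exactly at the bound.\<close>

lemma not_acyc_at_bound: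
  assumes "1 \<le> k" "k \<le> m"
  shows "\<exists>\<sigma>\<subseteq>V. \<not> acyc k \<sigma> (int ((m - k) div 2)) \<and> int (card \<sigma>) = int ((m - k) div 2) + reg_bound m k"
proof (intro exI conjI)
  let ?s = "(m - k) div 2"
  have le: "k + 2 * ?s \<le> m"
    using assms(2) by linarith
  then have sub: "spread k ?s \<subseteq> {1..m}"
    using spread_sub[of k ?s] by fastforce
  show "whiskers (spread k ?s) \<subseteq> V"
    by (rule whiskers_V[OF sub])
  show "\<not> acyc k (whiskers (spread k ?s)) (int ?s)"
    by (rule not_acyc_spread[OF assms(1) le])
  show "int (card (whiskers (spread k ?s))) = int ?s + reg_bound m k"
    by (simp add: card_whiskers[OF sub] card_spread reg_bound_def)
qed

text \<open>The spine is a cover by m vertices, and one whisker edge at each spine vertex attains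
  that number.\<close>

lemma Max_matching: "Max {card M | M. M \<subseteq> E \<and> disjoint M} = m"
proof (rule Max_eqI)
  have "E \<subseteq> Pow V"
    using E_sub by blast
  then have "finite E"
    using finite_V finite_subset by (metis finite_Pow_iff)
  then show "finite {card M | M. M \<subseteq> E \<and> disjoint M}"
    by simp
  show "k \<le> m" if k: "k \<in> {card M | M. M \<subseteq> E \<and> disjoint M}" for k
  proof -
    obtain M where "k = card M" "M \<subseteq> E" "disjoint M"
      using k by blast
    then have "has_matching E k V"
      using \<open>finite E\<close> E_sub finite_subset[of M E] by (intro has_matchingI[of M]) auto
    then show ?thesis
      using has_matching_lev_bound lev_range by (meson atLeastAtMost_iff)
  qed
  show "m \<in> {card M | M. M \<subseteq> E \<and> disjoint M}"
    using matching_whiskers[of "{1..m}"]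
    by (intro CollectI exI[of _ "(\<lambda>j. {x j, y j}) ` {1..m}"]) simp
qed

end

section \<open>Polynomials and monomial ideals\<close>

lemma lookup_single_mult_add:
  fixes p :: "('a::cancel_comm_monoid_add) \<Rightarrow>\<^sub>0 'k::semiring_0"
  shows "lookup (single s a * p) (s + u) = a * lookup p u"
  by (simp add: lookup_mult lookup_single when_mult)

lemma lookup_single_mult_not:
  fixes p :: "('a::cancel_comm_monoid_add) \<Rightarrow>\<^sub>0 'k::semiring_0"
  assumes "\<And>u. t \<noteq> s + u"
  shows "lookup (single s a * p) t = 0"
  using assms by (simp add: lookup_mult lookup_single when_mult)

abbreviation cst :: "'k \<Rightarrow> ('v, 'k::field) mpoly" where
  "cst a \<equiv> single 0 a"

lemma lookup_cst_mult [simp]: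
  fixes p :: "('v, 'k::field) mpoly"
  shows "lookup (cst a * p) t = a * lookup p t"
  using lookup_single_mult_add[of 0 a p t] by simp

lemma lookup_var_mult:
  fixes p :: "('v, 'k::field) mpoly"
  shows "lookup (var x * p) t =
    (if lookup t x = 0 then 0 else lookup p (t - single x 1))"
proof (cases "lookup t x = 0")
  case True
  have "t \<noteq> single x 1 + u" for u
    using True by (auto simp: lookup_add)
  then show ?thesis
    using True by (simp add: var_def lookup_single_mult_not)
next
  case False
  then have "t = single x 1 + (t - single x 1)"
    by (intro poly_mapping_eqI) (auto simp: lookup_add lookup_minus lookup_single when_def)
  then show ?thesis
    using False lookup_single_mult_add[of "single x 1" 1 p "t - single x 1"]
    by (simp add: var_def)
qed

lemma keys_multD:
  assumes "t \<in> keys (p * q)"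
  obtains a b where "t = a + b" "a \<in> keys p" "b \<in> keys q"
  using assms keys_mult[of p q] by blast

lemma keys_add_nat:
  fixes a b :: "'v \<Rightarrow>\<^sub>0 nat"
  shows "keys (a + b) = keys a \<union> keys b"
  by (auto simp: in_keys_iff lookup_add)

lemma exp_add_eq_0_iff:
  fixes a b :: "'v \<Rightarrow>\<^sub>0 nat"
  shows "a + b = 0 \<longleftrightarrow> a = 0 \<and> b = 0"
proof -
  have "a + b = 0 \<longleftrightarrow> keys (a + b) = {}"
    by simp
  then show ?thesis
    unfolding keys_add_nat by simp
qed

text \<open>It becomes an ideal when \<open>Q\<close> is closed under multiplication of monomials,
  which is assumed where it matters. The whole polynomial ring is the case of the constantly true
  \<open>Q\<close>.\<close>

definition monomial_ideal :: "'v set \<Rightarrow> (('v \<Rightarrow>\<^sub>0 nat) \<Rightarrow> bool) \<Rightarrow> ('v, 'k::field) mpoly set" where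
  "monomial_ideal V Q = {p \<in> poly_ring V. \<forall>t\<in>keys p. Q t}"

lemma poly_ringI: "(\<And>t. t \<in> keys p \<Longrightarrow> keys t \<subseteq> V) \<Longrightarrow> p \<in> poly_ring V"
  by (auto simp: poly_ring_def)

lemma poly_ring_eq_monomial_ideal: "poly_ring V = monomial_ideal V (\<lambda>_. True)"
  by (auto simp: monomial_ideal_def)

lemma monomial_ideal_0 [simp]: "0 \<in> monomial_ideal V Q"
  by (simp add: monomial_ideal_def poly_ring_def)

lemma monomial_ideal_add: "p \<in> monomial_ideal V Q \<Longrightarrow> q \<in> monomial_ideal V Q \<Longrightarrow> p + q \<in> monomial_ideal V Q"
  using keys_add[of p q] unfolding monomial_ideal_def poly_ring_def by blast

lemma monomial_ideal_sum: "(\<And>a. a \<in> A \<Longrightarrow> f a \<in> monomial_ideal V Q) \<Longrightarrow> sum f A \<in> monomial_ideal V Q"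
  by (induction A rule: infinite_finite_induct) (auto intro: monomial_ideal_add)

lemma monomial_ideal_mult:
  assumes "q \<in> poly_ring V" "p \<in> monomial_ideal V Q" "\<And>s t. Q t \<Longrightarrow> Q (s + t)"
  shows "q * p \<in> monomial_ideal V Q"
proof -
  have "keys t \<subseteq> V \<and> Q t" if t: "t \<in> keys (q * p)" for t
  proof -
    obtain a b where ab: "t = a + b" "a \<in> keys q" "b \<in> keys p"
      using keys_multD[OF t] .
    then have "keys a \<subseteq> V" "keys b \<subseteq> V" "Q b"
      using assms(1,2) by (auto simp: monomial_ideal_def poly_ring_def)
    then show ?thesis
      using assms(3) by (simp add: ab(1) keys_add_nat)
  qed
  then show ?thesis
    by (simp add: monomial_ideal_def poly_ring_def)
qed

lemma poly_ring_0 [simp]: "0 \<in> poly_ring V"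
  by (simp add: poly_ring_def)

lemma poly_ring_cst [simp]: "cst a \<in> poly_ring V"
  by (auto simp: poly_ring_def)

lemma poly_ring_1 [simp]: "1 \<in> poly_ring V"
  using poly_ring_cst[of 1 V] by simp

lemma poly_ring_var: "x \<in> V \<Longrightarrow> var x \<in> poly_ring V"
  by (auto simp: poly_ring_def var_def)

lemma poly_ring_add: "p \<in> poly_ring V \<Longrightarrow> q \<in> poly_ring V \<Longrightarrow> p + q \<in> poly_ring V"
  unfolding poly_ring_eq_monomial_ideal by (rule monomial_ideal_add)

lemma poly_ring_mult: "p \<in> poly_ring V \<Longrightarrow> q \<in> poly_ring V \<Longrightarrow> p * q \<in> poly_ring V"
  using monomial_ideal_mult[of p V q "\<lambda>_. True"] by (simp add: poly_ring_eq_monomial_ideal)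

lemma ideal_gen_subset_monomial_ideal:
  assumes "S \<subseteq> monomial_ideal V Q" "\<And>s t. Q t \<Longrightarrow> Q (s + t)"
  shows "ideal_gen V S \<subseteq> monomial_ideal V Q"
proof
  fix p assume "p \<in> ideal_gen V S"
  then obtain A q where A: "p = (\<Sum>f\<in>A. q f * f)" "A \<subseteq> S" "q ` A \<subseteq> poly_ring V"
    by (auto simp: ideal_gen_def)
  have "q f * f \<in> monomial_ideal V Q" if "f \<in> A" for f
    by (rule monomial_ideal_mult) (use A assms that in auto)
  then show "p \<in> monomial_ideal V Q"
    unfolding A(1) by (rule monomial_ideal_sum)
qed

lemma ideal_gen_mult:
  assumes "f \<in> S" "q \<in> poly_ring V"
  shows "q * f \<in> ideal_gen V S"
  unfolding ideal_gen_def using assms by (intro CollectI exI[of _ "{f}"] exI[of _ "\<lambda>_. q"]) auto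

lemma ideal_gen_base: "f \<in> S \<Longrightarrow> f \<in> ideal_gen V S"
  using ideal_gen_mult[of f S 1 V] by simp

lemma ideal_gen_0 [simp]: "0 \<in> ideal_gen V S"
  unfolding ideal_gen_def by (intro CollectI exI[of _ "{}"]) auto

lemma ideal_gen_add:
  assumes "p \<in> ideal_gen V S" "q \<in> ideal_gen V S"
  shows "p + q \<in> ideal_gen V S"
proof -
  obtain A a where A: "p = (\<Sum>f\<in>A. a f * f)" "finite A" "A \<subseteq> S" "a ` A \<subseteq> poly_ring V"
    using assms(1) by (auto simp: ideal_gen_def)
  obtain B b where B: "q = (\<Sum>f\<in>B. b f * f)" "finite B" "B \<subseteq> S" "b ` B \<subseteq> poly_ring V"
    using assms(2) by (auto simp: ideal_gen_def)
  let ?a = "\<lambda>f. if f \<in> A then a f else 0" and ?b = "\<lambda>f. if f \<in> B then b f else 0"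
  have "p = (\<Sum>f\<in>A \<union> B. ?a f * f)"
    unfolding A(1) by (rule sum.mono_neutral_cong_left) (use A B in auto)
  moreover have "q = (\<Sum>f\<in>A \<union> B. ?b f * f)"
    unfolding B(1) by (rule sum.mono_neutral_cong_left) (use A B in auto)
  ultimately have "p + q = (\<Sum>f\<in>A \<union> B. (?a f + ?b f) * f)"
    by (simp add: sum.distrib distrib_right)
  moreover have "?a f + ?b f \<in> poly_ring V" for f
    using A(4) B(4) by (intro poly_ring_add) auto
  ultimately show ?thesis
    unfolding ideal_gen_def using A B
    by (intro CollectI exI[of _ "A \<union> B"] exI[of _ "\<lambda>f. ?a f + ?b f"]) auto
qed

lemma ideal_gen_sum: "(\<And>a. a \<in> A \<Longrightarrow> f a \<in> ideal_gen V S) \<Longrightarrow> sum f A \<in> ideal_gen V S"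
  by (induction A rule: infinite_finite_induct) (auto intro: ideal_gen_add)

definition indicator_exp :: "'v set \<Rightarrow> 'v \<Rightarrow>\<^sub>0 nat" where
  "indicator_exp A = (\<Sum>x\<in>A. single x 1)"

lemma lookup_indicator_exp:
  "finite A \<Longrightarrow> lookup (indicator_exp A) z = (if z \<in> A then 1 else 0)"
  by (simp add: indicator_exp_def lookup_sum lookup_single when_def)

lemma keys_indicator_exp: "finite A \<Longrightarrow> keys (indicator_exp A) = A"
  by (auto simp: in_keys_iff lookup_indicator_exp split: if_splits)

lemma indicator_exp_doubleton: "u \<noteq> v \<Longrightarrow> single (indicator_exp {u, v}) 1 = var u * var v"
  by (simp add: indicator_exp_def var_def mult_single)

lemma prod_single_one:
  "(\<Prod>i\<in>I. single (f i) (1::'k::field)) = single (\<Sum>i\<in>I. f i) 1"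
  by (induction I rule: infinite_finite_induct) (auto simp: mult_single)

lemma sum_indicator_exp:
  assumes "finite M" "disjoint M" "\<And>e. e \<in> M \<Longrightarrow> finite e"
  shows "(\<Sum>e\<in>M. indicator_exp e) = indicator_exp (\<Union>M)"
proof (rule poly_mapping_eqI)
  fix z
  have "(\<Sum>e\<in>M. lookup (indicator_exp e) z) = (\<Sum>e\<in>M. if z \<in> e then 1 else 0)"
    by (rule sum.cong) (simp_all add: lookup_indicator_exp assms(3))
  also have "\<dots> = (if z \<in> \<Union>M then 1 else 0)"
  proof (cases "z \<in> \<Union>M")
    case True
    then obtain e where e: "e \<in> M" "z \<in> e"
      by blast
    have "z \<in> e' \<longleftrightarrow> e' = e" if "e' \<in> M" for e'
      using assms(2) e that unfolding disjoint_def by blast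
    then have "(\<Sum>e'\<in>M. if z \<in> e' then 1 else 0) = (\<Sum>e'\<in>M. if e' = e then 1 else (0::nat))"
      by (intro sum.cong) auto
    then show ?thesis
      using assms(1) e True by simp
  qed auto
  finally show "lookup (\<Sum>e\<in>M. indicator_exp e) z = lookup (indicator_exp (\<Union>M)) z"
    using assms by (simp add: lookup_sum lookup_indicator_exp)
qed

text \<open>Edges may be repeated or overlap: these are the monomials of the ordinary power of the
  edge ideal.\<close>

fun divisible_by_edges :: "'v set set \<Rightarrow> nat \<Rightarrow> ('v \<Rightarrow>\<^sub>0 nat) \<Rightarrow> bool" where
  "divisible_by_edges E 0 t \<longleftrightarrow> True"
| "divisible_by_edges E (Suc k) t \<longleftrightarrow>
    (\<exists>u v s. {u, v} \<in> E \<and> t = s + (single u 1 + single v 1) \<and> divisible_by_edges E k s)"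

lemma divisible_by_edges_add: "divisible_by_edges E k t \<Longrightarrow> divisible_by_edges E k (s + t)"
proof (induction k arbitrary: t)
  case (Suc k)
  then obtain u v r where "{u, v} \<in> E" "t = r + (single u 1 + single v 1)"
    "divisible_by_edges E k r"
    by auto
  then have "{u, v} \<in> E \<and> s + t = (s + r) + (single u 1 + single v 1) \<and>
      divisible_by_edges E k (s + r)"
    using Suc.IH[of r] by (simp add: add.assoc)
  then show ?case
    by (subst divisible_by_edges.simps) blast
qed simp

lemma edge_ideal_subset:
  fixes G :: "'v graph"
  assumes "simple_graph G"
  shows "(edge_ideal G :: ('v, 'k::field) mpoly set) \<subseteq> monomial_ideal (verts G) (divisible_by_edges (edges G) 1)"
  unfolding edge_ideal_def
proof (rule ideal_gen_subset_monomial_ideal)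
  show "{var x * var y |x y. {x, y} \<in> edges G} \<subseteq>
    (monomial_ideal (verts G) (divisible_by_edges (edges G) 1) :: ('v, 'k) mpoly set)"
  proof
    fix p :: "('v, 'k) mpoly" assume "p \<in> {var x * var y |x y. {x, y} \<in> edges G}"
    then obtain x y where p: "p = var x * var y" and e: "{x, y} \<in> edges G"
      by blast
    have "{x, y} \<subseteq> verts G"
      using e assms unfolding simple_graph_def by blast
    then have "p \<in> poly_ring (verts G)"
      unfolding p by (intro poly_ring_mult poly_ring_var) auto
    moreover have "\<forall>t\<in>keys p. divisible_by_edges (edges G) 1 t"
    proof -
      have "divisible_by_edges (edges G) 1 (single x 1 + single y 1)"
        unfolding One_nat_def divisible_by_edges.simps
        by (intro exI[of _ x] exI[of _ y] exI[of _ 0]) (simp add: e)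
      then show ?thesis
        by (simp add: p var_def mult_single del: divisible_by_edges.simps)
    qed
    ultimately show "p \<in> monomial_ideal (verts G) (divisible_by_edges (edges G) 1)"
      unfolding monomial_ideal_def by blast
  qed
qed (rule divisible_by_edges_add)

lemma prod_edge_ideal:
  assumes "simple_graph G" "\<forall>i<k. f i \<in> edge_ideal G"
  shows "(\<Prod>i<k. f i) \<in> monomial_ideal (verts G) (divisible_by_edges (edges G) k)"
  using assms(2)
proof (induction k)
  case 0
  then show ?case
    by (simp flip: poly_ring_eq_monomial_ideal)
next
  case (Suc k)
  have 1: "(\<Prod>i<k. f i) \<in> monomial_ideal (verts G) (divisible_by_edges (edges G) k)"
    using Suc by simp
  have 2: "f k \<in> monomial_ideal (verts G) (divisible_by_edges (edges G) 1)"
    using Suc.prems edge_ideal_subset[OF assms(1)] by blast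
  have "(\<Prod>i<k. f i) * f k \<in> poly_ring (verts G)"
    using 1 2 by (intro poly_ring_mult) (auto simp: monomial_ideal_def)
  moreover have "divisible_by_edges (edges G) (Suc k) t" if t: "t \<in> keys ((\<Prod>i<k. f i) * f k)" for t
  proof -
    obtain a b where ab: "t = a + b" "a \<in> keys (\<Prod>i<k. f i)" "b \<in> keys (f k)"
      using keys_multD[OF t] .
    have a: "divisible_by_edges (edges G) k a" and "divisible_by_edges (edges G) 1 b"
      using ab(2,3) 1 2 unfolding monomial_ideal_def by simp_all
    then obtain u v s where b: "{u, v} \<in> edges G" "b = s + (single u 1 + single v 1)"
      unfolding One_nat_def divisible_by_edges.simps by blast
    have "t = (s + a) + (single u 1 + single v 1)"
      unfolding ab(1) b by (simp add: ac_simps)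
    then show ?thesis
      using b(1) divisible_by_edges_add[OF a] by (subst divisible_by_edges.simps) blast
  qed
  ultimately show ?case
    by (simp add: monomial_ideal_def)
qed

lemma ideal_power_edge_ideal:
  assumes "simple_graph G"
  shows "ideal_power (verts G) (edge_ideal G) k \<subseteq> monomial_ideal (verts G) (divisible_by_edges (edges G) k)"
  unfolding ideal_power_def
  by (rule ideal_gen_subset_monomial_ideal) (use prod_edge_ideal[OF assms] divisible_by_edges_add in auto)

text \<open>A vertex shared by two of the k dividing edges would have exponent at least 2, so in a
  square-free monomial they form a matching.\<close>

lemma has_matching_of_divisible:
  assumes "divisible_by_edges E k t" "\<And>x. lookup t x \<le> 1"
  shows "has_matching E k (keys t)"
  using assms
proof (induction k arbitrary: t)
  case (Suc k)
  then obtain u v s where s: "{u, v} \<in> E" "t = s + (single u 1 + single v 1)"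
    "divisible_by_edges E k s"
    by auto
  have le: "lookup s x + (if x = u then 1 else 0) + (if x = v then 1 else 0) \<le> 1" for x
    using Suc.prems(2)[of x] by (auto simp: s(2) lookup_add lookup_single when_def split: if_splits)
  have "lookup s x \<le> 1" for x
    using le[of x] by simp
  then have "has_matching E k (keys s)"
    by (rule Suc.IH[OF s(3)])
  moreover have "u \<notin> keys s" "v \<notin> keys s"
    using le[of u] le[of v] by (auto simp: in_keys_iff split: if_splits)
  moreover have "keys t = insert u (insert v (keys s))"
    by (auto simp: s(2) keys_add_nat)
  ultimately show ?case
    using has_matching_insert[OF _ s(1)] by simp
qed simp

lemma matching_monomial_in_ideal_power:
  assumes "simple_graph G" "M \<subseteq> edges G" "disjoint M" "finite M" "card M = k"
  shows "single (indicator_exp (\<Union>M)) 1 \<in> ideal_power (verts G) (edge_ideal G) k"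
proof -
  have card: "card e = 2" if "e \<in> M" for e
    using that assms(1,2) by (auto simp: simple_graph_def)
  then have fin: "finite e" if "e \<in> M" for e
    using that by (metis card.infinite zero_neq_numeral)
  obtain h where h: "bij_betw h {..<k} M"
    using ex_bij_betw_nat_finite[OF assms(4)] assms(5) by (auto simp: atLeast0LessThan)
  have edge: "single (indicator_exp e) 1 \<in> edge_ideal G" if e: "e \<in> M" for e
  proof -
    obtain u v where uv: "e = {u, v}" "u \<noteq> v"
      using card[OF e] by (auto simp: card_2_iff)
    have "var u * var v \<in> edge_ideal G"
      unfolding edge_ideal_def using e uv(1) assms(2) by (intro ideal_gen_base) auto
    then show ?thesis
      using indicator_exp_doubleton[OF uv(2)] uv(1) by metis
  qed
  have "(\<Prod>i<k. single (indicator_exp (h i)) (1::'b)) = single (\<Sum>i<k. indicator_exp (h i)) 1"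
    by (rule prod_single_one)
  also have "(\<Sum>i<k. indicator_exp (h i)) = (\<Sum>e\<in>M. indicator_exp e)"
    by (rule sum.reindex_bij_betw[OF h])
  also have "\<dots> = indicator_exp (\<Union>M)"
    using assms(3,4) fin by (intro sum_indicator_exp)
  finally have "single (indicator_exp (\<Union>M)) (1::'b) = (\<Prod>i<k. single (indicator_exp (h i)) 1)"
    by simp
  moreover have "\<forall>i<k. single (indicator_exp (h i)) (1::'b) \<in> edge_ideal G"
    using edge h by (auto simp: bij_betw_def)
  ultimately show ?thesis
    unfolding ideal_power_def by (intro ideal_gen_base) blast
qed

lemma sum_monomials: "(\<Sum>t\<in>keys p. single t (lookup p t)) = p"
  by (rule poly_mapping_eqI) (simp add: lookup_sum lookup_single when_def in_keys_iff)

text \<open>The bridge from algebra to combinatorics. A monomial whose support contains the vertices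
  of a k-matching is a multiple of the product of these vertices, whatever its own exponents are; so
  membership depends on the support alone.\<close>

lemma sqfree_power_eq:
  fixes G :: "'v graph"
  assumes G: "simple_graph G"
  shows "(sqfree_power (verts G) (edge_ideal G) k :: ('v, 'k::field) mpoly set) =
    monomial_ideal (verts G) (\<lambda>t. has_matching (edges G) k (keys t))"
proof
  have up: "has_matching (edges G) k (keys (s + t))"
    if "has_matching (edges G) k (keys t)" for s t :: "'v \<Rightarrow>\<^sub>0 nat"
    using that by (rule has_matching_mono) (simp add: keys_add_nat)
  show "(sqfree_power (verts G) (edge_ideal G) k :: ('v, 'k) mpoly set) \<subseteq>
    monomial_ideal (verts G) (\<lambda>t. has_matching (edges G) k (keys t))"
    unfolding sqfree_power_def
  proof (rule ideal_gen_subset_monomial_ideal)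
    show "(sqfree_monomials \<inter> ideal_power (verts G) (edge_ideal G) k :: ('v, 'k) mpoly set) \<subseteq>
      monomial_ideal (verts G) (\<lambda>t. has_matching (edges G) k (keys t))"
    proof
      fix p :: "('v, 'k) mpoly"
      assume p: "p \<in> sqfree_monomials \<inter> ideal_power (verts G) (edge_ideal G) k"
      then obtain t where t: "p = single t 1" "\<And>x. lookup t x \<le> 1"
        by (auto simp: sqfree_monomials_def)
      have "p \<in> monomial_ideal (verts G) (divisible_by_edges (edges G) k)"
        using p ideal_power_edge_ideal[OF G] by blast
      then show "p \<in> monomial_ideal (verts G) (\<lambda>t. has_matching (edges G) k (keys t))"
        using has_matching_of_divisible[of "edges G" k t] t by (simp add: monomial_ideal_def)
    qed
  qed (rule up)
next
  show "monomial_ideal (verts G) (\<lambda>t. has_matching (edges G) k (keys t)) \<subseteq>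
    (sqfree_power (verts G) (edge_ideal G) k :: ('v, 'k) mpoly set)"
  proof
    fix p :: "('v, 'k) mpoly"
    assume p: "p \<in> monomial_ideal (verts G) (\<lambda>t. has_matching (edges G) k (keys t))"
    have "single t (lookup p t) \<in> sqfree_power (verts G) (edge_ideal G) k"
      if t: "t \<in> keys p" for t
    proof -
      have "has_matching (edges G) k (keys t)"
        using p t by (simp add: monomial_ideal_def)
      then obtain M where M: "M \<subseteq> edges G" "disjoint M" "finite M" "card M = k" "\<Union>M \<subseteq> keys t"
        unfolding has_matching_def by blast
      define s where "s = indicator_exp (\<Union>M)"
      have fin: "finite (\<Union>M)"
        using M(5) by (rule finite_subset) simp
      have ls: "lookup s x = (if x \<in> \<Union>M then 1 else 0)" for x
        unfolding s_def by (rule lookup_indicator_exp[OF fin])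
      have eq: "t = (t - s) + s"
      proof (rule poly_mapping_eqI)
        fix x
        have "x \<in> \<Union>M \<Longrightarrow> lookup t x \<noteq> 0"
          using M(5) by (auto simp: in_keys_iff)
        then show "lookup t x = lookup ((t - s) + s) x"
          by (auto simp: lookup_add lookup_minus ls)
      qed
      have "single s (1::'k) \<in> sqfree_monomials \<inter> ideal_power (verts G) (edge_ideal G) k"
        using matching_monomial_in_ideal_power[OF G M(1-4), where 'b = 'k] ls
        by (auto simp: sqfree_monomials_def s_def)
      moreover have "single (t - s) (lookup p t) \<in> poly_ring (verts G)"
      proof (rule poly_ringI)
        fix r assume "r \<in> keys (single (t - s) (lookup p t))"
        then have "r = t - s"
          by (simp split: if_splits)
        then have "keys r \<subseteq> keys t"
          by (auto simp: in_keys_iff lookup_minus)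
        moreover have "keys t \<subseteq> verts G"
          using p t by (auto simp: monomial_ideal_def poly_ring_def)
        ultimately show "keys r \<subseteq> verts G"
          by blast
      qed
      ultimately have "single (t - s) (lookup p t) * single s 1
          \<in> sqfree_power (verts G) (edge_ideal G) k"
        unfolding sqfree_power_def by (rule ideal_gen_mult)
      then show ?thesis
        using eq by (simp add: mult_single)
    qed
    then have "(\<Sum>t\<in>keys p. single t (lookup p t)) \<in>
      sqfree_power (verts G) (edge_ideal G) k"
      unfolding sqfree_power_def by (intro ideal_gen_sum)
    then show "p \<in> sqfree_power (verts G) (edge_ideal G) k"
      by (simp add: sum_monomials)
  qed
qed

section \<open>Degrees, homogeneous parts and constant terms\<close>

lemma mon_degree_eq_sum:
  assumes "finite A" "keys t \<subseteq> A"
  shows "mon_degree t = (\<Sum>x\<in>A. lookup t x)"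
  unfolding mon_degree_def by (rule sum.mono_neutral_left) (use assms in \<open>auto simp: in_keys_iff\<close>)

lemma mon_degree_add: "mon_degree (s + t) = mon_degree s + mon_degree t"
proof -
  let ?A = "keys s \<union> keys t"
  have "mon_degree (s + t) = (\<Sum>x\<in>?A. lookup (s + t) x)"
    "mon_degree s = (\<Sum>x\<in>?A. lookup s x)" "mon_degree t = (\<Sum>x\<in>?A. lookup t x)"
    by (rule mon_degree_eq_sum; simp add: keys_add_nat)+
  then show ?thesis
    by (simp add: lookup_add sum.distrib)
qed

lemma mon_degree_0 [simp]: "mon_degree 0 = 0"
  by (simp add: mon_degree_def)

lemma mon_degree_single [simp]: "mon_degree (single x n) = n"
  by (simp add: mon_degree_def)

lemma mon_degree_eq_0_iff [simp]: "mon_degree t = 0 \<longleftrightarrow> t = 0"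
  using poly_mapping_eqI[of t 0] by (auto simp: mon_degree_def in_keys_iff)

lemma mon_degree_indicator_exp: "finite A \<Longrightarrow> mon_degree (indicator_exp A) = card A"
  by (simp add: mon_degree_eq_sum[of A] keys_indicator_exp lookup_indicator_exp)

lemma homogeneous_0 [simp]: "homogeneous e 0"
  by (simp add: homogeneous_def)

lemma homogeneous_add: "homogeneous e p \<Longrightarrow> homogeneous e q \<Longrightarrow> homogeneous e (p + q)"
  using keys_add[of p q] unfolding homogeneous_def by blast

lemma homogeneous_mult: "homogeneous d p \<Longrightarrow> homogeneous e q \<Longrightarrow> homogeneous (d + e) (p * q)"
  unfolding homogeneous_def by (metis keys_multD mon_degree_add of_nat_add)

lemma homogeneous_cst [simp]: "homogeneous 0 (cst a)"
  by (auto simp: homogeneous_def)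

lemma homogeneous_var: "homogeneous 1 (var x)"
  by (auto simp: homogeneous_def var_def)

lemma homogeneous_lookup: "homogeneous e p \<Longrightarrow> int (mon_degree t) \<noteq> e \<Longrightarrow> lookup p t = 0"
  by (auto simp: homogeneous_def in_keys_iff)

lemma homogeneousI: "(\<And>t. lookup p t \<noteq> 0 \<Longrightarrow> int (mon_degree t) = e) \<Longrightarrow> homogeneous e p"
  by (auto simp: homogeneous_def in_keys_iff)

lemma homogeneous_negative: "homogeneous e p \<Longrightarrow> e < 0 \<Longrightarrow> p = 0"
  by (intro poly_mapping_eqI) (auto simp: homogeneous_lookup)

lemma homogeneous_uminus: "homogeneous e p \<Longrightarrow> homogeneous e (- p)"
  by (auto simp: homogeneous_def)

definition hom_part :: "int \<Rightarrow> ('v, 'k::field) mpoly \<Rightarrow> ('v, 'k) mpoly" where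
  "hom_part e p = (\<Sum>t\<in>{t \<in> keys p. int (mon_degree t) = e}. single t (lookup p t))"

lemma lookup_hom_part: "lookup (hom_part e p) t = (if int (mon_degree t) = e then lookup p t else 0)"
  by (simp add: hom_part_def lookup_sum lookup_single when_def in_keys_iff)

lemma hom_part_0 [simp]: "hom_part e 0 = 0"
  by (rule poly_mapping_eqI) (simp add: lookup_hom_part)

lemma hom_part_sum: "hom_part e (sum f A) = (\<Sum>a\<in>A. hom_part e (f a))"
  by (rule poly_mapping_eqI) (simp add: lookup_hom_part lookup_sum)

lemma homogeneous_hom_part: "homogeneous e (hom_part e p)"
  by (rule homogeneousI) (simp add: lookup_hom_part split: if_splits)

lemma hom_part_homogeneous: "homogeneous d p \<Longrightarrow> hom_part e p = (if d = e then p else 0)"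
  by (rule poly_mapping_eqI) (auto simp: lookup_hom_part homogeneous_lookup)

lemma keys_hom_part: "keys (hom_part e p) \<subseteq> keys p"
  by (auto simp: in_keys_iff lookup_hom_part split: if_splits)

lemma monomial_ideal_hom_part: "p \<in> monomial_ideal V Q \<Longrightarrow> hom_part e p \<in> monomial_ideal V Q"
  using keys_hom_part[of e p] by (auto simp: monomial_ideal_def poly_ring_def)

lemma poly_ring_hom_part: "p \<in> poly_ring V \<Longrightarrow> hom_part e p \<in> poly_ring V"
  unfolding poly_ring_eq_monomial_ideal by (rule monomial_ideal_hom_part)

lemma sum_hom_parts:
  assumes "finite D" "\<And>t. t \<in> keys p \<Longrightarrow> int (mon_degree t) \<in> D"
  shows "(\<Sum>e\<in>D. hom_part e p) = p"
proof (rule poly_mapping_eqI)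
  fix t
  show "lookup (\<Sum>e\<in>D. hom_part e p) t = lookup p t"
    using assms by (cases "t \<in> keys p") (auto simp: lookup_sum lookup_hom_part in_keys_iff)
qed

lemma hom_part_mult:
  assumes "homogeneous d g"
  shows "hom_part e (p * g) = hom_part (e - d) p * g"
proof -
  \<comment> \<open>Inserting \<open>e - d\<close> guarantees that the one summand that survives
    below is present, even when it is zero.\<close>
  let ?D = "insert (e - d) ((\<lambda>t. int (mon_degree t)) ` keys p)"
  have "p * g = (\<Sum>c\<in>?D. hom_part c p) * g"
    by (subst sum_hom_parts) auto
  then have "hom_part e (p * g) = (\<Sum>c\<in>?D. hom_part e (hom_part c p * g))"
    by (simp add: sum_distrib_right hom_part_sum del: sum.insert)
  also have "\<dots> = (\<Sum>c\<in>?D. if c = e - d then hom_part c p * g else 0)"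
    by (rule sum.cong[OF refl], subst hom_part_homogeneous[OF homogeneous_mult[OF homogeneous_hom_part assms]]) auto
  also have "\<dots> = hom_part (e - d) p * g"
    by (subst sum.delta) auto
  finally show ?thesis .
qed

lemma ideal_gen_vars_lookup_0:
  assumes "p \<in> ideal_gen V (var ` V)"
  shows "lookup p 0 = 0"
proof -
  have "ideal_gen V (var ` V) \<subseteq> monomial_ideal V (\<lambda>t. t \<noteq> 0)"
    by (rule ideal_gen_subset_monomial_ideal)
      (auto simp: monomial_ideal_def var_def poly_ring_def mon_degree_add simp flip: mon_degree_eq_0_iff)
  then have "0 \<notin> keys p"
    using assms unfolding monomial_ideal_def by blast
  then show ?thesis
    by (simp add: in_keys_iff)
qed

text \<open>Exponents are natural numbers, so the exponent 0 is a sum only as 0 + 0. Constant terms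
  are the means of expressing minimality below.\<close>

lemma lookup_mult_0:
  fixes p q :: "('v, 'k::field) mpoly"
  shows "lookup (p * q) 0 = lookup p 0 * lookup q 0"
proof -
  have *: "0 = a + b \<longleftrightarrow> a = 0 \<and> b = 0" for a b :: "'v \<Rightarrow>\<^sub>0 nat"
    using exp_add_eq_0_iff[of a b] by (simp add: eq_commute[of 0])
  have "lookup (p * q) 0 =
    Sum_any (\<lambda>l. lookup p l * Sum_any (\<lambda>r. lookup q r when 0 = l + r))"
    by (rule lookup_mult)
  also have "\<dots> = Sum_any (\<lambda>l. (lookup p l * lookup q 0) when l = 0)"
  proof (rule Sum_any.cong)
    fix l :: "'v \<Rightarrow>\<^sub>0 nat"
    show "lookup p l * Sum_any (\<lambda>r. lookup q r when 0 = l + r) =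
      (lookup p l * lookup q 0 when l = 0)"
      by (cases "l = 0") (simp_all add: *)
  qed
  finally show ?thesis
    by simp
qed

section \<open>Koszul chains\<close>

lemma sum_fun_apply: "(\<Sum>a\<in>A. f a) x = (\<Sum>a\<in>A. f a x)"
  for f :: "'a \<Rightarrow> 'b \<Rightarrow> 'c::comm_monoid_add"
  by (induction A rule: infinite_finite_induct) auto

lemma sum_antisymmetric:
  fixes a :: "'a \<Rightarrow> 'a \<Rightarrow> 'b::ab_group_add"
  assumes "finite A" "\<And>x z. x \<in> A \<Longrightarrow> z \<in> A \<Longrightarrow> x \<noteq> z \<Longrightarrow> a x z + a z x = 0"
  shows "(\<Sum>x\<in>A. \<Sum>z\<in>A - {x}. a x z) = 0"
  using assms
proof (induction A rule: finite_induct)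
  case (insert y A)
  have "(\<Sum>z\<in>insert y A - {x}. a x z) = a x y + (\<Sum>z\<in>A - {x}. a x z)" if "x \<in> A" for x
  proof -
    have "insert y A - {x} = insert y (A - {x})"
      using that insert.hyps by blast
    then show ?thesis
      using insert.hyps by simp
  qed
  then have "(\<Sum>x\<in>A. \<Sum>z\<in>insert y A - {x}. a x z) = (\<Sum>x\<in>A. a x y) + (\<Sum>x\<in>A. \<Sum>z\<in>A - {x}. a x z)"
    by (simp add: sum.distrib)
  also have "(\<Sum>x\<in>A. \<Sum>z\<in>A - {x}. a x z) = 0"
    using insert by simp
  finally have "(\<Sum>x\<in>insert y A. \<Sum>z\<in>insert y A - {x}. a x z) = (\<Sum>z\<in>A. a y z + a z y)"
    using insert.hyps by (simp add: sum.distrib)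
  also have "\<dots> = 0"
    by (rule sum.neutral) (use insert in auto)
  finally show ?case .
qed simp

definition smul :: "('v, 'k::field) mpoly \<Rightarrow> (nat \<Rightarrow> ('v, 'k) mpoly) \<Rightarrow> nat \<Rightarrow> ('v, 'k) mpoly" where
  "smul q v = (\<lambda>s. q * v s)"

lemma smul_apply [simp]: "smul q v s = q * v s"
  by (simp add: smul_def)

lemma smul_simps:
  "smul q (u + v) = smul q u + smul q v" "smul (p + q) v = smul p v + smul q v"
  "smul p (smul q v) = smul (p * q) v" "smul q 0 = 0" "smul 0 v = 0" "smul 1 v = v"
  "smul q (- v) = - smul q v" "smul (- q) v = - smul q v" "smul q (u - v) = smul q u - smul q v"
  by (auto simp: fun_eq_iff algebra_simps)

lemma smul_sum: "smul q (\<Sum>a\<in>A. f a) = (\<Sum>a\<in>A. smul q (f a))"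
  by (auto simp: fun_eq_iff sum_fun_apply sum_distrib_left)

text \<open>The set stands for a basis element of the exterior algebra, its value for a coefficient
  in a module of vectors. Vectors are functions on all of \<open>nat\<close>, so that modules of
  every rank share one type.\<close>

type_synonym ('v, 'k) kchain = "'v set \<Rightarrow> nat \<Rightarrow> ('v, 'k) mpoly"

definition kscale :: "'k::field \<Rightarrow> ('v, 'k) kchain \<Rightarrow> ('v, 'k) kchain" where
  "kscale a c = (\<lambda>S. smul (cst a) (c S))"

lemma kscale_apply: "kscale a c S = smul (cst a) (c S)"
  by (simp add: kscale_def)

interpretation kspace: vector_space "kscale :: 'k::field \<Rightarrow> ('v, 'k) kchain \<Rightarrow> ('v, 'k) kchain"
proof
  fix a b :: 'k and x y :: "('v, 'k) kchain"
  show "kscale a (x + y) = kscale a x + kscale a y"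
    by (auto simp: fun_eq_iff kscale_def distrib_left)
  show "kscale (a + b) x = kscale a x + kscale b x"
    by (auto simp: fun_eq_iff kscale_def distrib_right single_add)
  show "kscale a (kscale b x) = kscale (a * b) x"
    by (auto simp: fun_eq_iff kscale_def mult_single simp flip: mult.assoc)
  show "kscale 1 x = x"
    by (auto simp: fun_eq_iff kscale_def)
qed

section \<open>Dimensions of quotients\<close>

text \<open>Expresses that Z/B has dimension n without forming a quotient type: \<open>b\<close>
  lists representatives of a basis.\<close>

definition has_quotient_dim :: "('v, 'k::field) kchain set \<Rightarrow> ('v, 'k) kchain set \<Rightarrow> nat \<Rightarrow> bool" where
  "has_quotient_dim Z B n \<longleftrightarrow> (\<exists>b. (\<forall>l<n. b l \<in> Z) \<and>
     (\<forall>z\<in>Z. \<exists>a. z - (\<Sum>l<n. kscale (a l) (b l)) \<in> B) \<and>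
     (\<forall>a. (\<Sum>l<n. kscale (a l) (b l)) \<in> B \<longrightarrow> (\<forall>l<n. a l = 0)))"

lemma has_quotient_dimE:
  assumes "has_quotient_dim Z B n"
  obtains b where "\<And>l. l < n \<Longrightarrow> b l \<in> Z" "\<And>z. z \<in> Z \<Longrightarrow> \<exists>a. z - (\<Sum>l<n. kscale (a l) (b l)) \<in> B"
    "\<And>a l. (\<Sum>l<n. kscale (a l) (b l)) \<in> B \<Longrightarrow> l < n \<Longrightarrow> a l = 0"
proof -
  obtain b where b: "\<forall>l<n. b l \<in> Z" "\<forall>z\<in>Z. \<exists>a. z - (\<Sum>l<n. kscale (a l) (b l)) \<in> B"
    "\<forall>a. (\<Sum>l<n. kscale (a l) (b l)) \<in> B \<longrightarrow> (\<forall>l<n. a l = 0)"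
    using assms unfolding has_quotient_dim_def by (elim exE conjE)
  show thesis
    by (rule that[of b]) (use b in simp_all)
qed

text \<open>An isomorphism \<open>Z / B \<cong> Z' / B'\<close> given as a linear relation, so that connecting
  homomorphisms need no choice of lifts.\<close>

definition quotient_iso ::
  "('v, 'k::field) kchain set \<Rightarrow> ('v, 'k) kchain set \<Rightarrow> ('v, 'k) kchain set \<Rightarrow> ('v, 'k) kchain set \<Rightarrow> bool" where
  "quotient_iso Z B Z' B' \<longleftrightarrow> (\<exists>\<rho>.
     (\<forall>(z, z')\<in>\<rho>. z \<in> Z \<and> z' \<in> Z' \<and> (z \<in> B \<longleftrightarrow> z' \<in> B')) \<and>
     Z \<subseteq> Domain \<rho> \<and> Z' \<subseteq> Range \<rho> \<and> (0, 0) \<in> \<rho> \<and>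
     (\<forall>(z, z')\<in>\<rho>. \<forall>(w, w')\<in>\<rho>. (z + w, z' + w') \<in> \<rho>) \<and>
     (\<forall>(z, z')\<in>\<rho>. \<forall>a. (kscale a z, kscale a z') \<in> \<rho>))"

lemma quotient_iso_sym:
  assumes "quotient_iso Z B Z' B'"
  shows "quotient_iso Z' B' Z B"
proof -
  obtain \<rho> where \<rho>: "\<forall>(z, z')\<in>\<rho>. z \<in> Z \<and> z' \<in> Z' \<and> (z \<in> B \<longleftrightarrow> z' \<in> B')"
    "Z \<subseteq> Domain \<rho>" "Z' \<subseteq> Range \<rho>" "(0, 0) \<in> \<rho>"
    "\<forall>(z, z')\<in>\<rho>. \<forall>(w, w')\<in>\<rho>. (z + w, z' + w') \<in> \<rho>"
    "\<forall>(z, z')\<in>\<rho>. \<forall>a. (kscale a z, kscale a z') \<in> \<rho>"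
    using assms unfolding quotient_iso_def by blast
  show ?thesis
    unfolding quotient_iso_def
  proof (intro exI[of _ "\<rho>\<inverse>"] conjI)
    show "\<forall>(z', z)\<in>\<rho>\<inverse>. z' \<in> Z' \<and> z \<in> Z \<and> (z' \<in> B' \<longleftrightarrow> z \<in> B)"
      using \<rho>(1) by fast
    show "Z' \<subseteq> Domain (\<rho>\<inverse>)" "Z \<subseteq> Range (\<rho>\<inverse>)" "(0, 0) \<in> \<rho>\<inverse>"
      using \<rho>(2-4) by simp_all
    show "\<forall>(z, z')\<in>\<rho>\<inverse>. \<forall>(w, w')\<in>\<rho>\<inverse>. (z + w, z' + w') \<in> \<rho>\<inverse>"
      using \<rho>(5) by fast
    show "\<forall>(z, z')\<in>\<rho>\<inverse>. \<forall>a. (kscale a z, kscale a z') \<in> \<rho>\<inverse>"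
      using \<rho>(6) by fast
  qed
qed

text \<open>A relation closed under sums and scalars pairs linear combinations with linear
  combinations, and it respects membership in \<open>B\<close> and \<open>B'\<close>; so elements
  related to basis representatives are basis representatives.\<close>

lemma has_quotient_dim_transport:
  assumes "quotient_iso Z B Z' B'" "has_quotient_dim Z B n"
  shows "has_quotient_dim Z' B' n"
proof -
  obtain \<rho> where \<rho>': "\<forall>(z, z')\<in>\<rho>. z \<in> Z \<and> z' \<in> Z' \<and> (z \<in> B \<longleftrightarrow> z' \<in> B')"
    "Z \<subseteq> Domain \<rho>" "Z' \<subseteq> Range \<rho>" "(0, 0) \<in> \<rho>"
    "\<forall>(z, z')\<in>\<rho>. \<forall>(w, w')\<in>\<rho>. (z + w, z' + w') \<in> \<rho>"
    "\<forall>(z, z')\<in>\<rho>. \<forall>a. (kscale a z, kscale a z') \<in> \<rho>"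
    using assms(1) unfolding quotient_iso_def by blast
  have \<rho>1: "z \<in> Z \<and> z' \<in> Z' \<and> (z \<in> B \<longleftrightarrow> z' \<in> B')" if "(z, z') \<in> \<rho>" for z z'
    using bspec[OF \<rho>'(1) that] by simp
  have \<rho>5: "(z + w, z' + w') \<in> \<rho>" if "(z, z') \<in> \<rho>" "(w, w') \<in> \<rho>" for z z' w w'
    using bspec[OF \<rho>'(5) that(1)] that(2) by fast
  have \<rho>6: "(kscale a z, kscale a z') \<in> \<rho>" if "(z, z') \<in> \<rho>" for z z' a
    using bspec[OF \<rho>'(6) that] by simp
  note \<rho> = \<rho>1 \<rho>'(2-4) \<rho>5 \<rho>6
  from assms(2) obtain b where b: "\<And>l. l < n \<Longrightarrow> b l \<in> Z" "\<And>z. z \<in> Z \<Longrightarrow> \<exists>a. z - (\<Sum>l<n. kscale (a l) (b l)) \<in> B"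
    "\<And>a l. (\<Sum>l<n. kscale (a l) (b l)) \<in> B \<Longrightarrow> l < n \<Longrightarrow> a l = 0"
    by (rule has_quotient_dimE) blast
  have "\<forall>l. \<exists>b'. l < n \<longrightarrow> (b l, b') \<in> \<rho>"
    using b(1) \<rho>(2) by blast
  then obtain b' where b': "\<And>l. l < n \<Longrightarrow> (b l, b' l) \<in> \<rho>"
    by metis
  have sum: "(\<Sum>l<m. kscale (a l) (b l), \<Sum>l<m. kscale (a l) (b' l)) \<in> \<rho>" if "m \<le> n" for a m
    using that by (induction m) (use \<rho>(4,5,6) b' in auto)
  have minus: "(z - w, z' - w') \<in> \<rho>" if "(z, z') \<in> \<rho>" "(w, w') \<in> \<rho>" for z z' w w'
  proof -
    have "(kscale (- 1) w, kscale (- 1) w') \<in> \<rho>"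
      by (rule \<rho>(6)[OF that(2)])
    then have "(- w, - w') \<in> \<rho>"
      by simp
    from \<rho>(5)[OF that(1) this] show ?thesis
      by simp
  qed
  show ?thesis
    unfolding has_quotient_dim_def
  proof (intro exI[of _ b'] conjI allI impI ballI)
    show "b' l \<in> Z'" if "l < n" for l
      using \<rho>(1) b' that by blast
    show "\<exists>a. z' - (\<Sum>l<n. kscale (a l) (b' l)) \<in> B'" if "z' \<in> Z'" for z'
    proof -
      obtain z where z: "(z, z') \<in> \<rho>"
        using \<rho>(3) \<open>z' \<in> Z'\<close> by blast
      then obtain a where "z - (\<Sum>l<n. kscale (a l) (b l)) \<in> B"
        using b(2) \<rho>(1) by blast
      then have "z' - (\<Sum>l<n. kscale (a l) (b' l)) \<in> B'"
        using \<rho>(1)[OF minus[OF z sum[OF order_refl, of a]]] by simp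
      then show ?thesis
        by blast
    qed
    show "a l = 0" if "(\<Sum>l<n. kscale (a l) (b' l)) \<in> B'" "l < n" for a l
      using b(3)[of a l] that \<rho>(1)[OF sum[OF order_refl, of a]] by simp
  qed
qed

lemma has_quotient_dim_0_iff: "has_quotient_dim Z B 0 \<longleftrightarrow> Z \<subseteq> B"
  by (auto simp: has_quotient_dim_def)

lemma has_quotient_dim_subset:
  fixes Z :: "('v, 'k::field) kchain set"
  assumes "has_quotient_dim Z B n" "Z \<subseteq> B"
  shows "n = 0"
proof (rule ccontr)
  assume "n \<noteq> 0"
  then have n: "0 < n"
    by simp
  from assms(1) obtain b where b: "\<And>l. l < n \<Longrightarrow> b l \<in> Z"
    "\<And>a l. (\<Sum>l<n. kscale (a l) (b l)) \<in> B \<Longrightarrow> l < n \<Longrightarrow> a l = 0"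
    by (rule has_quotient_dimE) blast
  let ?a = "\<lambda>l. if l = 0 then 1 else 0 :: 'k"
  have "(\<Sum>l<n. kscale (?a l) (b l)) = (\<Sum>l<n. if l = 0 then b l else 0)"
    by (rule sum.cong) auto
  also have "\<dots> = b 0"
    using n by simp
  finally have "(\<Sum>l<n. kscale (?a l) (b l)) \<in> B"
    using b(1)[OF n] assms(2) by auto
  from b(2)[OF this n] show False
    by simp
qed

text \<open>A basis of \<open>B\<close> is extended to a basis of \<open>Z\<close>; the vectors
  added represent a basis of the quotient.\<close>

lemma has_quotient_dim_exists:
  assumes "kspace.subspace Z" "kspace.subspace B" "B \<subseteq> Z" "finite W" "Z \<subseteq> kspace.span W"
  shows "\<exists>n. has_quotient_dim Z B n"
proof -
  obtain C where C: "C \<subseteq> B" "kspace.independent C" "B \<subseteq> kspace.span C"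
    by (rule kspace.maximal_independent_subset)
  obtain D where D: "C \<subseteq> D" "D \<subseteq> Z" "kspace.independent D" "Z \<subseteq> kspace.span D"
    by (rule kspace.maximal_independent_subset_extend[OF subset_trans[OF C(1) assms(3)] C(2)])
  have "finite D"
    using kspace.independent_span_bound[OF assms(4) D(3) subset_trans[OF D(2) assms(5)]] by simp
  define n where "n = card (D - C)"
  obtain b where b: "bij_betw b {..<n} (D - C)"
    using ex_bij_betw_nat_finite[of "D - C"] \<open>finite D\<close> by (auto simp: n_def atLeast0LessThan)
  have reindex: "(\<Sum>l<n. kscale (a (b l)) (b l)) = (\<Sum>x\<in>D - C. kscale (a x) x)" for a
    by (rule sum.reindex_bij_betw[OF b])
  have spanC: "kspace.span C = B"
    using kspace.span_minimal[OF C(1) assms(2)] C(3) by (rule subset_antisym)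
  show ?thesis
    unfolding has_quotient_dim_def
  proof (intro exI[of _ n] exI[of _ b] conjI allI impI ballI)
    show "b l \<in> Z" if "l < n" for l
      using b D(2) that by (auto simp: bij_betw_def)
    show "\<exists>a. z - (\<Sum>l<n. kscale (a l) (b l)) \<in> B" if "z \<in> Z" for z
    proof -
      have "z \<in> kspace.span D"
        using D(4) that by blast
      then obtain a where a: "z = (\<Sum>x\<in>D. kscale (a x) x)"
        using kspace.span_finite[OF \<open>finite D\<close>] by auto
      have "z = (\<Sum>x\<in>D - C. kscale (a x) x) + (\<Sum>x\<in>C. kscale (a x) x)"
        unfolding a using \<open>finite D\<close> by (rule sum.subset_diff[OF D(1)])
      then have "z - (\<Sum>l<n. kscale (a (b l)) (b l)) = (\<Sum>x\<in>C. kscale (a x) x)"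
        by (simp add: reindex)
      also have "\<dots> \<in> kspace.span C"
        by (intro kspace.span_sum kspace.span_scale kspace.span_base)
      finally show ?thesis
        using spanC by (intro exI[of _ "\<lambda>l. a (b l)"]) simp
    qed
    show "a l = 0" if a: "(\<Sum>l<n. kscale (a l) (b l)) \<in> B" and l: "l < n" for a l
    proof -
      define a' where "a' x = a (the_inv_into {..<n} b x)" for x
      have a': "a' (b i) = a i" if "i < n" for i
        using b that by (simp add: a'_def bij_betw_def the_inv_into_f_f)
      have "(\<Sum>l<n. kscale (a l) (b l)) = (\<Sum>x\<in>D - C. kscale (a' x) x)"
        unfolding reindex[symmetric] by (rule sum.cong) (simp_all add: a')
      then have "(\<Sum>x\<in>D - C. kscale (a' x) x) \<in> kspace.span C"
        using a spanC by simp
      moreover have "finite C"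
        using \<open>finite D\<close> D(1) finite_subset by auto
      ultimately obtain e where e: "(\<Sum>x\<in>D - C. kscale (a' x) x) = (\<Sum>x\<in>C. kscale (e x) x)"
        using kspace.span_finite by auto
      \<comment> \<open>A combination of added vectors that lies in \<open>B\<close> is turned into
        a linear relation on the whole independent set \<open>D\<close>.\<close>
      define f where "f x = (if x \<in> C then - e x else a' x)" for x
      have "(\<Sum>x\<in>D. kscale (f x) x) = (\<Sum>x\<in>D - C. kscale (f x) x) + (\<Sum>x\<in>C. kscale (f x) x)"
        using \<open>finite D\<close> by (rule sum.subset_diff[OF D(1)])
      also have "(\<Sum>x\<in>D - C. kscale (f x) x) = (\<Sum>x\<in>D - C. kscale (a' x) x)"
        by (rule sum.cong) (auto simp: f_def)
      also have "(\<Sum>x\<in>C. kscale (f x) x) = - (\<Sum>x\<in>C. kscale (e x) x)"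
        by (simp add: f_def sum_negf)
      finally have "(\<Sum>x\<in>D. kscale (f x) x) = 0"
        unfolding e right_minus .
      moreover have "b l \<in> D" "b l \<notin> C"
        using b l by (auto simp: bij_betw_def)
      ultimately have "f (b l) = 0"
        using kspace.independentD[OF D(3) \<open>finite D\<close> order_refl] by blast
      then show ?thesis
        using \<open>b l \<notin> C\<close> a'[OF l] by (simp add: f_def)
    qed
  qed
qed

text \<open>Representatives together with a basis of \<open>B\<close> form a basis of
  \<open>Z\<close>, so n is a difference of dimensions, whichever representatives are taken.\<close>

lemma has_quotient_dim_unique:
  fixes Z :: "('v, 'k::field) kchain set"
  assumes "kspace.subspace Z" "kspace.subspace B" "B \<subseteq> Z" "finite W" "Z \<subseteq> kspace.span W"
    and "has_quotient_dim Z B n"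
  shows "n + kspace.dim B = kspace.dim Z"
proof -
  from assms(6) obtain b where b: "\<And>l. l < n \<Longrightarrow> b l \<in> Z" "\<And>z. z \<in> Z \<Longrightarrow> \<exists>a. z - (\<Sum>l<n. kscale (a l) (b l)) \<in> B"
    "\<And>a l. (\<Sum>l<n. kscale (a l) (b l)) \<in> B \<Longrightarrow> l < n \<Longrightarrow> a l = 0"
    by (rule has_quotient_dimE) blast
  obtain C where C: "C \<subseteq> B" "kspace.independent C" "B \<subseteq> kspace.span C" "card C = kspace.dim B"
    by (rule kspace.basis_exists)
  have "C \<subseteq> kspace.span W"
    using C(1) assms(3,5) by order
  then have finC: "finite C"
    using kspace.independent_span_bound[OF assms(4) C(2)] by simp
  have spanC: "kspace.span C = B"
    using kspace.span_minimal[OF C(1) assms(2)] C(3) by (rule subset_antisym)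
  have zero: "a l = 0" if "(\<Sum>l<n. kscale (a l) (b l)) = (\<Sum>x\<in>C. kscale (e x) x)" "l < n" for a e l
  proof -
    have "(\<Sum>x\<in>C. kscale (e x) x) \<in> kspace.span C"
      by (intro kspace.span_sum kspace.span_scale kspace.span_base)
    then show ?thesis
      using b(3)[of a l] that spanC by simp
  qed
  have single: "(\<Sum>l<n. kscale (if l = i then 1 else 0) (b l)) = b i" if "i < n" for i
  proof -
    have "(\<Sum>l<n. kscale (if l = i then 1 else 0) (b l)) = (\<Sum>l<n. if l = i then b l else 0)"
      by (rule sum.cong) auto
    then show ?thesis
      using that by simp
  qed
  have inj: "inj_on b {..<n}"
  proof (rule inj_onI, rule ccontr)
    fix i l assume il: "i \<in> {..<n}" "l \<in> {..<n}" "b i = b l" "i \<noteq> l"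
    let ?a = "\<lambda>t. (if t = i then 1 else 0) - (if t = l then 1 else 0) :: 'k"
    have "(\<Sum>t<n. kscale (?a t) (b t)) = 0"
      using il single[of i] single[of l] by (simp add: kspace.scale_left_diff_distrib sum_subtractf)
    then have "?a i = 0"
      using il zero[of ?a "\<lambda>_. 0" i] by simp
    then show False
      using il by simp
  qed
  have disj: "b ` {..<n} \<inter> C = {}"
  proof (rule ccontr)
    assume "b ` {..<n} \<inter> C \<noteq> {}"
    then obtain i where i: "i < n" "b i \<in> C"
      by blast
    have "b i = (\<Sum>x\<in>C. if x = b i then x else 0)"
      using i finC by simp
    also have "\<dots> = (\<Sum>x\<in>C. kscale (if x = b i then 1 else 0) x)"
      by (rule sum.cong) auto
    finally have "(\<Sum>l<n. kscale (if l = i then 1 else 0) (b l)) = (\<Sum>x\<in>C. kscale (if x = b i then 1 else 0) x)"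
      unfolding single[OF i(1)] .
    from zero[OF this i(1)] show False
      by simp
  qed
  let ?D = "b ` {..<n} \<union> C"
  have finD: "finite ?D"
    using finC by simp
  have "kspace.independent ?D"
  proof (rule kspace.independent_if_scalars_zero[OF finD])
    fix f x assume f: "(\<Sum>x\<in>?D. kscale (f x) x) = 0" and x: "x \<in> ?D"
    have "(\<Sum>x\<in>?D. kscale (f x) x) = (\<Sum>x\<in>b ` {..<n}. kscale (f x) x) + (\<Sum>x\<in>C. kscale (f x) x)"
      using finC disj by (intro sum.union_disjoint) auto
    also have "(\<Sum>x\<in>b ` {..<n}. kscale (f x) x) = (\<Sum>l<n. kscale (f (b l)) (b l))"
      by (subst sum.reindex[OF inj]) simp
    finally have "(\<Sum>l<n. kscale (f (b l)) (b l)) + (\<Sum>x\<in>C. kscale (f x) x) = 0"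
      unfolding f by (rule sym)
    then have eq: "(\<Sum>l<n. kscale (f (b l)) (b l)) = - (\<Sum>x\<in>C. kscale (f x) x)"
      by (rule eq_neg_iff_add_eq_0[THEN iffD2])
    also have "\<dots> = (\<Sum>x\<in>C. kscale (- f x) x)"
      by (simp add: sum_negf)
    finally have fb: "f (b l) = 0" if "l < n" for l
      using zero[of "\<lambda>l. f (b l)" "\<lambda>x. - f x" l] that by simp
    then have "(\<Sum>x\<in>C. kscale (f x) x) = 0"
      using eq by simp
    then have "f x = 0" if "x \<in> C" for x
      using kspace.independentD[OF C(2) finC order_refl] that by blast
    then show "f x = 0"
      using x fb by auto
  qed
  moreover have "?D \<subseteq> Z"
    using b(1) C(1) assms(3) by auto
  moreover have "Z \<subseteq> kspace.span ?D"
  proof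
    fix z assume "z \<in> Z"
    then obtain a where a: "z - (\<Sum>l<n. kscale (a l) (b l)) \<in> B"
      using b(2) by blast
    then have "z - (\<Sum>l<n. kscale (a l) (b l)) \<in> kspace.span ?D"
      using kspace.span_mono[of C ?D] spanC by auto
    moreover have "(\<Sum>l<n. kscale (a l) (b l)) \<in> kspace.span ?D"
      by (intro kspace.span_sum kspace.span_scale kspace.span_base) auto
    ultimately show "z \<in> kspace.span ?D"
      using kspace.span_add by fastforce
  qed
  ultimately have "card ?D = kspace.dim Z"
    by (intro kspace.basis_card_eq_dim) auto
  moreover have "card ?D = n + card C"
    using disj finC card_image[OF inj] by (subst card_Un_disjoint) auto
  ultimately show ?thesis
    using C(4) by simp
qed

section \<open>The Koszul complex of a graded module\<close>

definition mod_linear :: "((nat \<Rightarrow> ('v, 'k::field) mpoly) \<Rightarrow> nat \<Rightarrow> ('v, 'k) mpoly) \<Rightarrow> bool" where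
  "mod_linear D \<longleftrightarrow> (\<forall>u v. D (u + v) = D u + D v) \<and> (\<forall>q v. D (smul q v) = smul q (D v))"

lemma mod_linearD:
  assumes "mod_linear D"
  shows "D (u + v) = D u + D v" "D (smul q v) = smul q (D v)" "D 0 = 0" "D (- v) = - D v"
    "D (u - v) = D u - D v" "D (\<Sum>a\<in>A. f a) = (\<Sum>a\<in>A. D (f a))"
proof -
  show add: "D (u + v) = D u + D v" and scale: "D (smul q v) = smul q (D v)" for u v q
    using assms by (auto simp: mod_linear_def)
  show zero: "D 0 = 0"
    using scale[of 0 0] by (simp add: smul_simps)
  show neg: "D (- v) = - D v" for v
    using scale[of "-1" v] by (simp add: smul_simps)
  show "D (u - v) = D u - D v"
    using add[of u "- v"] by (simp add: neg)
  show "D (\<Sum>a\<in>A. f a) = (\<Sum>a\<in>A. D (f a))"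
  proof (induction A rule: infinite_finite_induct)
    case (insert x A)
    then show ?case
      using add[of "f x" "sum f A"] by (simp only: sum.insert not_False_eq_True)
  qed (simp_all only: sum.infinite sum.empty zero not_False_eq_True)
qed

context sign_function
begin

text \<open>The module is encoded by its homogeneous pieces, each of which is a vector space over
  the field; homogeneous polynomials move between the pieces.\<close>

definition graded_module :: "(int \<Rightarrow> (nat \<Rightarrow> ('v, 'k) mpoly) set) \<Rightarrow> bool" where
  "graded_module M \<longleftrightarrow> (\<forall>j. 0 \<in> M j \<and> (\<forall>u\<in>M j. \<forall>v\<in>M j. u + v \<in> M j) \<and>
     (\<forall>q d. \<forall>v\<in>M j. q \<in> poly_ring V \<longrightarrow> homogeneous d q \<longrightarrow> smul q v \<in> M (j + d)))"

lemma graded_moduleD: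
  assumes "graded_module M"
  shows "0 \<in> M j" "u \<in> M j \<Longrightarrow> v \<in> M j \<Longrightarrow> u + v \<in> M j"
    "v \<in> M j \<Longrightarrow> q \<in> poly_ring V \<Longrightarrow> homogeneous d q \<Longrightarrow> smul q v \<in> M (j + d)"
    "v \<in> M j \<Longrightarrow> smul (cst a) v \<in> M j" "v \<in> M j \<Longrightarrow> - v \<in> M j"
    "(\<And>a. a \<in> A \<Longrightarrow> f a \<in> M j) \<Longrightarrow> sum f A \<in> M j"
proof -
  show zero: "0 \<in> M j" for j
    using assms by (auto simp: graded_module_def)
  show add: "u \<in> M j \<Longrightarrow> v \<in> M j \<Longrightarrow> u + v \<in> M j" for u v
    using assms by (auto simp: graded_module_def)
  show scale: "v \<in> M j \<Longrightarrow> q \<in> poly_ring V \<Longrightarrow> homogeneous d q \<Longrightarrow> smul q v \<in> M (j + d)" for q d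
    using assms by (auto simp: graded_module_def)
  show cst: "v \<in> M j \<Longrightarrow> smul (cst a) v \<in> M j" for a
    using scale[of "cst a" 0] by simp
  show "- v \<in> M j" if "v \<in> M j"
  proof -
    have "smul (cst (-1)) v = - v"
      by (simp add: single_uminus smul_simps)
    then show ?thesis
      using cst[OF that, of "-1"] by simp
  qed
  show "(\<And>a. a \<in> A \<Longrightarrow> f a \<in> M j) \<Longrightarrow> sum f A \<in> M j"
    by (induction A rule: infinite_finite_induct) (auto intro: zero add)
qed

definition kcoeff :: "'v \<Rightarrow> 'v set \<Rightarrow> ('v, 'k) mpoly" where
  "kcoeff x S = cst (sg x S) * var x"

definition kdiff :: "('v, 'k) kchain \<Rightarrow> ('v, 'k) kchain" where
  "kdiff c S = (\<Sum>x\<in>V - S. smul (kcoeff x S) (c (insert x S)))"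

text \<open>Here \<open>j\<close> is the total and \<open>p\<close> the homological degree. The
  exterior basis element of S has degree \<open>card S\<close>, so coefficients have degree j - p
  and the differential preserves j.\<close>

definition kchains :: "(int \<Rightarrow> (nat \<Rightarrow> ('v, 'k) mpoly) set) \<Rightarrow> int \<Rightarrow> int \<Rightarrow> ('v, 'k) kchain set" where
  "kchains M j p = {c. \<forall>S. if S \<subseteq> V \<and> int (card S) = p then c S \<in> M (j - p) else c S = 0}"

definition kcycles :: "(int \<Rightarrow> (nat \<Rightarrow> ('v, 'k) mpoly) set) \<Rightarrow> int \<Rightarrow> int \<Rightarrow> ('v, 'k) kchain set" where
  "kcycles M j p = {c \<in> kchains M j p. kdiff c = 0}"

definition kbounds :: "(int \<Rightarrow> (nat \<Rightarrow> ('v, 'k) mpoly) set) \<Rightarrow> int \<Rightarrow> int \<Rightarrow> ('v, 'k) kchain set" where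
  "kbounds M j p = kdiff ` kchains M j (p + 1)"

lemma kcoeff_poly_ring: "x \<in> V \<Longrightarrow> kcoeff x S \<in> poly_ring V"
  unfolding kcoeff_def by (intro poly_ring_mult poly_ring_cst poly_ring_var)

lemma homogeneous_kcoeff: "homogeneous 1 (kcoeff x S)"
  unfolding kcoeff_def using homogeneous_mult[OF homogeneous_cst homogeneous_var] by simp

lemma kcoeff_swap:
  assumes "S \<subseteq> V" "x \<in> V" "z \<in> V" "x \<noteq> z" "x \<notin> S" "z \<notin> S"
  shows "kcoeff x S * kcoeff z (insert x S) + kcoeff z S * kcoeff x (insert z S) = 0"
proof -
  have "kcoeff x S * kcoeff z (insert x S) = cst (sg z (insert x S) * sg x S) * (var x * var z)"
    unfolding kcoeff_def by (simp add: mult_single[of 0 _ 0, simplified, symmetric] algebra_simps)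
  moreover have "kcoeff z S * kcoeff x (insert z S) = cst (sg x (insert z S) * sg z S) * (var x * var z)"
    unfolding kcoeff_def by (simp add: mult_single[of 0 _ 0, simplified, symmetric] algebra_simps)
  ultimately show ?thesis
    by (simp add: sg_swap[OF assms] single_uminus)
qed

lemma kdiff_add: "kdiff (c + d) = kdiff c + kdiff d"
  by (rule ext) (simp add: kdiff_def smul_simps sum.distrib)

lemma kdiff_scale: "kdiff (kscale a c) = kscale a (kdiff c)"
  by (rule ext) (simp add: kdiff_def kscale_apply smul_simps smul_sum mult.commute)

lemma kdiff_0 [simp]: "kdiff 0 = 0"
  by (rule ext) (simp add: kdiff_def smul_simps)

lemma kdiff_minus: "kdiff (- c) = - kdiff c"
  by (rule ext) (simp add: kdiff_def smul_simps sum_negf)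

lemma kdiff_diff: "kdiff (c - d) = kdiff c - kdiff d"
  using kdiff_add[of c "- d"] by (simp add: kdiff_minus)

lemma kchainsD:
  assumes "c \<in> kchains M j p"
  shows "S \<subseteq> V \<Longrightarrow> int (card S) = p \<Longrightarrow> c S \<in> M (j - p)"
    "\<not> S \<subseteq> V \<Longrightarrow> c S = 0" "int (card S) \<noteq> p \<Longrightarrow> c S = 0"
    "\<not> (S \<subseteq> V \<and> int (card S) = p) \<Longrightarrow> c S = 0"
proof -
  have *: "if S \<subseteq> V \<and> int (card S) = p then c S \<in> M (j - p) else c S = 0"
    using assms unfolding kchains_def by blast
  show "S \<subseteq> V \<Longrightarrow> int (card S) = p \<Longrightarrow> c S \<in> M (j - p)"
    "\<not> S \<subseteq> V \<Longrightarrow> c S = 0" "int (card S) \<noteq> p \<Longrightarrow> c S = 0"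
    "\<not> (S \<subseteq> V \<and> int (card S) = p) \<Longrightarrow> c S = 0"
    using * by (simp_all split: if_splits)
qed

lemma kchainsI:
  assumes "\<And>S. S \<subseteq> V \<Longrightarrow> int (card S) = p \<Longrightarrow> c S \<in> M (j - p)"
    "\<And>S. \<not> (S \<subseteq> V \<and> int (card S) = p) \<Longrightarrow> c S = 0"
  shows "c \<in> kchains M j p"
  using assms unfolding kchains_def by auto

lemma kchains_add:
  assumes "graded_module M" "c \<in> kchains M j p" "d \<in> kchains M j p"
  shows "c + d \<in> kchains M j p"
proof (rule kchainsI)
  fix S assume "S \<subseteq> V" "int (card S) = p"
  then show "(c + d) S \<in> M (j - p)"
    using kchainsD(1)[OF assms(2)] kchainsD(1)[OF assms(3)] graded_moduleD(2)[OF assms(1)] by simp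
next
  fix S assume "\<not> (S \<subseteq> V \<and> int (card S) = p)"
  then show "(c + d) S = 0"
    using kchainsD(4)[OF assms(2)] kchainsD(4)[OF assms(3)] by simp
qed

lemma kchains_scale:
  assumes "graded_module M" "c \<in> kchains M j p"
  shows "kscale a c \<in> kchains M j p"
proof (rule kchainsI)
  fix S assume "S \<subseteq> V" "int (card S) = p"
  then show "kscale a c S \<in> M (j - p)"
    using kchainsD(1)[OF assms(2)] graded_moduleD(4)[OF assms(1)] by (simp add: kscale_apply)
next
  fix S assume "\<not> (S \<subseteq> V \<and> int (card S) = p)"
  then show "kscale a c S = 0"
    using kchainsD(4)[OF assms(2)] by (simp add: kscale_apply smul_simps)
qed

lemma kchains_0: "graded_module M \<Longrightarrow> 0 \<in> kchains M j p"
  by (rule kchainsI) (auto intro: graded_moduleD)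

lemma kchains_diff:
  assumes "graded_module M" "c \<in> kchains M j p" "d \<in> kchains M j p"
  shows "c - d \<in> kchains M j p"
  using kchains_add[OF assms(1,2) kchains_scale[OF assms(1,3), of "-1"]] by simp

lemma kdiff_kchains:
  assumes "graded_module M" "c \<in> kchains M j (p + 1)"
  shows "kdiff c \<in> kchains M j p"
proof (rule kchainsI)
  fix S assume S: "S \<subseteq> V" "int (card S) = p"
  show "kdiff c S \<in> M (j - p)"
    unfolding kdiff_def
  proof (rule graded_moduleD(6)[OF assms(1)])
    fix x assume x: "x \<in> V - S"
    have "finite S"
      using S(1) finite_V finite_subset by auto
    then have "int (card (insert x S)) = p + 1"
      using x S(2) by simp
    then have "c (insert x S) \<in> M (j - (p + 1))"
      using kchainsD(1)[OF assms(2), of "insert x S"] x S(1) by simp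
    from graded_moduleD(3)[OF assms(1) this kcoeff_poly_ring homogeneous_kcoeff]
    show "smul (kcoeff x S) (c (insert x S)) \<in> M (j - p)"
      using x by simp
  qed
next
  fix S assume S: "\<not> (S \<subseteq> V \<and> int (card S) = p)"
  have "c (insert x S) = 0" if x: "x \<in> V - S" for x
  proof (cases "S \<subseteq> V")
    case True
    then have "finite S"
      using finite_V finite_subset by auto
    then show ?thesis
      using S True x by (intro kchainsD(3)[OF assms(2)]) auto
  next
    case False
    then show ?thesis
      by (intro kchainsD(2)[OF assms(2)]) auto
  qed
  then show "kdiff c S = 0"
    unfolding kdiff_def by (intro sum.neutral) (simp add: smul_simps)
qed

lemma kdiff_kdiff:
  assumes "c \<in> kchains M j p"
  shows "kdiff (kdiff c) = 0"
proof
  fix S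
  show "kdiff (kdiff c) S = 0 S"
  proof (cases "S \<subseteq> V")
    case True
    let ?a = "\<lambda>x z. smul (kcoeff x S * kcoeff z (insert x S)) (c (insert z (insert x S)))"
    have "kdiff (kdiff c) S = (\<Sum>x\<in>V - S. \<Sum>z\<in>V - S - {x}. ?a x z)"
      unfolding kdiff_def smul_sum by (intro sum.cong) (auto simp: smul_simps)
    also have "\<dots> = 0"
    proof (rule sum_antisymmetric)
      fix x z assume xz: "x \<in> V - S" "z \<in> V - S" "x \<noteq> z"
      have "?a x z + ?a z x =
        smul (kcoeff x S * kcoeff z (insert x S) + kcoeff z S * kcoeff x (insert z S)) (c (insert z (insert x S)))"
        by (simp add: smul_simps insert_commute)
      also have "\<dots> = 0"
        using kcoeff_swap[OF True, of x z] xz by (simp add: smul_simps)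
      finally show "?a x z + ?a z x = 0" .
    qed (use finite_V in simp)
    finally show ?thesis
      by simp
  next
    case False
    then have "c (insert z (insert x S)) = 0" for x z
      by (intro kchainsD(2)[OF assms]) auto
    then show ?thesis
      by (simp add: kdiff_def smul_simps)
  qed
qed

lemma kbounds_kcycles: "graded_module M \<Longrightarrow> kbounds M j p \<subseteq> kcycles M j p"
  using kdiff_kchains kdiff_kdiff by (auto simp: kbounds_def kcycles_def)

lemma subspace_kcycles: "graded_module M \<Longrightarrow> kspace.subspace (kcycles M j p)"
  by (auto simp: kspace.subspace_def kcycles_def kchains_0 kchains_add kchains_scale kdiff_add kdiff_scale)

lemma subspace_kbounds: "graded_module M \<Longrightarrow> kspace.subspace (kbounds M j p)"
  unfolding kspace.subspace_def kbounds_def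
  by (auto simp flip: kdiff_add kdiff_scale intro!: imageI kchains_add kchains_scale)
    (metis imageI kchains_0 kdiff_0)

lemma kdiff_comp: "mod_linear D \<Longrightarrow> kdiff (\<lambda>S. D (c S)) = (\<lambda>S. D (kdiff c S))"
  by (rule ext) (simp only: kdiff_def mod_linearD(2,6))

text \<open>The lift is taken coefficient by coefficient, with 0 wherever a chain has to
  vanish.\<close>

lemma kchains_lift:
  assumes "mod_linear D" "\<And>j. D ` F j = M j" "c \<in> kchains M j p"
  obtains b where "b \<in> kchains F j p" "(\<lambda>S. D (b S)) = c"
proof -
  have "\<exists>w. (S \<subseteq> V \<and> int (card S) = p \<longrightarrow> w \<in> F (j - p)) \<and> (\<not> (S \<subseteq> V \<and> int (card S) = p) \<longrightarrow> w = 0) \<and> D w = c S" for S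
  proof (cases "S \<subseteq> V \<and> int (card S) = p")
    case True
    then have "c S \<in> D ` F (j - p)"
      using kchainsD(1)[OF assms(3)] assms(2) by blast
    then obtain w where "w \<in> F (j - p)" "D w = c S"
      by auto
    then show ?thesis
      using True by (intro exI[of _ w]) simp
  next
    case False
    then show ?thesis
      using kchainsD(4)[OF assms(3) False] mod_linearD(3)[OF assms(1)] by auto
  qed
  then obtain b where b: "\<And>S. S \<subseteq> V \<and> int (card S) = p \<Longrightarrow> b S \<in> F (j - p)"
    "\<And>S. \<not> (S \<subseteq> V \<and> int (card S) = p) \<Longrightarrow> b S = 0" "\<And>S. D (b S) = c S"
    by metis
  show ?thesis
  proof (rule that[of b])
    show "b \<in> kchains F j p"
      by (rule kchainsI) (use b(1,2) in simp_all)
    show "(\<lambda>S. D (b S)) = c"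
      using b(3) by (rule ext)
  qed
qed

lemma kchains_comp:
  assumes "mod_linear D" "\<And>j. D ` F j = M j" "b \<in> kchains F j p"
  shows "(\<lambda>S. D (b S)) \<in> kchains M j p"
proof (rule kchainsI)
  fix S assume "S \<subseteq> V" "int (card S) = p"
  then show "D (b S) \<in> M (j - p)"
    using kchainsD(1)[OF assms(3)] assms(2) by blast
next
  fix S assume "\<not> (S \<subseteq> V \<and> int (card S) = p)"
  then show "D (b S) = 0"
    using kchainsD(4)[OF assms(3)] mod_linearD(3)[OF assms(1)] by simp
qed

lemma kchains_kernel: "c \<in> kchains (\<lambda>j. {v \<in> F j. D v = 0}) j p \<longleftrightarrow> c \<in> kchains F j p \<and> (\<forall>S. D (c S) = 0)"
  if "mod_linear D"
proof
  assume c: "c \<in> kchains (\<lambda>j. {v \<in> F j. D v = 0}) j p"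
  have "D (c S) = 0" for S
    using kchainsD(1)[OF c, of S] kchainsD(4)[OF c, of S] mod_linearD(3)[OF that]
    by (cases "S \<subseteq> V \<and> int (card S) = p") auto
  moreover have "c \<in> kchains F j p"
    by (rule kchainsI) (use kchainsD(1)[OF c] kchainsD(4)[OF c] in auto)
  ultimately show "c \<in> kchains F j p \<and> (\<forall>S. D (c S) = 0)"
    by blast
next
  assume c: "c \<in> kchains F j p \<and> (\<forall>S. D (c S) = 0)"
  show "c \<in> kchains (\<lambda>j. {v \<in> F j. D v = 0}) j p"
    by (rule kchainsI) (use kchainsD(1)[OF conjunct1[OF c]] kchainsD(4)[OF conjunct1[OF c]] c in simp_all)
qed

text \<open>The connecting isomorphism of \<open>0 \<rightarrow> N \<rightarrow> F \<rightarrow> M \<rightarrow> 0\<close>; in homological degree 0 it exists because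
  \<open>N \<subseteq> \<mm>F\<close>, the elements of \<open>\<mm>F\<close> being the boundaries of degree 0.\<close>

lemma connecting_iso:
  assumes F: "graded_module F" and M: "graded_module M" and D: "mod_linear D"
    and surj: "\<And>j. D ` F j = M j" and N: "N = (\<lambda>j. {v \<in> F j. D v = 0})"
    and exact: "\<And>p. 1 \<le> p \<Longrightarrow> kcycles F j p \<subseteq> kbounds F j p"
    and minimal: "kchains N j 0 \<subseteq> kbounds F j 0" and p: "0 \<le> p"
  shows "quotient_iso (kcycles N j p) (kbounds N j p) (kcycles M j (p + 1)) (kbounds M j (p + 1))"
proof -
  \<comment> \<open>The snake: \<open>b\<close> lifts the cycle on the side of \<open>M\<close>, and
    the boundary of \<open>b\<close> falls into the kernel \<open>N\<close>. Admitting all lifts at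
    once keeps the relation linear.\<close>
  define \<rho> where "\<rho> = {(kdiff b, \<lambda>S. D (b S)) | b. b \<in> kchains F j (p + 1) \<and> (\<forall>S. D (kdiff b S) = 0)}"
  note lin = mod_linearD[OF D]
  have NC: "c \<in> kchains N j q \<longleftrightarrow> c \<in> kchains F j q \<and> (\<forall>S. D (c S) = 0)" for c q
    unfolding N by (rule kchains_kernel[OF D])
  show ?thesis
    unfolding quotient_iso_def
  proof (intro exI[of _ \<rho>] conjI)
    show "\<forall>(z, z')\<in>\<rho>. z \<in> kcycles N j p \<and> z' \<in> kcycles M j (p + 1) \<and>
        (z \<in> kbounds N j p \<longleftrightarrow> z' \<in> kbounds M j (p + 1))"
    proof clarify
      fix z z' assume "(z, z') \<in> \<rho>"
      then obtain b where b: "z = kdiff b" "z' = (\<lambda>S. D (b S))" "b \<in> kchains F j (p + 1)"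
        "\<And>S. D (kdiff b S) = 0"
        unfolding \<rho>_def by blast
      have 1: "z \<in> kcycles N j p"
        unfolding kcycles_def using b kdiff_kdiff[OF b(3)] kdiff_kchains[OF F b(3)] by (simp add: NC)
      have 2: "z' \<in> kcycles M j (p + 1)"
        unfolding kcycles_def mem_Collect_eq b(2) kdiff_comp[OF D] b(4)
        using kchains_comp[OF D surj b(3)] by (simp add: zero_fun_def)
      have 3: "z' \<in> kbounds M j (p + 1)" if "z \<in> kbounds N j p"
      proof -
        obtain n where n: "n \<in> kchains N j (p + 1)" "kdiff b = kdiff n"
          using \<open>z \<in> kbounds N j p\<close> b(1) by (auto simp: kbounds_def)
        \<comment> \<open>Positive-degree exactness of \<open>F\<close> makes b - n a boundary;
          applying \<open>D\<close>, which kills n, exhibits z' as a boundary.\<close>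
        then have "b - n \<in> kcycles F j (p + 1)"
          using kchains_diff[OF F b(3)] by (simp add: NC kcycles_def kdiff_diff)
        then obtain e where e: "e \<in> kchains F j (p + 1 + 1)" "b - n = kdiff e"
          using exact[of "p + 1"] p by (auto simp: kbounds_def)
        have "z' = kdiff (\<lambda>S. D (e S))"
        proof -
          have "D (b S) = D (kdiff e S)" for S
          proof -
            have "D (kdiff e S) = D (b S) - D (n S)"
              unfolding e(2)[symmetric] minus_apply lin(5) ..
            then show ?thesis
              using n(1) by (simp add: NC)
          qed
          then show ?thesis
            by (simp add: b(2) kdiff_comp[OF D])
        qed
        then show ?thesis
          using kchains_comp[OF D surj e(1)] by (auto simp: kbounds_def)
      qed
      have 4: "z \<in> kbounds N j p" if "z' \<in> kbounds M j (p + 1)"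
      proof -
        obtain e where e: "e \<in> kchains M j (p + 1 + 1)" "z' = kdiff e"
          using \<open>z' \<in> kbounds M j (p + 1)\<close> by (auto simp: kbounds_def)
        obtain e' where e': "e' \<in> kchains F j (p + 1 + 1)" "(\<lambda>S. D (e' S)) = e"
          using kchains_lift[OF D surj e(1)] .
        have "(\<lambda>S. D (b S)) = (\<lambda>S. D (kdiff e' S))"
          using e(2) b(2) unfolding e'(2)[symmetric] kdiff_comp[OF D] by simp
        then have "D (b S) = D (kdiff e' S)" for S
          by (rule fun_cong)
        then have "D ((b - kdiff e') S) = 0" for S
          unfolding minus_apply lin(5) by (simp add: zero_fun_def)
        then have "b - kdiff e' \<in> kchains N j (p + 1)"
          using kchains_diff[OF F b(3) kdiff_kchains[OF F e'(1)]] by (simp add: NC)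
        moreover have "z = kdiff (b - kdiff e')"
          by (simp add: b(1) kdiff_diff kdiff_kdiff[OF e'(1)])
        ultimately show ?thesis
          by (simp add: kbounds_def)
      qed
      show "z \<in> kcycles N j p \<and> z' \<in> kcycles M j (p + 1) \<and> (z \<in> kbounds N j p \<longleftrightarrow> z' \<in> kbounds M j (p + 1))"
        using 1 2 3 4 by blast
    qed
    show "kcycles N j p \<subseteq> Domain \<rho>"
    proof
      fix z assume z: "z \<in> kcycles N j p"
      have "z \<in> kbounds F j p"
      proof (cases "p = 0")
        case True
        then show ?thesis
          using z minimal by (auto simp: kcycles_def)
      next
        case False
        then show ?thesis
          using z exact[of p] p by (auto simp: kcycles_def NC)
      qed
      then obtain b where "b \<in> kchains F j (p + 1)" "z = kdiff b"
        by (auto simp: kbounds_def)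
      then have "(z, \<lambda>S. D (b S)) \<in> \<rho>"
        using z by (auto simp: \<rho>_def kcycles_def NC)
      then show "z \<in> Domain \<rho>"
        by blast
    qed
    show "kcycles M j (p + 1) \<subseteq> Range \<rho>"
    proof
      fix z' assume z': "z' \<in> kcycles M j (p + 1)"
      then have "z' \<in> kchains M j (p + 1)"
        by (simp add: kcycles_def)
      then obtain b where b: "b \<in> kchains F j (p + 1)" "(\<lambda>S. D (b S)) = z'"
        by (rule kchains_lift[OF D surj])
      have "(\<lambda>S. D (kdiff b S)) = 0"
        unfolding kdiff_comp[OF D, symmetric] b(2) using z' by (simp add: kcycles_def)
      then have "D (kdiff b S) = 0" for S
        by (metis zero_fun_apply)
      then have "(kdiff b, z') \<in> \<rho>"
        using b by (auto simp: \<rho>_def)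
      then show "z' \<in> Range \<rho>"
        by blast
    qed
    show "(0, 0) \<in> \<rho>"
    proof -
      have D0: "(\<lambda>S. D ((0 :: ('v, 'k) kchain) S)) = 0"
        by (rule ext) (simp only: zero_fun_apply lin(3))
      have "\<forall>S. D (kdiff 0 S) = 0"
        by (simp only: kdiff_0 zero_fun_apply lin(3)) simp
      then have "(kdiff 0, \<lambda>S. D ((0 :: ('v, 'k) kchain) S)) \<in> \<rho>"
        unfolding \<rho>_def using kchains_0[OF F] by blast
      then show ?thesis
        unfolding D0 kdiff_0 .
    qed
    show "\<forall>(z, z')\<in>\<rho>. \<forall>(w, w')\<in>\<rho>. (z + w, z' + w') \<in> \<rho>"
    proof clarify
      fix z z' w w' assume "(z, z') \<in> \<rho>" "(w, w') \<in> \<rho>"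
      then obtain b d where "z = kdiff b" "z' = (\<lambda>S. D (b S))" "b \<in> kchains F j (p + 1)"
        "\<And>S. D (kdiff b S) = 0" "w = kdiff d" "w' = (\<lambda>S. D (d S))" "d \<in> kchains F j (p + 1)"
        "\<And>S. D (kdiff d S) = 0"
        unfolding \<rho>_def by blast
      then have "z + w = kdiff (b + d)" "z' + w' = (\<lambda>S. D ((b + d) S))" "b + d \<in> kchains F j (p + 1)"
        "\<And>S. D (kdiff (b + d) S) = 0"
        by (simp_all only: kdiff_add plus_fun_apply lin(1) kchains_add[OF F] plus_fun_def[of "\<lambda>S. D (b S)"] add_0)
      then show "(z + w, z' + w') \<in> \<rho>"
        unfolding \<rho>_def by blast
    qed
    show "\<forall>(z, z')\<in>\<rho>. \<forall>a. (kscale a z, kscale a z') \<in> \<rho>"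
    proof clarify
      fix z z' a assume "(z, z') \<in> \<rho>"
      then obtain b where "z = kdiff b" "z' = (\<lambda>S. D (b S))" "b \<in> kchains F j (p + 1)"
        "\<And>S. D (kdiff b S) = 0"
        unfolding \<rho>_def by blast
      then have "kscale a z = kdiff (kscale a b)" "kscale a z' = (\<lambda>S. D (kscale a b S))"
        "kscale a b \<in> kchains F j (p + 1)" "\<And>S. D (kdiff (kscale a b) S) = 0"
        by (simp_all only: kdiff_scale kscale_apply lin(2) kchains_scale[OF F] kscale_def[of a "\<lambda>S. D (b S)"] smul_simps(4))
      then show "(kscale a z, kscale a z') \<in> \<rho>"
        unfolding \<rho>_def by blast
    qed
  qed
qed

lemma kcycles_0: "kcycles M j 0 = kchains M j 0"
proof -
  have "kdiff c = 0" if c: "c \<in> kchains M j 0" for c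
  proof
    fix S
    have "c (insert x S) = 0" if "x \<in> V - S" for x
    proof (cases "insert x S \<subseteq> V")
      case True
      then have "finite (insert x S)"
        by (rule finite_subset[OF _ finite_V])
      then show ?thesis
        by (intro kchainsD(3)[OF c]) auto
    qed (rule kchainsD(2)[OF c])
    then show "kdiff c S = 0 S"
      unfolding kdiff_def zero_fun_apply[of S] by (intro sum.neutral) (simp add: smul_simps)
  qed
  then show ?thesis
    by (auto simp: kcycles_def)
qed

text \<open>Koszul homology in degree 0 is the module modulo the variables times the module. Passing
  from \<open>F\<close> to \<open>M\<close> does not change it, since the kernel already lies in the
  part divided out.\<close>

lemma generators_iso:
  assumes F: "graded_module F" and M: "graded_module M" and D: "mod_linear D"
    and surj: "\<And>j. D ` F j = M j" and N: "N = (\<lambda>j. {v \<in> F j. D v = 0})"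
    and minimal: "kchains N j 0 \<subseteq> kbounds F j 0"
  shows "quotient_iso (kcycles F j 0) (kbounds F j 0) (kcycles M j 0) (kbounds M j 0)"
proof -
  define \<rho> where "\<rho> = {(b, \<lambda>S. D (b S)) | b. b \<in> kchains F j 0}"
  note lin = mod_linearD[OF D]
  have NC: "c \<in> kchains N j q \<longleftrightarrow> c \<in> kchains F j q \<and> (\<forall>S. D (c S) = 0)" for c q
    unfolding N by (rule kchains_kernel[OF D])
  show ?thesis
    unfolding quotient_iso_def kcycles_0
  proof (intro exI[of _ \<rho>] conjI)
    show "\<forall>(z, z')\<in>\<rho>. z \<in> kchains F j 0 \<and> z' \<in> kchains M j 0 \<and>
        (z \<in> kbounds F j 0 \<longleftrightarrow> z' \<in> kbounds M j 0)"
    proof clarify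
      fix z z' assume "(z, z') \<in> \<rho>"
      then have z: "z' = (\<lambda>S. D (z S))" "z \<in> kchains F j 0"
        unfolding \<rho>_def by blast+
      have "z' \<in> kbounds M j 0" if "z \<in> kbounds F j 0"
      proof -
        obtain e where e: "e \<in> kchains F j (0 + 1)" "z = kdiff e"
          using \<open>z \<in> kbounds F j 0\<close> unfolding kbounds_def by blast
        then have "z' = kdiff (\<lambda>S. D (e S))"
          by (simp add: z(1) kdiff_comp[OF D])
        then show ?thesis
          using kchains_comp[OF D surj e(1)] unfolding kbounds_def by blast
      qed
      moreover have "z \<in> kbounds F j 0" if "z' \<in> kbounds M j 0"
      proof -
        obtain e where e: "e \<in> kchains M j (0 + 1)" "z' = kdiff e"
          using \<open>z' \<in> kbounds M j 0\<close> unfolding kbounds_def by blast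
        obtain e' where e': "e' \<in> kchains F j (0 + 1)" "(\<lambda>S. D (e' S)) = e"
          using kchains_lift[OF D surj e(1)] .
        have "(\<lambda>S. D (z S)) = (\<lambda>S. D (kdiff e' S))"
          using e(2) z(1) unfolding e'(2)[symmetric] kdiff_comp[OF D] by simp
        then have "D (z S) = D (kdiff e' S)" for S
          by (rule fun_cong)
        then have "D ((z - kdiff e') S) = 0" for S
          unfolding minus_apply lin(5) by (simp add: zero_fun_def)
        then have "z - kdiff e' \<in> kchains N j 0"
          using kchains_diff[OF F z(2) kdiff_kchains[OF F e'(1)]] by (simp add: NC)
        then obtain n where n: "n \<in> kchains F j (0 + 1)" "z - kdiff e' = kdiff n"
          using minimal unfolding kbounds_def by blast
        then have "z = kdiff (n + e')"
          by (simp add: kdiff_add algebra_simps flip: n(2))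
        then show ?thesis
          using kchains_add[OF F n(1) e'(1)] unfolding kbounds_def by blast
      qed
      ultimately show "z \<in> kchains F j 0 \<and> z' \<in> kchains M j 0 \<and> (z \<in> kbounds F j 0 \<longleftrightarrow> z' \<in> kbounds M j 0)"
        using z kchains_comp[OF D surj z(2)] by blast
    qed
    show "kchains F j 0 \<subseteq> Domain \<rho>"
      by (auto simp: \<rho>_def)
    show "kchains M j 0 \<subseteq> Range \<rho>"
    proof
      fix z' assume "z' \<in> kchains M j 0"
      then obtain b where "b \<in> kchains F j 0" "(\<lambda>S. D (b S)) = z'"
        by (rule kchains_lift[OF D surj])
      then have "(b, z') \<in> \<rho>"
        by (auto simp: \<rho>_def)
      then show "z' \<in> Range \<rho>"
        by blast
    qed
    show "(0, 0) \<in> \<rho>"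
    proof -
      have D0: "(\<lambda>S. D ((0 :: ('v, 'k) kchain) S)) = 0"
        by (rule ext) (simp only: zero_fun_apply lin(3))
      have "(0, \<lambda>S. D ((0 :: ('v, 'k) kchain) S)) \<in> \<rho>"
        unfolding \<rho>_def using kchains_0[OF F] by blast
      then show ?thesis
        unfolding D0 .
    qed
    show "\<forall>(z, z')\<in>\<rho>. \<forall>(w, w')\<in>\<rho>. (z + w, z' + w') \<in> \<rho>"
    proof clarify
      fix z z' w w' assume "(z, z') \<in> \<rho>" "(w, w') \<in> \<rho>"
      then have "z' = (\<lambda>S. D (z S))" "w' = (\<lambda>S. D (w S))" "z \<in> kchains F j 0" "w \<in> kchains F j 0"
        unfolding \<rho>_def by blast+
      then have "z' + w' = (\<lambda>S. D ((z + w) S))" "z + w \<in> kchains F j 0"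
        by (simp_all only: plus_fun_apply lin(1) kchains_add[OF F] plus_fun_def[of "\<lambda>S. D (z S)"])
      then show "(z + w, z' + w') \<in> \<rho>"
        unfolding \<rho>_def by blast
    qed
    show "\<forall>(z, z')\<in>\<rho>. \<forall>a. (kscale a z, kscale a z') \<in> \<rho>"
    proof clarify
      fix z z' a assume "(z, z') \<in> \<rho>"
      then have "z' = (\<lambda>S. D (z S))" "z \<in> kchains F j 0"
        unfolding \<rho>_def by blast+
      then have "kscale a z' = (\<lambda>S. D (kscale a z S))" "kscale a z \<in> kchains F j 0"
        by (simp_all only: kscale_apply lin(2) kchains_scale[OF F] kscale_def[of a "\<lambda>S. D (z S)"])
      then show "(kscale a z, kscale a z') \<in> \<rho>"
        unfolding \<rho>_def by blast
    qed
  qed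
qed

end

section \<open>Multigraded pieces of Koszul chains\<close>

lemma finite_exponents:
  assumes "finite V"
  shows "finite {t. keys t \<subseteq> V \<and> mon_degree t = n}"
proof (induction n)
  case 0
  have "{t. keys t \<subseteq> V \<and> mon_degree t = 0} \<subseteq> {0}"
    by auto
  then show ?case
    by (rule finite_subset) simp
next
  case (Suc n)
  let ?T = "\<lambda>n. {t. keys t \<subseteq> V \<and> mon_degree t = n}"
  have "?T (Suc n) \<subseteq> (\<lambda>(t, x). t + single x 1) ` (?T n \<times> V)"
  proof
    fix t assume t: "t \<in> ?T (Suc n)"
    then have "t \<noteq> 0"
      using mon_degree_0 by force
    then obtain x where x: "x \<in> keys t"
      by (metis equals0I mon_degree_def mon_degree_eq_0_iff sum.empty)
    define s where "s = t - single x 1"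
    have eq: "t = s + single x 1"
      using x by (intro poly_mapping_eqI) (auto simp: s_def lookup_add lookup_minus lookup_single when_def in_keys_iff)
    have "mon_degree t = mon_degree s + 1"
      by (subst eq) (simp add: mon_degree_add)
    moreover have "keys t = insert x (keys s)"
      by (subst eq) (simp add: keys_add_nat)
    ultimately have "s \<in> ?T n" "x \<in> V"
      using t by auto
    then show "t \<in> (\<lambda>(t, x). t + single x 1) ` (?T n \<times> V)"
      using eq by (intro image_eqI[of _ _ "(s, x)"]) simp_all
  qed
  then show ?case
    by (rule finite_subset) (use Suc assms in simp)
qed

context sign_function
begin

text \<open>The Koszul differential acts on each component of a vector separately, so the
  multigraded analysis can be done for polynomial coefficients.\<close>

definition pdiff :: "('v set \<Rightarrow> ('v, 'k) mpoly) \<Rightarrow> 'v set \<Rightarrow> ('v, 'k) mpoly" where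
  "pdiff c S = (\<Sum>x\<in>V - S. kcoeff x S * c (insert x S))"

lemma kdiff_component: "kdiff c S s = pdiff (\<lambda>T. c T s) S"
  by (simp add: kdiff_def pdiff_def sum_fun_apply)

text \<open>The part of multidegree \<open>a\<close>: the coefficient of \<open>x\<^sup>a \<^sup>- \<^sup>S e\<^sub>S\<close>, as a function of \<open>S\<close>.\<close>

definition slice :: "('v \<Rightarrow>\<^sub>0 nat) \<Rightarrow> ('v set \<Rightarrow> ('v, 'k) mpoly) \<Rightarrow> 'v set \<Rightarrow> 'k" where
  "slice a c S = (if S \<subseteq> keys a then lookup (c S) (a - indicator_exp S) else 0)"

lemma add_diff_indicator:
  assumes "finite S" "S \<subseteq> keys a"
  shows "a - indicator_exp S + indicator_exp S = a"
proof (rule poly_mapping_eqI)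
  fix x
  have "x \<in> S \<Longrightarrow> lookup a x \<noteq> 0"
    using assms(2) by (auto simp: in_keys_iff)
  then show "lookup (a - indicator_exp S + indicator_exp S) x = lookup a x"
    by (auto simp: lookup_add lookup_minus lookup_indicator_exp[OF assms(1)])
qed

text \<open>With a = t + S in exponents, the variable x contributes the coefficient of exponent t -
  x in \<open>c (insert x S)\<close>, and t - x equals a minus the indicator of
  \<open>insert x S\<close>. So the Koszul differential preserves the multidegree a and is there the
  simplicial differential on \<open>keys a\<close>.\<close>

lemma lookup_pdiff:
  assumes "S \<subseteq> V" and supp: "\<And>T. \<not> T \<subseteq> V \<Longrightarrow> c T = 0"
  shows "lookup (pdiff c S) t =
    sdiff (keys (t + indicator_exp S)) (slice (t + indicator_exp S) c) S"
proof -
  let ?a = "t + indicator_exp S"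
  have fS: "finite S"
    by (rule finite_subset[OF assms(1) finite_V])
  have keys: "keys ?a = keys t \<union> S"
    by (simp add: keys_add_nat keys_indicator_exp[OF fS])
  let ?f = "\<lambda>x. sg x S * lookup (c (insert x S)) (t - single x 1)"
  have "lookup (pdiff c S) t =
    (\<Sum>x\<in>V - S. sg x S * lookup (var x * c (insert x S)) t)"
    by (simp add: pdiff_def lookup_sum kcoeff_def mult.assoc)
  \<comment> \<open>Only variables dividing the monomial contribute. The next step extends the sum
    to all of \<open>keys t - S\<close>, because \<open>c\<close> vanishes at sets not contained in
    \<open>V\<close>.\<close>
  also have "\<dots> = (\<Sum>x\<in>(V \<inter> keys t) - S. ?f x)"
    by (rule sum.mono_neutral_cong_right) (use finite_V in \<open>auto simp: lookup_var_mult in_keys_iff\<close>)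
  also have "\<dots> = (\<Sum>x\<in>keys t - S. ?f x)"
  proof (rule sum.mono_neutral_left)
    show "\<forall>x\<in>keys t - S - (V \<inter> keys t - S). ?f x = 0"
    proof
      fix x assume "x \<in> keys t - S - (V \<inter> keys t - S)"
      then have "\<not> insert x S \<subseteq> V"
        by blast
      then show "?f x = 0"
        by (simp add: supp)
    qed
  qed auto
  also have "\<dots> = (\<Sum>x\<in>keys ?a - S. sg x S * slice ?a c (insert x S))"
  proof (rule sum.cong)
    fix x assume "x \<in> keys ?a - S"
    then have x: "x \<in> keys t" "x \<notin> S"
      using keys by auto
    have "?a - indicator_exp (insert x S) = t - single x 1"
    proof (rule poly_mapping_eqI)
      fix z
      show "lookup (?a - indicator_exp (insert x S)) z =
        lookup (t - single x 1) z"
        using x fS by (auto simp: lookup_add lookup_minus lookup_indicator_exp lookup_single when_def)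
    qed
    moreover have "insert x S \<subseteq> keys ?a"
      using x keys by auto
    ultimately show "?f x = sg x S * slice ?a c (insert x S)"
      by (simp add: slice_def)
  qed (use keys in auto)
  finally show ?thesis
    by (simp add: sdiff_def)
qed

definition pchains :: "(('v \<Rightarrow>\<^sub>0 nat) \<Rightarrow> bool) \<Rightarrow> int \<Rightarrow> int \<Rightarrow> ('v set \<Rightarrow> ('v, 'k) mpoly) set" where
  "pchains Q j p = {c. \<forall>S. if S \<subseteq> V \<and> int (card S) = p
     then c S \<in> monomial_ideal V Q \<and> homogeneous (j - p) (c S) else c S = 0}"

lemma pchainsD:
  assumes "c \<in> pchains Q j p"
  shows "c S \<in> monomial_ideal V Q" "homogeneous (j - p) (c S)" "\<not> (S \<subseteq> V \<and> int (card S) = p) \<Longrightarrow> c S = 0"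
proof -
  have *: "if S \<subseteq> V \<and> int (card S) = p
     then c S \<in> monomial_ideal V Q \<and> homogeneous (j - p) (c S) else c S = 0"
    using assms unfolding pchains_def by blast
  show "c S \<in> monomial_ideal V Q" "homogeneous (j - p) (c S)" "\<not> (S \<subseteq> V \<and> int (card S) = p) \<Longrightarrow> c S = 0"
    using * by (auto split: if_splits)
qed

lemma slice_schain:
  assumes "c \<in> pchains Q j p"
  shows "slice a c \<in> schain (keys a) (\<lambda>S. Q (a - indicator_exp S)) p"
  unfolding schain_def
proof clarify
  fix S assume nz: "slice a c S \<noteq> 0"
  then have S: "S \<subseteq> keys a" "lookup (c S) (a - indicator_exp S) \<noteq> 0"
    by (auto simp: slice_def split: if_splits)
  then have "c S \<noteq> 0"
    by auto
  then have "int (card S) = p"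
    using pchainsD(3)[OF assms] by blast
  moreover have "Q (a - indicator_exp S)"
    using pchainsD(1)[OF assms, of S] S(2) by (auto simp: monomial_ideal_def in_keys_iff)
  ultimately show "S \<subseteq> keys a \<and> int (card S) = p \<and> Q (a - indicator_exp S)"
    using S(1) by blast
qed

lemma sdiff_slice_cycle:
  assumes c: "c \<in> pchains Q j p" and a: "keys a \<subseteq> V"
  shows "sdiff (keys a) (slice a c) S = slice a (pdiff c) S"
proof (cases "S \<subseteq> keys a")
  case True
  then have "S \<subseteq> V"
    using a by blast
  then have "finite S"
    using finite_V finite_subset by auto
  have "lookup (pdiff c S) (a - indicator_exp S) = sdiff (keys a) (slice a c) S"
    using lookup_pdiff[OF \<open>S \<subseteq> V\<close>, of c "a - indicator_exp S"] pchainsD(3)[OF c]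
    unfolding add_diff_indicator[OF \<open>finite S\<close> True] by blast
  then show ?thesis
    using True by (simp add: slice_def)
next
  case False
  then have "slice a c (insert x S) = 0" for x
    by (simp add: slice_def)
  then show ?thesis
    using False by (simp add: sdiff_def slice_def[of a "pdiff c" S])
qed

text \<open>A chain of degree j meets only finitely many multidegrees, so fillings of its slices can
  be summed to a chain of polynomials.\<close>

lemma pboundary_if_slices_boundary:
  assumes c: "c \<in> pchains Q j p"
    and slices: "\<And>a. keys a \<subseteq> V \<Longrightarrow> int (mon_degree a) = j \<Longrightarrow>
      \<exists>g\<in>schain (keys a) (\<lambda>S. Q (a - indicator_exp S)) (p + 1).
        \<forall>S. sdiff (keys a) g S = slice a c S"
  obtains e where "e \<in> pchains Q j (p + 1)" "pdiff e = c"
proof -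
  define A where "A = {a. keys a \<subseteq> V \<and> int (mon_degree a) = j}"
  have "A \<subseteq> {a. keys a \<subseteq> V \<and> mon_degree a = nat j}"
    unfolding A_def by auto
  then have finA: "finite A"
    by (rule finite_subset[OF _ finite_exponents[OF finite_V]])
  have "\<exists>g. a \<in> A \<longrightarrow> g \<in> schain (keys a) (\<lambda>S. Q (a - indicator_exp S)) (p + 1) \<and>
        (\<forall>S. sdiff (keys a) g S = slice a c S)" for a
    using slices[of a] unfolding A_def by blast
  then obtain g where g: "\<And>a. a \<in> A \<Longrightarrow> g a \<in> schain (keys a) (\<lambda>S. Q (a - indicator_exp S)) (p + 1)"
    and gd: "\<And>a S. a \<in> A \<Longrightarrow> sdiff (keys a) (g a) S = slice a c S"
    by metis
  \<comment> \<open>Inverse to taking slices: the filling in multidegree a is put back at the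
    monomial with exponent a - S.\<close>
  define e where "e S = (\<Sum>a\<in>A. if S \<subseteq> keys a
    then single (a - indicator_exp S) (g a S) else 0)" for S
  have le: "lookup (e S) t = (if t + indicator_exp S \<in> A then g (t + indicator_exp S) S else 0)"
    if "S \<subseteq> V" for S t
  proof -
    have fS: "finite S"
      by (rule finite_subset[OF that finite_V])
    have "lookup (e S) t = (\<Sum>a\<in>A. if a = t + indicator_exp S then g a S else 0)"
      unfolding e_def lookup_sum
    proof (rule sum.cong)
      fix a
      have "S \<subseteq> keys a \<and> a - indicator_exp S = t \<longleftrightarrow> a = t + indicator_exp S"
        using add_diff_indicator[OF fS, of a] by (auto simp: keys_add_nat keys_indicator_exp[OF fS])
      then show "lookup (if S \<subseteq> keys a
          then single (a - indicator_exp S) (g a S) else 0) t =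
        (if a = t + indicator_exp S then g a S else 0)"
        by (auto simp: lookup_single when_def)
    qed simp
    then show ?thesis
      using finA by simp
  qed
  have e: "e \<in> pchains Q j (p + 1)"
    unfolding pchains_def
  proof (clarify)
    fix S
    show "if S \<subseteq> V \<and> int (card S) = p + 1
      then e S \<in> monomial_ideal V Q \<and> homogeneous (j - (p + 1)) (e S) else e S = 0"
    proof (cases "S \<subseteq> V")
      case True
      have fS: "finite S"
        by (rule finite_subset[OF True finite_V])
      have t: "keys t \<subseteq> V \<and> int (mon_degree t) = j - (p + 1) \<and> Q t \<and> int (card S) = p + 1"
        if nz: "lookup (e S) t \<noteq> 0" for t
      proof -
        have a: "t + indicator_exp S \<in> A" "g (t + indicator_exp S) S \<noteq> 0"
          using nz le[OF True] by (auto split: if_splits)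
        then have "int (card S) = p + 1" "Q (t + indicator_exp S - indicator_exp S)"
          using schain_D[OF g[OF a(1)], of S] by blast+
        moreover have "keys t \<subseteq> V" "int (mon_degree t) + int (card S) = j"
          using a(1) by (auto simp: A_def keys_add_nat mon_degree_add mon_degree_indicator_exp[OF fS])
        ultimately show ?thesis
          by simp
      qed
      show ?thesis
      proof (cases "int (card S) = p + 1")
        case c: True
        then show ?thesis
          using t True by (auto simp: monomial_ideal_def poly_ring_def homogeneous_def in_keys_iff)
      next
        case False
        then have "e S = 0"
          using t by (intro poly_mapping_eqI) auto
        then show ?thesis
          using False by simp
      qed
    next
      case False
      then have "e S = 0"
        unfolding e_def by (intro sum.neutral) (auto simp: A_def)
      then show ?thesis
        using False by simp
    qed
  qed
  have e0: "\<not> T \<subseteq> V \<Longrightarrow> e T = 0" for T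
    using pchainsD(3)[OF e] by blast
  have "pdiff e = c"
  proof
    fix S
    show "pdiff e S = c S"
    proof (cases "S \<subseteq> V")
      case True
      have fS: "finite S"
        by (rule finite_subset[OF True finite_V])
      show ?thesis
      proof (rule poly_mapping_eqI)
        fix t
        let ?a = "t + indicator_exp S"
        have "S \<subseteq> keys ?a"
          by (simp add: keys_add_nat keys_indicator_exp[OF fS])
        have 1: "lookup (pdiff e S) t = sdiff (keys ?a) (slice ?a e) S"
          by (rule lookup_pdiff[OF True e0])
        show "lookup (pdiff e S) t = lookup (c S) t"
        proof (cases "?a \<in> A")
          case a: True
          have "slice ?a e = g ?a"
          proof
            fix T
            show "slice ?a e T = g ?a T"
            proof (cases "T \<subseteq> keys ?a")
              case T: True
              then have TV: "T \<subseteq> V"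
                using a by (auto simp: A_def)
              then have "finite T"
                using finite_V finite_subset by auto
              have "slice ?a e T = lookup (e T) (?a - indicator_exp T)"
                using T by (simp add: slice_def)
              also have "\<dots> = g ?a T"
                unfolding le[OF TV] add_diff_indicator[OF \<open>finite T\<close> T] using a by simp
              finally show ?thesis .
            next
              case False
              then show ?thesis
                using schain_D(1)[OF g[OF a]] by (simp add: slice_def)
            qed
          qed
          then have "lookup (pdiff e S) t = slice ?a c S"
            using 1 gd[OF a] by simp
          then show ?thesis
            using \<open>S \<subseteq> keys ?a\<close> by (simp add: slice_def)
        next
          case False
          \<comment> \<open>A multidegree outside \<open>A\<close> has the wrong degree or involves
            a variable outside \<open>V\<close>, so it occurs neither in \<open>e\<close> nor in
            \<open>c\<close>.\<close>
          have "slice ?a e T = 0" if "x \<in> keys ?a - S" "T = insert x S" for T x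
          proof (cases "T \<subseteq> keys ?a \<and> T \<subseteq> V")
            case T: True
            then have "finite T"
              using finite_V finite_subset by auto
            then show ?thesis
              using T False le[of T "?a - indicator_exp T"] add_diff_indicator[of T ?a] by (simp add: slice_def)
          next
            case False
            then show ?thesis
              using e0[of T] by (auto simp: slice_def)
          qed
          then have "lookup (pdiff e S) t = 0"
            unfolding 1 sdiff_def by (intro sum.neutral) auto
          moreover have "lookup (c S) t = 0"
          proof (rule ccontr)
            assume nz: "lookup (c S) t \<noteq> 0"
            then have "c S \<noteq> 0"
              by auto
            then have "int (card S) = p"
              using pchainsD(3)[OF c] by blast
            moreover have "int (mon_degree t) = j - p" "keys t \<subseteq> V"
              using pchainsD(1,2)[OF c, of S] nz
              by (auto simp: monomial_ideal_def poly_ring_def homogeneous_def in_keys_iff)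
            ultimately have "?a \<in> A"
              using True by (simp add: A_def keys_add_nat keys_indicator_exp[OF fS] mon_degree_add
                  mon_degree_indicator_exp[OF fS])
            then show False
              using False by simp
          qed
          ultimately show ?thesis
            by simp
        qed
      qed
    next
      case False
      then have "e (insert x S) = 0" for x
        by (intro e0) auto
      then show ?thesis
        using False pchainsD(3)[OF c] by (simp add: pdiff_def)
    qed
  qed
  then show ?thesis
    using e that by blast
qed

text \<open>A simplicial cycle without filling is placed in the single multidegree a. The slice at a
  of any Koszul filling would fill the simplicial cycle.\<close>

lemma pcycle_not_boundary:
  assumes a: "keys a \<subseteq> V" "int (mon_degree a) = j"
    and nac: "\<not> acyclic_at (keys a) (\<lambda>S. Q (a - indicator_exp S)) p"
  obtains c where "c \<in> pchains Q j p" "pdiff c = (\<lambda>_. 0)" "\<And>e. e \<in> pchains Q j (p + 1) \<Longrightarrow> pdiff e \<noteq> c"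
proof -
  obtain f where f: "f \<in> schain (keys a) (\<lambda>S. Q (a - indicator_exp S)) p"
    "\<And>S. sdiff (keys a) f S = 0"
    and nb: "\<And>g. g \<in> schain (keys a) (\<lambda>S. Q (a - indicator_exp S)) (p + 1) \<Longrightarrow>
      \<not> (\<forall>S. sdiff (keys a) g S = f S)"
    using nac unfolding acyclic_at_def by blast
  define c where "c S = (if S \<subseteq> keys a
    then single (a - indicator_exp S) (f S) else 0)" for S
  have c: "c \<in> pchains Q j p"
    unfolding pchains_def
  proof clarify
    fix S
    show "if S \<subseteq> V \<and> int (card S) = p
      then c S \<in> monomial_ideal V Q \<and> homogeneous (j - p) (c S) else c S = 0"
    proof (cases "S \<subseteq> keys a \<and> f S \<noteq> 0")
      case True
      then have S: "int (card S) = p" "Q (a - indicator_exp S)" "S \<subseteq> V"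
        using schain_D[OF f(1)] a(1) by blast+
      then have fS: "finite S"
        using finite_V finite_subset by auto
      have eq: "a - indicator_exp S + indicator_exp S = a"
        using add_diff_indicator[OF fS] True by blast
      have "mon_degree (a - indicator_exp S) + card S = mon_degree a"
        using arg_cong[OF eq, of mon_degree] by (simp add: mon_degree_add mon_degree_indicator_exp[OF fS])
      moreover have "keys (a - indicator_exp S) \<subseteq> V"
        using a(1) arg_cong[OF eq, of keys] unfolding keys_add_nat by blast
      ultimately show ?thesis
        using S True a(2) by (auto simp: c_def monomial_ideal_def poly_ring_def homogeneous_def)
    next
      case False
      then have "c S = 0"
        by (auto simp: c_def)
      then show ?thesis
        by simp
    qed
  qed
  have c0: "\<not> T \<subseteq> V \<Longrightarrow> c T = 0" for T
    using pchainsD(3)[OF c] by blast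
  have slice_a: "slice a c = f"
    using schain_D(1)[OF f(1)] by (auto simp: slice_def c_def fun_eq_iff)
  have slice_b: "slice b c S = 0" if "b \<noteq> a" for b S
  proof (cases "S \<subseteq> keys b \<and> S \<subseteq> keys a")
    case True
    then have fS: "finite S"
      using finite_subset[of S "keys a"] by simp
    have "b - indicator_exp S \<noteq> a - indicator_exp S"
      using add_diff_indicator[OF fS] True that by metis
    then show ?thesis
      using True by (simp add: slice_def c_def lookup_single when_def)
  qed (auto simp: slice_def c_def)
  have "pdiff c S = 0" for S
  proof (cases "S \<subseteq> V")
    case True
    show ?thesis
    proof (rule poly_mapping_eqI)
      fix t
      let ?b = "t + indicator_exp S"
      have "sdiff (keys ?b) (slice ?b c) S = 0"
      proof (cases "?b = a")
        case True
        then show ?thesis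
          using f(2) by (simp add: slice_a)
      next
        case False
        then show ?thesis
          by (simp add: sdiff_def slice_b)
      qed
      then show "lookup (pdiff c S) t = lookup 0 t"
        using lookup_pdiff[where c = c and t = t, OF \<open>S \<subseteq> V\<close> c0] by simp
    qed
  next
    case False
    then have "c (insert x S) = 0" for x
      by (intro c0) auto
    then show ?thesis
      by (simp add: pdiff_def)
  qed
  moreover have "pdiff e \<noteq> c" if e: "e \<in> pchains Q j (p + 1)" for e
  proof
    assume eq: "pdiff e = c"
    have "\<forall>S. sdiff (keys a) (slice a e) S = f S"
      using sdiff_slice_cycle[OF e a(1)] unfolding eq slice_a by blast
    then show False
      using nb slice_schain[OF e] by blast
  qed
  ultimately show ?thesis
    using c that[of c] by blast
qed

section \<open>Direct sums of shifted monomial ideals\<close>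

text \<open>The degree j piece of a direct sum of r copies of a monomial ideal, with generators in
  degrees \<open>sh s\<close>. It covers the two modules analysed multidegree by multidegree: free
  modules, with \<open>Q\<close> constantly true, and the ideal itself, with r = 1 and no
  shift.\<close>

definition mono_module :: "nat \<Rightarrow> (nat \<Rightarrow> int) \<Rightarrow> (('v \<Rightarrow>\<^sub>0 nat) \<Rightarrow> bool) \<Rightarrow> int \<Rightarrow> (nat \<Rightarrow> ('v, 'k) mpoly) set" where
  "mono_module r sh Q j = {v. (\<forall>s<r. v s \<in> monomial_ideal V Q) \<and> (\<forall>s\<ge>r. v s = 0) \<and>
     (\<forall>s. homogeneous (j - sh s) (v s))}"

lemma mono_moduleD:
  assumes "v \<in> mono_module r sh Q j"
  shows "v s \<in> monomial_ideal V Q" "homogeneous (j - sh s) (v s)" "r \<le> s \<Longrightarrow> v s = 0"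
  using assms by (cases "s < r"; auto simp: mono_module_def)+

lemma component_pchains:
  assumes "c \<in> kchains (mono_module r sh Q) j p"
  shows "(\<lambda>S. c S s) \<in> pchains Q (j - sh s) p"
  unfolding pchains_def
proof clarify
  fix S
  show "if S \<subseteq> V \<and> int (card S) = p
    then c S s \<in> monomial_ideal V Q \<and> homogeneous (j - sh s - p) (c S s) else c S s = 0"
  proof (cases "S \<subseteq> V \<and> int (card S) = p")
    case True
    then have "c S \<in> mono_module r sh Q (j - p)"
      using kchainsD(1)[OF assms] by blast
    from mono_moduleD(1,2)[OF this, of s] show ?thesis
      using True by (simp add: algebra_simps)
  next
    case False
    then show ?thesis
      using kchainsD(4)[OF assms False] by simp
  qed
qed

lemma kchains_mono_moduleI:
  assumes "\<And>s. s < r \<Longrightarrow> (\<lambda>S. c S s) \<in> pchains Q (j - sh s) p" "\<And>S s. r \<le> s \<Longrightarrow> c S s = 0"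
  shows "c \<in> kchains (mono_module r sh Q) j p"
proof (rule kchainsI)
  fix S
  have "c S s \<in> monomial_ideal V Q \<and> homogeneous (j - p - sh s) (c S s)" if "s < r" for s
    using pchainsD(1,2)[OF assms(1)[OF that], of S] by (simp add: algebra_simps)
  moreover have "homogeneous (j - p - sh s) (c S s)" if "\<not> s < r" for s
    using assms(2)[of s S] that by simp
  ultimately show "c S \<in> mono_module r sh Q (j - p)"
    unfolding mono_module_def using assms(2) by blast
next
  fix S assume S: "\<not> (S \<subseteq> V \<and> int (card S) = p)"
  show "c S = 0"
  proof
    fix s
    show "c S s = 0 s"
      using assms(2)[of s S] pchainsD(3)[OF assms(1) S, of s] by (cases "s < r") simp_all
  qed
qed

lemma mono_module_boundaryI:
  assumes c: "c \<in> kchains (mono_module r sh Q) j p"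
    and slices: "\<And>s a. s < r \<Longrightarrow> keys a \<subseteq> V \<Longrightarrow> int (mon_degree a) = j - sh s \<Longrightarrow>
      \<exists>g\<in>schain (keys a) (\<lambda>S. Q (a - indicator_exp S)) (p + 1).
        \<forall>S. sdiff (keys a) g S = slice a (\<lambda>S. c S s) S"
  shows "c \<in> kbounds (mono_module r sh Q) j p"
proof -
  have "\<exists>e. s < r \<longrightarrow> e \<in> pchains Q (j - sh s) (p + 1) \<and> pdiff e = (\<lambda>S. c S s)" for s
    using pboundary_if_slices_boundary[OF component_pchains[OF c] slices] by metis
  then obtain e where e: "\<And>s. s < r \<Longrightarrow> e s \<in> pchains Q (j - sh s) (p + 1)" "\<And>s. s < r \<Longrightarrow> pdiff (e s) = (\<lambda>S. c S s)"
    by metis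
  define d where "d S s = (if s < r then e s S else 0)" for S s
  have d: "d \<in> kchains (mono_module r sh Q) j (p + 1)"
    by (rule kchains_mono_moduleI) (use e(1) in \<open>simp_all add: d_def\<close>)
  have "kdiff d = c"
  proof (rule ext, rule ext)
    fix S s
    show "kdiff d S s = c S s"
    proof (cases "s < r")
      case True
      then show ?thesis
        using fun_cong[OF e(2)[OF True], of S] by (simp add: kdiff_component d_def)
    next
      case False
      have "c S s = 0"
      proof (cases "S \<subseteq> V \<and> int (card S) = p")
        case True
        then show ?thesis
          using kchainsD(1)[OF c] False mono_moduleD(3)[of "c S" r sh Q _ s] by auto
      qed (simp add: kchainsD(4)[OF c])
      then show ?thesis
        using False by (simp add: kdiff_component d_def pdiff_def)
    qed
  qed
  then show ?thesis
    using d unfolding kbounds_def by blast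
qed

lemma mono_module_exact:
  assumes "\<And>s a. s < r \<Longrightarrow> keys a \<subseteq> V \<Longrightarrow> int (mon_degree a) = j - sh s \<Longrightarrow>
      acyclic_at (keys a) (\<lambda>S. Q (a - indicator_exp S)) p"
  shows "kcycles (mono_module r sh Q) j p \<subseteq> kbounds (mono_module r sh Q) j p"
proof
  fix c assume "c \<in> kcycles (mono_module r sh Q) j p"
  then have c: "c \<in> kchains (mono_module r sh Q) j p" "kdiff c = 0"
    by (auto simp: kcycles_def)
  show "c \<in> kbounds (mono_module r sh Q) j p"
  proof (rule mono_module_boundaryI[OF c(1)])
    fix s a assume a: "s < r" "keys a \<subseteq> V" "int (mon_degree a) = j - sh s"
    note p = component_pchains[OF c(1), of s]
    have "pdiff (\<lambda>S. c S s) = (\<lambda>_. 0)"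
      unfolding kdiff_component[symmetric] by (simp add: c(2))
    then have "sdiff (keys a) (slice a (\<lambda>S. c S s)) S = 0" for S
      using sdiff_slice_cycle[OF p a(2)] by (simp add: slice_def)
    then show "\<exists>g\<in>schain (keys a) (\<lambda>S. Q (a - indicator_exp S)) (p + 1).
        \<forall>S. sdiff (keys a) g S = slice a (\<lambda>S. c S s) S"
      using assms[OF a] slice_schain[OF p] unfolding acyclic_at_def by blast
  qed
qed

lemma mono_module_not_exact:
  assumes "0 < r" "keys a \<subseteq> V" "int (mon_degree a) = j - sh 0"
    and nac: "\<not> acyclic_at (keys a) (\<lambda>S. Q (a - indicator_exp S)) p"
  shows "\<not> kcycles (mono_module r sh Q) j p \<subseteq> kbounds (mono_module r sh Q) j p"
proof
  assume sub: "kcycles (mono_module r sh Q) j p \<subseteq> kbounds (mono_module r sh Q) j p"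
  obtain c where c: "c \<in> pchains Q (j - sh 0) p" "pdiff c = (\<lambda>_. 0)"
    "\<And>e. e \<in> pchains Q (j - sh 0) (p + 1) \<Longrightarrow> pdiff e \<noteq> c"
    using pcycle_not_boundary[OF assms(2,3) nac] by blast
  define d where "d S s = (if s = 0 then c S else 0)" for S and s :: nat
  have zero: "(\<lambda>_. 0) \<in> pchains Q i p" for i
    by (simp add: pchains_def)
  have "d \<in> kchains (mono_module r sh Q) j p"
  proof (rule kchains_mono_moduleI)
    show "(\<lambda>S. d S s) \<in> pchains Q (j - sh s) p" for s
      using c(1) zero by (cases "s = 0") (simp_all add: d_def)
  qed (use assms(1) in \<open>simp add: d_def\<close>)
  moreover have "kdiff d = 0"
  proof (rule ext, rule ext)
    fix S s
    show "kdiff d S s = 0 S s"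
      using fun_cong[OF c(2), of S] by (cases "s = 0") (simp_all add: kdiff_component d_def, simp add: pdiff_def)
  qed
  ultimately have "d \<in> kbounds (mono_module r sh Q) j p"
    using sub by (auto simp: kcycles_def)
  then obtain e where e: "e \<in> kchains (mono_module r sh Q) j (p + 1)" "d = kdiff e"
    by (auto simp: kbounds_def)
  have "pdiff (\<lambda>S. e S 0) S = c S" for S
    using fun_cong[OF fun_cong[OF e(2), of S], of 0] by (simp add: kdiff_component d_def)
  then show False
    using c(3)[OF component_pchains[OF e(1)]] by blast
qed

lemma graded_module_mono_module:
  assumes "\<And>s t. Q t \<Longrightarrow> Q (s + t)"
  shows "graded_module (mono_module r sh Q)"
  unfolding graded_module_def
proof (intro allI conjI ballI impI)
  show "0 \<in> mono_module r sh Q j" for j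
    by (simp add: mono_module_def)
  show "u + v \<in> mono_module r sh Q j" if "u \<in> mono_module r sh Q j" "v \<in> mono_module r sh Q j" for u v j
    using that by (simp add: mono_module_def monomial_ideal_add homogeneous_add)
  show "smul q v \<in> mono_module r sh Q (j + d)"
    if v: "v \<in> mono_module r sh Q j" and q: "q \<in> poly_ring V" "homogeneous d q" for q d v j
  proof -
    have "homogeneous (j + d - sh s) (q * v s)" for s
      using homogeneous_mult[OF q(2) mono_moduleD(2)[OF v, of s]] by (simp add: algebra_simps)
    moreover have "q * v s \<in> monomial_ideal V Q" for s
      by (rule monomial_ideal_mult[OF q(1) mono_moduleD(1)[OF v] assms])
    ultimately show ?thesis
      using mono_moduleD(3)[OF v] by (simp add: mono_module_def)
  qed
qed

text \<open>Monomials of the prescribed degree, placed at one set and one component, span; as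
  \<open>V\<close> is finite there are finitely many of them.\<close>

lemma kchains_mono_module_finite_dim:
  obtains W where "finite W" "kchains (mono_module r sh Q) j p \<subseteq> kspace.span W"
proof -
  define T where "T s = {t. keys t \<subseteq> V \<and> mon_degree t = nat (j - p - sh s)}" for s
  define w where "w S s t = (\<lambda>S' s'. if S' = S \<and> s' = s then single t 1 else 0 :: ('v, 'k) mpoly)"
    for S :: "'v set" and s :: nat and t
  define W where "W = (\<Union>S\<in>Pow V. \<Union>s\<in>{..<r}. w S s ` T s)"
  have finT: "finite (T s)" for s
    unfolding T_def by (rule finite_exponents[OF finite_V])
  then have "finite W"
    unfolding W_def using finite_V by auto
  moreover have "c \<in> kspace.span W" if c: "c \<in> kchains (mono_module r sh Q) j p" for c
  proof -
    have "c = (\<Sum>S\<in>Pow V. \<Sum>s<r. \<Sum>t\<in>T s. kscale (lookup (c S s) t) (w S s t))"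
      (is "c = ?R")
    proof (rule ext, rule ext)
      fix S' s'
      have "?R S' s' = (\<Sum>S\<in>Pow V. \<Sum>s<r. if S = S' \<and> s = s' then (\<Sum>t\<in>T s. single t (lookup (c S s) t)) else 0)"
        unfolding sum_fun_apply
      proof (intro sum.cong refl)
        fix S s
        show "(\<Sum>t\<in>T s. kscale (lookup (c S s) t) (w S s t) S' s') =
          (if S = S' \<and> s = s' then (\<Sum>t\<in>T s. single t (lookup (c S s) t)) else 0)"
          by (cases "S = S'"; cases "s = s'") (simp_all add: kscale_apply w_def mult_single)
      qed
      also have "\<dots> = (\<Sum>S\<in>Pow V. if S = S' then (if s' < r then (\<Sum>t\<in>T s'. single t (lookup (c S s') t)) else 0) else 0)"
        by (intro sum.cong refl) auto
      also have "\<dots> = (if S' \<subseteq> V \<and> s' < r then (\<Sum>t\<in>T s'. single t (lookup (c S' s') t)) else 0)"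
        using finite_V by auto
      also have "\<dots> = c S' s'"
      proof (cases "S' \<subseteq> V \<and> int (card S') = p")
        case True
        then have m: "c S' \<in> mono_module r sh Q (j - p)"
          using kchainsD(1)[OF c] by blast
        show ?thesis
        proof (cases "s' < r")
          case s: True
          have "(\<Sum>t\<in>T s'. single t (lookup (c S' s') t)) =
            (\<Sum>t\<in>keys (c S' s'). single t (lookup (c S' s') t))"
          proof (rule sum.mono_neutral_right[OF finT])
            show "keys (c S' s') \<subseteq> T s'"
            proof
              fix t assume t: "t \<in> keys (c S' s')"
              have "int (mon_degree t) = j - p - sh s'"
                using mono_moduleD(2)[OF m, of s'] t by (auto simp: homogeneous_def)
              then have "mon_degree t = nat (j - p - sh s')"
                by linarith
              moreover have "keys t \<subseteq> V"
                using mono_moduleD(1)[OF m, of s'] t by (auto simp: monomial_ideal_def poly_ring_def)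
              ultimately show "t \<in> T s'"
                by (simp add: T_def)
            qed
          qed (auto simp: in_keys_iff)
          then show ?thesis
            using s True by (simp add: sum_monomials)
        next
          case False
          then show ?thesis
            using mono_moduleD(3)[OF m, of s'] by simp
        qed
      next
        case False
        then show ?thesis
          using kchainsD(4)[OF c False] by simp
      qed
      finally show "c S' s' = ?R S' s'"
        by simp
    qed
    moreover have "?R \<in> kspace.span W"
      by (intro kspace.span_sum kspace.span_scale kspace.span_base) (auto simp: W_def)
    ultimately show ?thesis
      by simp
  qed
  ultimately show ?thesis
    using that[of W] by blast
qed

end

section \<open>Minimal covers of graded modules\<close>

lemma ideal_gen_varsI:
  assumes "p \<in> poly_ring V" "lookup p 0 = 0"
  shows "p \<in> ideal_gen V (var ` V)"
proof -
  have "single t (lookup p t) \<in> ideal_gen V (var ` V)"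
    if t: "t \<in> keys p" for t
  proof -
    have tV: "keys t \<subseteq> V"
      using assms(1) t by (auto simp: poly_ring_def)
    have "t \<noteq> 0"
      using t assms(2) by (auto simp: in_keys_iff)
    then obtain x where x: "x \<in> keys t"
      by (metis equals0I mon_degree_def mon_degree_eq_0_iff sum.empty)
    define s where "s = t - single x 1"
    have eq: "t = s + single x 1"
      using x by (intro poly_mapping_eqI) (auto simp: s_def lookup_add lookup_minus lookup_single when_def in_keys_iff)
    have "keys s \<subseteq> keys t"
      by (subst eq) (auto simp: keys_add_nat)
    then have "single s (lookup p t) \<in> poly_ring V"
      using tV by (auto simp: poly_ring_def)
    moreover have "var x \<in> var ` V"
      using x tV by blast
    ultimately have "single s (lookup p t) * var x \<in> ideal_gen V (var ` V)"
      by (intro ideal_gen_mult)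
    moreover have "single s (lookup p t) * var x = single t (lookup p t)"
      unfolding var_def mult_single eq[symmetric] by simp
    ultimately show ?thesis
      by simp
  qed
  then have "(\<Sum>t\<in>keys p. single t (lookup p t)) \<in> ideal_gen V (var ` V)"
    by (rule ideal_gen_sum)
  then show ?thesis
    by (simp add: sum_monomials)
qed

definition grade :: "(nat \<Rightarrow> int) \<Rightarrow> (nat \<Rightarrow> ('v, 'k::field) mpoly) set \<Rightarrow> int \<Rightarrow> (nat \<Rightarrow> ('v, 'k) mpoly) set" where
  "grade sh M j = {v \<in> M. \<forall>s. homogeneous (j - sh s) (v s)}"

definition hpart :: "(nat \<Rightarrow> int) \<Rightarrow> int \<Rightarrow> (nat \<Rightarrow> ('v, 'k::field) mpoly) \<Rightarrow> nat \<Rightarrow> ('v, 'k) mpoly" where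
  "hpart sh j v = (\<lambda>s. hom_part (j - sh s) (v s))"

text \<open>The map from a free module determined by generators; \<open>g\<close> is its matrix
  listed by columns.\<close>

definition combine :: "(nat \<Rightarrow> nat \<Rightarrow> ('v, 'k::field) mpoly) \<Rightarrow> nat \<Rightarrow> (nat \<Rightarrow> ('v, 'k) mpoly) \<Rightarrow> nat \<Rightarrow> ('v, 'k) mpoly" where
  "combine g r v = (\<Sum>t<r. smul (v t) (g t))"

definition unit_vec :: "nat \<Rightarrow> nat \<Rightarrow> ('v, 'k::field) mpoly" where
  "unit_vec t = (\<lambda>s. if s = t then 1 else 0)"

lemma combine_apply: "combine g r v s = (\<Sum>t<r. v t * g t s)"
  by (simp add: combine_def sum_fun_apply)

lemma mod_linear_combine: "mod_linear (combine g r)"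
  unfolding mod_linear_def
  by (auto simp: fun_eq_iff combine_apply distrib_right sum.distrib sum_distrib_left mult.assoc)

lemma combine_unit_vec: "t < r \<Longrightarrow> combine g r (unit_vec t) = g t"
  by (rule ext) (simp add: combine_apply unit_vec_def if_distrib[of "\<lambda>q. q * _"] cong: if_cong)

lemma homogeneous_iff_hpart: "(\<forall>s. homogeneous (j - sh s) (v s)) \<longleftrightarrow> hpart sh j v = v"
proof
  assume "\<forall>s. homogeneous (j - sh s) (v s)"
  then have "hom_part (j - sh s) (v s) = v s" for s
    using hom_part_homogeneous[of "j - sh s" "v s" "j - sh s"] by simp
  then show "hpart sh j v = v"
    unfolding hpart_def by (intro ext)
next
  assume eq: "hpart sh j v = v"
  have "homogeneous (j - sh s) (hpart sh j v s)" for s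
    by (simp add: hpart_def homogeneous_hom_part)
  then show "\<forall>s. homogeneous (j - sh s) (v s)"
    unfolding eq by blast
qed

lemma gradeD: "v \<in> grade sh M j \<Longrightarrow> v \<in> M" "v \<in> grade sh M j \<Longrightarrow> homogeneous (j - sh s) (v s)"
  by (auto simp: grade_def)

text \<open>Homogeneous columns make the map preserve degrees, so it commutes with taking
  homogeneous parts.\<close>

lemma combine_hpart:
  assumes "\<And>t. t < r' \<Longrightarrow> g t \<in> grade sh M (sh' t)"
  shows "combine g r' (hpart sh' j v) = hpart sh j (combine g r' v)"
proof
  fix s
  have "hom_part (j - sh' t) (v t) * g t s = hom_part (j - sh s) (v t * g t s)" if "t < r'" for t
    using hom_part_mult[OF gradeD(2)[OF assms[OF that]], of "j - sh s" "v t" s] by simp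
  then show "combine g r' (hpart sh' j v) s = hpart sh j (combine g r' v) s"
    by (simp add: combine_apply hpart_def hom_part_sum)
qed

context sign_function
begin

definition free_module :: "nat \<Rightarrow> (nat \<Rightarrow> ('v, 'k) mpoly) set" where
  "free_module r = {v. (\<forall>s<r. v s \<in> poly_ring V) \<and> (\<forall>s\<ge>r. v s = 0)}"

lemma free_moduleD: "v \<in> free_module r \<Longrightarrow> v s \<in> poly_ring V" "v \<in> free_module r \<Longrightarrow> r \<le> s \<Longrightarrow> v s = 0"
  by (cases "s < r"; auto simp: free_module_def)+

lemma free_module_add: "u \<in> free_module r \<Longrightarrow> v \<in> free_module r \<Longrightarrow> u + v \<in> free_module r"
  by (simp add: free_module_def poly_ring_add)

lemma free_module_smul: "q \<in> poly_ring V \<Longrightarrow> v \<in> free_module r \<Longrightarrow> smul q v \<in> free_module r"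
  by (simp add: free_module_def poly_ring_mult)

lemma free_module_0: "0 \<in> free_module r"
  by (simp add: free_module_def)

lemma free_module_hpart: "v \<in> free_module r \<Longrightarrow> hpart sh j v \<in> free_module r"
  by (simp add: free_module_def hpart_def poly_ring_hom_part)

lemma unit_vec_free_module: "t < r \<Longrightarrow> unit_vec t \<in> free_module r"
  by (simp add: free_module_def unit_vec_def)

lemma grade_free_module: "grade sh (free_module r) = mono_module r sh (\<lambda>_. True)"
  by (auto simp: grade_def free_module_def mono_module_def poly_ring_eq_monomial_ideal fun_eq_iff)

text \<open>Gradedness is expressed by closure under homogeneous parts, relative to a free module
  whose basis has degrees \<open>sh\<close>.\<close>

definition graded_submodule :: "nat \<Rightarrow> (nat \<Rightarrow> int) \<Rightarrow> (nat \<Rightarrow> ('v, 'k) mpoly) set \<Rightarrow> bool" where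
  "graded_submodule r sh M \<longleftrightarrow> M \<subseteq> free_module r \<and> 0 \<in> M \<and> (\<forall>u\<in>M. \<forall>v\<in>M. u + v \<in> M) \<and>
     (\<forall>q\<in>poly_ring V. \<forall>v\<in>M. smul q v \<in> M) \<and> (\<forall>v\<in>M. \<forall>j. hpart sh j v \<in> M)"

lemma graded_submoduleD:
  assumes "graded_submodule r sh M"
  shows "M \<subseteq> free_module r" "0 \<in> M" "u \<in> M \<Longrightarrow> v \<in> M \<Longrightarrow> u + v \<in> M"
    "q \<in> poly_ring V \<Longrightarrow> v \<in> M \<Longrightarrow> smul q v \<in> M" "v \<in> M \<Longrightarrow> hpart sh j v \<in> M"
  using assms unfolding graded_submodule_def by simp_all

lemma graded_submodule_sum: "graded_submodule r sh M \<Longrightarrow> (\<And>a. a \<in> A \<Longrightarrow> f a \<in> M) \<Longrightarrow> sum f A \<in> M"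
  by (induction A rule: infinite_finite_induct) (auto intro: graded_submoduleD(2,3))

lemma graded_module_grade:
  assumes "graded_submodule r sh M"
  shows "graded_module (grade sh M)"
  unfolding graded_module_def
proof (intro allI conjI ballI impI)
  show "0 \<in> grade sh M j" for j
    using graded_submoduleD(2)[OF assms] by (simp add: grade_def)
  show "u + v \<in> grade sh M j" if "u \<in> grade sh M j" "v \<in> grade sh M j" for u v j
    using that graded_submoduleD(3)[OF assms] by (simp add: grade_def homogeneous_add)
  show "smul q v \<in> grade sh M (j + d)"
    if "v \<in> grade sh M j" "q \<in> poly_ring V" "homogeneous d q" for q d v j
  proof -
    have "homogeneous (j + d - sh s) (q * v s)" for s
      using homogeneous_mult[OF that(3) gradeD(2)[OF that(1), of s]] by (simp add: algebra_simps)
    then show ?thesis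
      using graded_submoduleD(4)[OF assms that(2) gradeD(1)[OF that(1)]] by (simp add: grade_def)
  qed
qed

lemma graded_submodule_free_module: "graded_submodule r sh (free_module r)"
  unfolding graded_submodule_def
  by (simp add: free_module_0 free_module_add free_module_smul free_module_hpart)

definition kernel :: "(nat \<Rightarrow> nat \<Rightarrow> ('v, 'k) mpoly) \<Rightarrow> nat \<Rightarrow> (nat \<Rightarrow> ('v, 'k) mpoly) set" where
  "kernel g r = {v \<in> free_module r. combine g r v = 0}"

text \<open>The last clause places the kernel inside the multiples of the variables: no generator
  can be dispensed with.\<close>

definition minimal_cover ::
  "(nat \<Rightarrow> int) \<Rightarrow> (nat \<Rightarrow> ('v, 'k) mpoly) set \<Rightarrow> nat \<Rightarrow> (nat \<Rightarrow> int) \<Rightarrow> (nat \<Rightarrow> nat \<Rightarrow> ('v, 'k) mpoly) \<Rightarrow> bool" where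
  "minimal_cover sh M r' sh' g \<longleftrightarrow> (\<forall>t<r'. g t \<in> grade sh M (sh' t)) \<and>
     combine g r' ` free_module r' = M \<and> (\<forall>v\<in>kernel g r'. \<forall>t. lookup (v t) 0 = 0)"

lemma graded_submodule_kernel:
  assumes "\<And>t. t < r' \<Longrightarrow> g t \<in> grade sh M (sh' t)"
  shows "graded_submodule r' sh' (kernel g r')"
proof -
  note lin = mod_linearD[OF mod_linear_combine[of g r']]
  have "hpart sh j 0 = 0" for j
    by (rule ext) (simp add: hpart_def)
  then have "combine g r' (hpart sh' j v) = 0" if "combine g r' v = 0" for v j
    using combine_hpart[OF assms, of r' "\<lambda>t. t" j v] that by simp
  then show ?thesis
    unfolding graded_submodule_def kernel_def
    using free_module_0 free_module_add free_module_smul free_module_hpart lin(1,2,3)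
    by (auto simp: smul_simps)
qed

lemma grade_image:
  assumes "\<And>t. t < r' \<Longrightarrow> g t \<in> grade sh M (sh' t)" and im: "combine g r' ` free_module r' = M"
  shows "combine g r' ` grade sh' (free_module r') j = grade sh M j"
proof (intro equalityI subsetI)
  fix w assume "w \<in> combine g r' ` grade sh' (free_module r') j"
  then obtain v where v: "w = combine g r' v" "v \<in> free_module r'" "hpart sh' j v = v"
    unfolding grade_def homogeneous_iff_hpart by blast
  have "hpart sh j w = w"
    using combine_hpart[OF assms(1), of r' "\<lambda>t. t" j v] unfolding v(1,3) by simp
  then show "w \<in> grade sh M j"
    using v(1,2) im unfolding grade_def homogeneous_iff_hpart by blast
next
  fix w assume "w \<in> grade sh M j"
  then have w: "w \<in> M" "hpart sh j w = w"
    unfolding grade_def homogeneous_iff_hpart by blast+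
  then obtain v where v: "w = combine g r' v" "v \<in> free_module r'"
    using im by blast
  have "w = combine g r' (hpart sh' j v)"
    using combine_hpart[OF assms(1), of r' "\<lambda>t. t" j v] w(2) v(1) by simp
  moreover have "hpart sh' j v \<in> grade sh' (free_module r') j"
    using free_module_hpart[OF v(2)] by (simp add: grade_def hpart_def homogeneous_hom_part)
  ultimately show "w \<in> combine g r' ` grade sh' (free_module r') j"
    by blast
qed

text \<open>This is a multidegree of the Koszul complex of the ring itself. A nonempty simplex is a
  cone; over the empty set only degree 0 carries homology, namely the field.\<close>

lemma acyclic_at_full:
  assumes "\<sigma> \<subseteq> V" "\<sigma> \<noteq> {} \<or> 1 \<le> p"
  shows "acyclic_at \<sigma> (\<lambda>S. True) p"
proof (cases "\<sigma> = {}")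
  case True
  have "f = (\<lambda>_. 0)" if f: "f \<in> schain {} \<Psi> p" for f \<Psi>
  proof
    fix S
    show "f S = 0"
      using schain_D(1,2)[OF f, of S] assms(2) True by (cases "S = {}") auto
  qed
  then show ?thesis
    unfolding acyclic_at_def True by (metis schain_zero sdiff_zero)
next
  case False
  then obtain x where "x \<in> \<sigma>"
    by blast
  then show ?thesis
    by (intro acyclic_at_cone[OF assms(1)]) simp_all
qed

text \<open>Identifies module elements with Koszul chains of homological degree 0.\<close>

definition pt :: "(nat \<Rightarrow> ('v, 'k) mpoly) \<Rightarrow> ('v, 'k) kchain" where
  "pt y = (\<lambda>S. if S = {} then y else 0)"

lemma pt_kchains: "pt y \<in> kchains M j 0 \<longleftrightarrow> y \<in> M j"
proof
  assume "pt y \<in> kchains M j 0"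
  from kchainsD(1)[OF this, of "{}"] show "y \<in> M j"
    by (simp add: pt_def)
next
  assume "y \<in> M j"
  moreover have "S = {}" if "S \<subseteq> V" "int (card S) = 0" for S
    using that finite_subset[OF that(1) finite_V] by simp
  ultimately show "pt y \<in> kchains M j 0"
    by (intro kchainsI) (auto simp: pt_def)
qed

lemma kchains_0_pt:
  assumes "c \<in> kchains M j 0"
  shows "c = pt (c {})"
proof
  fix S
  show "c S = pt (c {}) S"
  proof (cases "S = {}")
    case False
    have "\<not> (S \<subseteq> V \<and> int (card S) = 0)"
      using False finite_subset[OF _ finite_V, of S] by auto
    then show ?thesis
      using kchainsD(4)[OF assms] False by (simp add: pt_def)
  qed (simp add: pt_def)
qed

lemma pt_sum: "pt (\<Sum>a\<in>A. f a) = (\<Sum>a\<in>A. pt (f a))"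
proof
  fix S
  show "pt (\<Sum>a\<in>A. f a) S = (\<Sum>a\<in>A. pt (f a)) S"
    unfolding sum_fun_apply[of "\<lambda>a. pt (f a)" A S] by (cases "S = {}") (simp_all add: pt_def)
qed

lemma pt_diff: "pt (u - v) = pt u - pt v"
  by (rule ext) (simp add: pt_def)

lemma kscale_pt: "kscale a (pt y) = pt (smul (cst a) y)"
  by (rule ext) (simp add: pt_def kscale_apply smul_simps)

text \<open>Boundaries in degree 0 are the combinations of variables with coefficients from the
  module, since a chain of degree 1 is one coefficient for each variable.\<close>

lemma pt_kbounds:
  "pt y \<in> kbounds M j 0 \<longleftrightarrow> (\<exists>w. (\<forall>x\<in>V. w x \<in> M (j - 1)) \<and> y = (\<Sum>x\<in>V. smul (kcoeff x {}) (w x)))"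
  if M: "graded_module M"
proof
  assume "pt y \<in> kbounds M j 0"
  then obtain e where e: "e \<in> kchains M j 1" "pt y = kdiff e"
    by (auto simp: kbounds_def)
  have "y = (\<Sum>x\<in>V. smul (kcoeff x {}) (e {x}))"
    using fun_cong[OF e(2), of "{}"] by (simp add: pt_def kdiff_def)
  moreover have "\<forall>x\<in>V. e {x} \<in> M (j - 1)"
    using kchainsD(1)[OF e(1)] by simp
  ultimately show "\<exists>w. (\<forall>x\<in>V. w x \<in> M (j - 1)) \<and> y = (\<Sum>x\<in>V. smul (kcoeff x {}) (w x))"
    by (intro exI[of _ "\<lambda>x. e {x}"]) blast
next
  assume "\<exists>w. (\<forall>x\<in>V. w x \<in> M (j - 1)) \<and> y = (\<Sum>x\<in>V. smul (kcoeff x {}) (w x))"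
  then obtain w where w: "\<And>x. x \<in> V \<Longrightarrow> w x \<in> M (j - 1)" "y = (\<Sum>x\<in>V. smul (kcoeff x {}) (w x))"
    by blast
  define e where "e S = (if S \<subseteq> V \<and> int (card S) = 1 then w (the_elem S) else 0)" for S
  have e: "e \<in> kchains M j 1"
  proof (rule kchainsI)
    fix S assume S: "S \<subseteq> V" "int (card S) = 1"
    then obtain x where "S = {x}"
      by (auto simp: card_1_singleton_iff)
    then show "e S \<in> M (j - 1)"
      using S w(1) by (simp add: e_def)
  qed (unfold e_def, rule if_not_P)
  then have "kdiff e \<in> kchains M j 0"
    using kdiff_kchains[OF M, of e j 0] by simp
  then have "kdiff e = pt (kdiff e {})"
    by (rule kchains_0_pt)
  also have "kdiff e {} = y"
    by (simp add: kdiff_def e_def w(2))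
  finally have "pt y = kdiff e"
    by (rule sym)
  then show "pt y \<in> kbounds M j 0"
    unfolding kbounds_def using e by (intro image_eqI[of _ _ e]) simp_all
qed

lemma graded_module_free: "graded_module (mono_module r sh (\<lambda>_. True))"
  by (rule graded_module_mono_module) simp

text \<open>In multidegree 0 the slice is the constant term, which nothing can bound; every other
  multidegree has nonempty support, where the full simplex is exact.\<close>

lemma free_kbounds_iff:
  assumes y: "y \<in> mono_module r sh (\<lambda>_. True) j"
  shows "pt y \<in> kbounds (mono_module r sh (\<lambda>_. True)) j 0 \<longleftrightarrow> (\<forall>s. lookup (y s) 0 = 0)"
proof
  assume "pt y \<in> kbounds (mono_module r sh (\<lambda>_. True)) j 0"
  then obtain w where w: "y = (\<Sum>x\<in>V. smul (kcoeff x {}) (w x))"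
    unfolding pt_kbounds[OF graded_module_free] by blast
  have "lookup (var x :: ('v, 'k) mpoly) 0 = 0" for x
    using lookup_var_mult[of x 1 0] by simp
  then have "lookup (kcoeff x {} * q) 0 = 0" for x q
    by (simp add: lookup_mult_0 kcoeff_def)
  then show "\<forall>s. lookup (y s) 0 = 0"
    unfolding w by (simp add: sum_fun_apply lookup_sum)
next
  assume zero: "\<forall>s. lookup (y s) 0 = 0"
  have c: "pt y \<in> kchains (mono_module r sh (\<lambda>_. True)) j 0"
    using y by (simp add: pt_kchains)
  then have "kdiff (pt y) = 0"
    using kcycles_0 unfolding kcycles_def by blast
  show "pt y \<in> kbounds (mono_module r sh (\<lambda>_. True)) j 0"
  proof (rule mono_module_boundaryI[OF c])
    fix s a assume a: "s < r" "keys a \<subseteq> V" "int (mon_degree a) = j - sh s"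
    note p = component_pchains[OF c, of s]
    show "\<exists>g\<in>schain (keys a) (\<lambda>S. True) (0 + 1).
        \<forall>S. sdiff (keys a) g S = slice a (\<lambda>S. pt y S s) S"
    proof (cases "a = 0")
      case True
      have "slice a (\<lambda>S. pt y S s) = (\<lambda>_. 0)"
        using zero by (auto simp: slice_def True pt_def indicator_exp_def fun_eq_iff)
      then show ?thesis
        by (intro bexI[of _ "\<lambda>_. 0"]) simp_all
    next
      case False
      then have ne: "keys a \<noteq> {}"
        by (metis mon_degree_def mon_degree_eq_0_iff sum.empty)
      have "pdiff (\<lambda>S. pt y S s) = (\<lambda>_. 0)"
        unfolding kdiff_component[symmetric] by (simp add: \<open>kdiff (pt y) = 0\<close>)
      then have "sdiff (keys a) (slice a (\<lambda>S. pt y S s)) S = 0" for S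
        using sdiff_slice_cycle[OF p a(2)] by (simp add: slice_def)
      moreover have "acyclic_at (keys a) (\<lambda>S. True) 0"
        using acyclic_at_full[OF a(2)] ne by blast
      ultimately show ?thesis
        using slice_schain[OF p] unfolding acyclic_at_def by blast
    qed
  qed
qed

text \<open>The hypotheses of the two isomorphisms hold for a minimal cover: free modules are Koszul
  exact in positive degrees, and kernel vectors, having no constant terms, are boundaries in degree
  0.\<close>

lemma
  assumes M: "graded_submodule r sh M" and cover: "minimal_cover sh M r' sh' g"
  shows minimal_cover_connecting: "0 \<le> p \<Longrightarrow> quotient_iso
      (kcycles (grade sh' (kernel g r')) j p) (kbounds (grade sh' (kernel g r')) j p)
      (kcycles (grade sh M) j (p + 1)) (kbounds (grade sh M) j (p + 1))" (is "_ \<Longrightarrow> ?A")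
    and minimal_cover_generators: "quotient_iso
      (kcycles (mono_module r' sh' (\<lambda>_. True)) j 0) (kbounds (mono_module r' sh' (\<lambda>_. True)) j 0)
      (kcycles (grade sh M) j 0) (kbounds (grade sh M) j 0)" (is ?B)
    and minimal_cover_kernel: "graded_submodule r' sh' (kernel g r')" (is ?C)
proof -
  let ?F = "mono_module r' sh' (\<lambda>_. True)"
  have g: "\<And>t. t < r' \<Longrightarrow> g t \<in> grade sh M (sh' t)" and im: "combine g r' ` free_module r' = M"
    and min: "\<And>v t. v \<in> kernel g r' \<Longrightarrow> lookup (v t) 0 = 0"
    using cover unfolding minimal_cover_def by blast+
  have surj: "combine g r' ` ?F j = grade sh M j" for j
    using grade_image[OF g im] unfolding grade_free_module by blast
  have N: "grade sh' (kernel g r') = (\<lambda>j. {v \<in> ?F j. combine g r' v = 0})"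
    unfolding grade_free_module[symmetric] by (auto simp: grade_def kernel_def fun_eq_iff)
  have exact: "kcycles ?F j p \<subseteq> kbounds ?F j p" if "1 \<le> p" for j p
    by (rule mono_module_exact) (use acyclic_at_full that in blast)
  have minimal: "kchains (grade sh' (kernel g r')) j 0 \<subseteq> kbounds ?F j 0" for j
  proof
    fix c assume c: "c \<in> kchains (grade sh' (kernel g r')) j 0"
    have eq: "c = pt (c {})"
      by (rule kchains_0_pt[OF c])
    have k: "c {} \<in> grade sh' (kernel g r') j"
      using kchainsD(1)[OF c, of "{}"] by simp
    then have "c {} \<in> ?F j"
      unfolding N by blast
    moreover have "lookup (c {} s) 0 = 0" for s
      using min gradeD(1)[OF k] by blast
    ultimately show "c \<in> kbounds ?F j 0"
      by (subst eq) (simp add: free_kbounds_iff)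
  qed
  show ?A if "0 \<le> p"
    by (rule connecting_iso[OF graded_module_free graded_module_grade[OF M] mod_linear_combine surj N exact minimal that])
  show ?B
    by (rule generators_iso[OF graded_module_free graded_module_grade[OF M] mod_linear_combine surj N minimal])
  show ?C
    by (rule graded_submodule_kernel[OF g])
qed

text \<open>A vector of degree j can have a constant term only in components whose generator has
  degree j. Subtracting these constants leaves a boundary, and a combination of the unit vectors is
  a boundary only if all its constants vanish.\<close>

lemma has_quotient_dim_free:
  "has_quotient_dim (kcycles (mono_module r sh (\<lambda>_. True)) j 0) (kbounds (mono_module r sh (\<lambda>_. True)) j 0)
     (card {s. s < r \<and> sh s = j})"
proof -
  let ?F = "mono_module r sh (\<lambda>_. True)" and ?I = "{s. s < r \<and> sh s = j}"
  define n where "n = card ?I"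
  have "finite ?I"
    by simp
  then obtain h where h: "bij_betw h {..<n} ?I"
    using ex_bij_betw_nat_finite[of ?I] by (auto simp: n_def atLeast0LessThan)
  have hI: "h l < r" "sh (h l) = j" if "l < n" for l
    using h that by (auto simp: bij_betw_def)
  have u: "unit_vec (h l) \<in> ?F j" if "l < n" for l
    using hI[OF that] homogeneous_cst[of 1]
    by (auto simp: mono_module_def unit_vec_def poly_ring_eq_monomial_ideal[symmetric])
  let ?y = "\<lambda>a. \<Sum>l<n. smul (cst (a l)) (unit_vec (h l) :: nat \<Rightarrow> ('v, 'k) mpoly)"
  have y: "?y a \<in> ?F j" for a
    by (rule graded_moduleD(6)[OF graded_module_free]) (use u graded_moduleD(4)[OF graded_module_free] in blast)
  have ly: "lookup (?y a s) 0 = (\<Sum>l<n. if h l = s then a l else 0)" for a s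
    unfolding sum_fun_apply lookup_sum by (rule sum.cong) (auto simp: unit_vec_def)
  have lyh: "lookup (?y a (h i)) 0 = a i" if "i < n" for a i
  proof -
    have "(\<Sum>l<n. if h l = h i then a l else 0) = (\<Sum>l<n. if l = i then a l else 0)"
      using h that by (intro sum.cong) (auto simp: bij_betw_def inj_on_def)
    then show ?thesis
      using that by (simp add: ly)
  qed
  have sum: "(\<Sum>l<n. kscale (a l) (pt (unit_vec (h l)))) = pt (?y a)" for a
    by (simp only: kscale_pt pt_sum)
  show ?thesis
    unfolding has_quotient_dim_def n_def[symmetric] kcycles_0
  proof (intro exI[of _ "\<lambda>l. pt (unit_vec (h l))"] conjI allI impI ballI)
    show "pt (unit_vec (h l)) \<in> kchains ?F j 0" if "l < n" for l
      using u[OF that] by (simp add: pt_kchains)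
    show "\<exists>a. c - (\<Sum>l<n. kscale (a l) (pt (unit_vec (h l)))) \<in> kbounds ?F j 0"
      if c: "c \<in> kchains ?F j 0" for c
    proof
      let ?a = "\<lambda>l. lookup (c {} (h l)) 0"
      have c0: "c {} \<in> ?F j"
        using kchainsD(1)[OF c, of "{}"] by simp
      have "c {} - ?y ?a = c {} + - ?y ?a"
        by simp
      also have "\<dots> \<in> ?F j"
        by (intro graded_moduleD(2,5)[OF graded_module_free] c0 y)
      finally have d: "c {} - ?y ?a \<in> ?F j" .
      have "lookup ((c {} - ?y ?a) s) 0 = 0" for s
      proof (cases "s \<in> ?I")
        case True
        then obtain i where i: "i < n" "s = h i"
          using h by (auto simp: bij_betw_def)
        then show ?thesis
          unfolding minus_apply lookup_minus i(2) lyh[OF i(1), of ?a] by simp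
      next
        case False
        have "(\<Sum>l<n. if h l = s then ?a l else 0) = 0"
          using hI False by (intro sum.neutral) auto
        moreover have "lookup (c {} s) 0 = 0"
        proof (cases "s < r")
          case True
          then show ?thesis
            using False mono_moduleD(2)[OF c0, of s] by (intro homogeneous_lookup) auto
        next
          case False
          then show ?thesis
            using mono_moduleD(3)[OF c0, of s] by simp
        qed
        ultimately show ?thesis
          unfolding minus_apply lookup_minus ly by simp
      qed
      then have "pt (c {} - ?y ?a) \<in> kbounds ?F j 0"
        using free_kbounds_iff[OF d] by blast
      then show "c - (\<Sum>l<n. kscale (?a l) (pt (unit_vec (h l)))) \<in> kbounds ?F j 0"
        unfolding sum pt_diff kchains_0_pt[OF c, symmetric] .
    qed
    show "a l = 0" if "(\<Sum>l<n. kscale (a l) (pt (unit_vec (h l)))) \<in> kbounds ?F j 0" "l < n" for a l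
    proof -
      have "lookup (?y a (h l)) 0 = 0"
        using that(1) unfolding sum by (rule iffD1[OF free_kbounds_iff[OF y[of a]], THEN spec])
      then show ?thesis
        unfolding lyh[OF that(2)] .
    qed
  qed
qed

end

lemma homogeneous_0_eq: "homogeneous 0 p \<Longrightarrow> p = cst (lookup p 0)"
  by (rule poly_mapping_eqI) (auto simp: lookup_single when_def homogeneous_lookup)

context sign_function
begin

text \<open>The rank one case of \<open>free_kbounds_iff\<close> writes u as a sum of variables
  times homogeneous polynomials of degree one less; multiplying by y gives a boundary.\<close>

lemma smul_in_kbounds:
  assumes M: "graded_submodule r sh M" and u: "u \<in> poly_ring V" "homogeneous e u" "lookup u 0 = 0"
    and y: "y \<in> grade sh M (j - e)"
  shows "pt (smul u y) \<in> kbounds (grade sh M) j 0"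
proof -
  define v where "v s = (if s = 0 then u else 0)" for s :: nat
  have "v \<in> mono_module 1 (\<lambda>_. 0) (\<lambda>_. True) e"
    using u by (auto simp: v_def mono_module_def poly_ring_eq_monomial_ideal)
  then have "pt v \<in> kbounds (mono_module 1 (\<lambda>_. 0) (\<lambda>_. True)) e 0"
    by (subst free_kbounds_iff) (auto simp: v_def u(3))
  then obtain w where w: "\<And>x. x \<in> V \<Longrightarrow> w x \<in> mono_module 1 (\<lambda>_. 0) (\<lambda>_. True) (e - 1)"
    "v = (\<Sum>x\<in>V. smul (kcoeff x {}) (w x))"
    unfolding pt_kbounds[OF graded_module_free] by blast
  have u_eq: "u = (\<Sum>x\<in>V. kcoeff x {} * w x 0)"
    using fun_cong[OF w(2), of 0] by (simp add: v_def sum_fun_apply)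
  note gM = graded_module_grade[OF M]
  have "smul (w x 0) y \<in> grade sh M (j - 1)" if "x \<in> V" for x
  proof -
    have "w x 0 \<in> poly_ring V" "homogeneous (e - 1) (w x 0)"
      using mono_moduleD(1,2)[OF w(1)[OF that], of 0] by (simp_all add: poly_ring_eq_monomial_ideal)
    from graded_moduleD(3)[OF gM y this] show ?thesis
      by (simp add: algebra_simps)
  qed
  moreover have "smul u y = (\<Sum>x\<in>V. smul (kcoeff x {}) (smul (w x 0) y))"
  proof
    fix s
    have "smul u y s = (\<Sum>x\<in>V. kcoeff x {} * w x 0) * y s"
      by (simp only: smul_apply u_eq[symmetric])
    also have "\<dots> = (\<Sum>x\<in>V. kcoeff x {} * (w x 0 * y s))"
      by (simp only: sum_distrib_right mult.assoc)
    finally show "smul u y s = (\<Sum>x\<in>V. smul (kcoeff x {}) (smul (w x 0) y)) s"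
      by (simp only: sum_fun_apply smul_apply)
  qed
  ultimately show ?thesis
    unfolding pt_kbounds[OF gM] by (intro exI[of _ "\<lambda>x. smul (w x 0) y"] conjI ballI)
qed

lemma grade_negative:
  assumes "graded_submodule r sh M" "\<forall>s<r. 0 \<le> sh s" "j < 0" "v \<in> grade sh M j"
  shows "v = 0"
proof
  fix s
  show "v s = 0 s"
  proof (cases "s < r")
    case True
    then show ?thesis
      using homogeneous_negative[OF gradeD(2)[OF assms(4), of s]] assms(2,3) by force
  next
    case False
    then show ?thesis
      using graded_submoduleD(1)[OF assms(1)] gradeD(1)[OF assms(4)] free_moduleD(2)[of v r s] by auto
  qed
qed

lemma generated_by_grades:
  assumes M: "graded_submodule r sh M" and g: "\<And>t. t < r' \<Longrightarrow> g t \<in> M"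
    and gr: "\<And>j. grade sh M j \<subseteq> combine g r' ` free_module r'"
  shows "combine g r' ` free_module r' = M"
proof (intro equalityI subsetI)
  fix w assume "w \<in> combine g r' ` free_module r'"
  then obtain v where v: "w = combine g r' v" "v \<in> free_module r'"
    by blast
  show "w \<in> M"
    unfolding v(1) combine_def
    by (rule graded_submodule_sum[OF M], rule graded_submoduleD(4)[OF M]) (use v(2) free_moduleD(1) g in auto)
next
  fix v assume v: "v \<in> M"
  \<comment> \<open>All degrees occurring in v: exponent degree plus the degree of the component's
    generator.\<close>
  define D where "D = (\<Union>s<r. (\<lambda>t. int (mon_degree t) + sh s) ` keys (v s))"
  have finD: "finite D"
    by (simp add: D_def)
  have "v = (\<Sum>j\<in>D. hpart sh j v)"
  proof
    fix s
    show "v s = (\<Sum>j\<in>D. hpart sh j v) s"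
    proof (cases "s < r")
      case True
      have "(\<Sum>j\<in>D. hom_part (j - sh s) (v s)) = (\<Sum>e\<in>(\<lambda>j. j - sh s) ` D. hom_part e (v s))"
        by (subst sum.reindex) (auto simp: inj_on_def)
      also have "\<dots> = v s"
      proof (rule sum_hom_parts)
        fix t assume t: "t \<in> keys (v s)"
        then have "int (mon_degree t) + sh s \<in> D"
          using True by (auto simp: D_def)
        then show "int (mon_degree t) \<in> (\<lambda>j. j - sh s) ` D"
          by (rule image_eqI[rotated]) simp
      qed (use finD in simp)
      finally show ?thesis
        by (simp add: sum_fun_apply hpart_def)
    next
      case False
      then have "v s = 0"
        using graded_submoduleD(1)[OF M] v free_moduleD(2)[of v r s] by auto
      then show ?thesis
        by (simp add: sum_fun_apply hpart_def)
    qed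
  qed
  moreover have "hpart sh j v \<in> combine g r' ` free_module r'" for j
  proof -
    have "hpart sh j v \<in> grade sh M j"
      using graded_submoduleD(5)[OF M v, of j] by (simp add: grade_def hpart_def homogeneous_hom_part)
    then show ?thesis
      using gr by blast
  qed
  moreover have "(\<Sum>j\<in>D. f j) \<in> combine g r' ` free_module r'"
    if "\<And>j. f j \<in> combine g r' ` free_module r'" for f :: "int \<Rightarrow> nat \<Rightarrow> ('v, 'k) mpoly"
  proof -
    have "\<forall>j. \<exists>w. w \<in> free_module r' \<and> f j = combine g r' w"
      using that by blast
    then obtain w where w: "\<And>j. w j \<in> free_module r'" "\<And>j. f j = combine g r' (w j)"
      by metis
    have "(\<Sum>j\<in>D. f j) = combine g r' (\<Sum>j\<in>D. w j)"
      unfolding mod_linearD(6)[OF mod_linear_combine] using w(2) by simp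
    moreover have "(\<Sum>j\<in>D. w j) \<in> free_module r'"
      by (rule graded_submodule_sum[OF graded_submodule_free_module w(1)])
    ultimately show ?thesis
      by blast
  qed
  ultimately show "v \<in> combine g r' ` free_module r'"
    by metis
qed

text \<open>Generators of \<open>M\<close> are lifts of bases of the graded pieces of \<open>M/\<mm>M\<close>, which is the
  Koszul homology of \<open>M\<close> in degree 0; they generate by the graded Nakayama lemma.\<close>

lemma minimal_cover_exists:
  assumes M: "graded_submodule r sh M" and pos: "\<forall>s<r. 0 \<le> sh s"
    and fin: "\<And>j. \<exists>n. has_quotient_dim (kcycles (grade sh M) j 0) (kbounds (grade sh M) j 0) n"
    and bounded: "\<And>j. N < j \<Longrightarrow> kcycles (grade sh M) j 0 \<subseteq> kbounds (grade sh M) j 0"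
  shows "\<exists>r' sh' g. minimal_cover sh M r' sh' g \<and> (\<forall>t<r'. 0 \<le> sh' t)"
proof -
  note gM = graded_module_grade[OF M]
  let ?Z = "\<lambda>j. kchains (grade sh M) j 0" and ?B = "\<lambda>j. kbounds (grade sh M) j 0"
  obtain n where n: "\<And>j. has_quotient_dim (?Z j) (?B j) (n j)"
    using fin unfolding kcycles_0 by metis
  have "\<forall>j. \<exists>b. (\<forall>l<n j. b l \<in> ?Z j) \<and> (\<forall>z\<in>?Z j. \<exists>a. z - (\<Sum>l<n j. kscale (a l) (b l)) \<in> ?B j) \<and>
     (\<forall>a. (\<Sum>l<n j. kscale (a l) (b l)) \<in> ?B j \<longrightarrow> (\<forall>l<n j. a l = 0))"
    using n unfolding has_quotient_dim_def by (rule allI)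
  then obtain b where "\<forall>j. (\<forall>l<n j. b j l \<in> ?Z j) \<and> (\<forall>z\<in>?Z j. \<exists>a. z - (\<Sum>l<n j. kscale (a l) (b j l)) \<in> ?B j) \<and>
     (\<forall>a. (\<Sum>l<n j. kscale (a l) (b j l)) \<in> ?B j \<longrightarrow> (\<forall>l<n j. a l = 0))"
    unfolding choice_iff by (elim exE)
  then have b: "\<And>j l. l < n j \<Longrightarrow> b j l \<in> ?Z j"
    and span: "\<And>j z. z \<in> ?Z j \<Longrightarrow> \<exists>a. z - (\<Sum>l<n j. kscale (a l) (b j l)) \<in> ?B j"
    and indep: "\<And>j a l. (\<Sum>l<n j. kscale (a l) (b j l)) \<in> ?B j \<Longrightarrow> l < n j \<Longrightarrow> a l = 0"
    by blast+
  define y where "y j l = b j l {}" for j l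
  have by_pt: "b j l = pt (y j l)" if "l < n j" for j l
    unfolding y_def by (rule kchains_0_pt[OF b[OF that]])
  have yM: "y j l \<in> grade sh M j" if "l < n j" for j l
    using kchainsD(1)[OF b[OF that], of "{}"] by (simp add: y_def)
  have sum_b: "(\<Sum>l<n j. kscale (a l) (b j l)) = pt (\<Sum>l<n j. smul (cst (a l)) (y j l))" for a j
    unfolding pt_sum by (rule sum.cong) (simp_all add: by_pt kscale_pt)
  \<comment> \<open>Generators occur in degrees 0 to N only, as the module vanishes below 0 and the
    homology above N. This is what makes the cover finitely generated.\<close>
  have n0: "n j = 0" if "j \<notin> {0..N}" for j
  proof -
    have "?Z j \<subseteq> ?B j"
    proof (cases "N < j")
      case True
      then show ?thesis
        using bounded[of j] by (simp add: kcycles_0)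
    next
      case False
      then have "j < 0"
        using that by auto
      show ?thesis
      proof
        fix c assume c: "c \<in> ?Z j"
        have "c {} = 0"
          using grade_negative[OF M pos \<open>j < 0\<close>] kchainsD(1)[OF c, of "{}"] by simp
        then have "c = pt 0"
          using kchains_0_pt[OF c] by metis
        also have "pt 0 = (0 :: ('v, 'k) kchain)"
          by (rule ext) (simp add: pt_def)
        finally have "c = 0" .
        then show "c \<in> ?B j"
          using subspace_kbounds[OF gM] by (simp add: kspace.subspace_0)
      qed
    qed
    then show ?thesis
      by (rule has_quotient_dim_subset[OF n])
  qed
  define J where "J = (SIGMA j:{0..N}. {..<n j})"
  have "finite J"
    by (simp add: J_def)
  define r' where "r' = card J"
  obtain h where h: "bij_betw h {..<r'} J"
    using ex_bij_betw_nat_finite[OF \<open>finite J\<close>] by (auto simp: r'_def atLeast0LessThan)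
  define sh' where "sh' t = fst (h t)" for t
  define g where "g t = y (fst (h t)) (snd (h t))" for t
  have ht: "0 \<le> sh' t" "snd (h t) < n (sh' t)" if "t < r'" for t
  proof -
    have "h t \<in> J"
      using h that by (auto simp: bij_betw_def)
    then show "0 \<le> sh' t" "snd (h t) < n (sh' t)"
      unfolding sh'_def J_def by (auto simp: mem_Sigma_iff split_beta)
  qed
  have g: "g t \<in> grade sh M (sh' t)" if "t < r'" for t
    using yM[OF ht(2)[OF that]] by (simp add: g_def sh'_def)
  have surj_h: "\<exists>t<r'. h t = (j, l)" if "l < n j" for j l
  proof -
    have "j \<in> {0..N}"
      using n0[of j] that by fastforce
    then have "(j, l) \<in> J"
      using that by (simp add: J_def)
    then show ?thesis
      using h by (force simp: bij_betw_def)
  qed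
  let ?I = "combine g r' ` free_module r'"
  have I_add: "u + v \<in> ?I" if "u \<in> ?I" "v \<in> ?I" for u v
    using that free_module_add by (auto simp flip: mod_linearD(1)[OF mod_linear_combine])
  have I_smul: "smul q v \<in> ?I" if "q \<in> poly_ring V" "v \<in> ?I" for q v
    using that free_module_smul by (auto simp flip: mod_linearD(2)[OF mod_linear_combine])
  have "combine g r' 0 \<in> ?I"
    using free_module_0 by blast
  then have I_0: "0 \<in> ?I"
    using mod_linearD(3)[OF mod_linear_combine, of g r'] by simp
  have I_sum: "sum f A \<in> ?I" if "\<And>a. a \<in> A \<Longrightarrow> f a \<in> ?I" for f and A :: "'x set"
    using that by (induction A rule: infinite_finite_induct) (simp_all add: I_0 I_add)
  have I_y: "y j l \<in> ?I" if l: "l < n j" for j l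
  proof -
    obtain t where t: "t < r'" "h t = (j, l)"
      using surj_h[OF l] by blast
    have "combine g r' (unit_vec t) = y j l"
      using combine_unit_vec[OF t(1), of g] t(2) by (simp add: g_def)
    then show ?thesis
      using unit_vec_free_module[OF t(1)] by (metis imageI)
  qed
  have gen: "grade sh M j \<subseteq> ?I" for j
  \<comment> \<open>The measure sends all negative degrees, where the module is zero, to the base
    case 0.\<close>
  proof (induction "nat (j + 1)" arbitrary: j rule: less_induct)
    case less
    show ?case
    proof
      fix v assume v: "v \<in> grade sh M j"
      show "v \<in> ?I"
      proof (cases "j < 0")
        case True
        then show ?thesis
          using grade_negative[OF M pos True v] I_0 by simp
      next
        case False
        then have IH: "grade sh M (j - 1) \<subseteq> ?I"
          by (intro less.hyps) auto
        have "pt v \<in> ?Z j"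
          using v by (simp add: pt_kchains)
        then obtain a where "pt v - (\<Sum>l<n j. kscale (a l) (b j l)) \<in> ?B j"
          using span by blast
        then have "pt (v - (\<Sum>l<n j. smul (cst (a l)) (y j l))) \<in> ?B j"
          unfolding sum_b pt_diff .
        then obtain w where w: "\<And>x. x \<in> V \<Longrightarrow> w x \<in> grade sh M (j - 1)"
          "v - (\<Sum>l<n j. smul (cst (a l)) (y j l)) = (\<Sum>x\<in>V. smul (kcoeff x {}) (w x))"
          unfolding pt_kbounds[OF gM] by blast
        have v_eq: "v = (\<Sum>x\<in>V. smul (kcoeff x {}) (w x)) + (\<Sum>l<n j. smul (cst (a l)) (y j l))"
          unfolding w(2)[symmetric] by simp
        have "(\<Sum>x\<in>V. smul (kcoeff x {}) (w x)) \<in> ?I"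
        proof (rule I_sum)
          fix x assume "x \<in> V"
          then show "smul (kcoeff x {}) (w x) \<in> ?I"
            using w(1) IH by (intro I_smul kcoeff_poly_ring) auto
        qed
        moreover have "(\<Sum>l<n j. smul (cst (a l)) (y j l)) \<in> ?I"
          by (rule I_sum, rule I_smul) (simp_all add: I_y)
        ultimately show ?thesis
          by (subst v_eq) (rule I_add)
      qed
    qed
  qed
  have image: "?I = M"
    by (rule generated_by_grades[OF M _ gen]) (use g gradeD(1) in blast)
  \<comment> \<open>In the part of a kernel vector of degree j = \<open>sh' t0\<close>, coefficients
    at generators of other degrees have no constant term and contribute boundaries. So the constants
    at the generators of degree j give a relation modulo boundaries between independent classes, and
    must vanish.\<close>
  have minimal: "lookup (v t0) 0 = 0" if v: "v \<in> kernel g r'" for v t0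
  proof (cases "t0 < r'")
    case False
    then show ?thesis
      using v free_moduleD(2)[of v r' t0] by (simp add: kernel_def)
  next
    case True
    define j where "j = sh' t0"
    define u where "u = hpart sh' j v"
    have vF: "v \<in> free_module r'" and v0: "combine g r' v = 0"
      using v by (auto simp: kernel_def)
    have uF: "u \<in> free_module r'"
      unfolding u_def by (rule free_module_hpart[OF vF])
    have "hpart sh j 0 = 0"
      by (rule ext) (simp add: hpart_def)
    then have u0: "combine g r' u = 0"
      using combine_hpart[where g = g and sh' = sh' and sh = sh and M = M, OF g] v0 by (simp add: u_def)
    have uh: "homogeneous (j - sh' t) (u t)" for t
      by (simp add: u_def hpart_def homogeneous_hom_part)
    define P where "P = {t. t < r' \<and> sh' t = j}"
    define a where "a l = lookup (v (the_inv_into {..<r'} h (j, l))) 0" for l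
    have hinv: "the_inv_into {..<r'} h (h t) = t" if "t < r'" for t
      using h that by (simp add: bij_betw_def the_inv_into_f_f)
    have "bij_betw (\<lambda>t. snd (h t)) P {..<n j}"
      unfolding bij_betw_def
    proof
      show "inj_on (\<lambda>t. snd (h t)) P"
      proof (rule inj_onI)
        fix t t' assume t: "t \<in> P" "t' \<in> P" "snd (h t) = snd (h t')"
        then have "h t = h t'"
          by (simp add: P_def sh'_def prod_eq_iff)
        then show "t = t'"
          using t h by (auto simp: P_def bij_betw_def inj_on_def)
      qed
      show "(\<lambda>t. snd (h t)) ` P = {..<n j}"
      proof (intro equalityI subsetI)
        fix l assume "l \<in> (\<lambda>t. snd (h t)) ` P"
        then show "l \<in> {..<n j}"
          using ht(2) by (auto simp: P_def)
      next
        fix l assume "l \<in> {..<n j}"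
        then obtain t where "t < r'" "h t = (j, l)"
          using surj_h by blast
        then show "l \<in> (\<lambda>t. snd (h t)) ` P"
          by (intro image_eqI[of _ _ t]) (simp_all add: P_def sh'_def)
      qed
    qed
    then have "(\<Sum>l<n j. smul (cst (a l)) (y j l)) = (\<Sum>t\<in>P. smul (cst (a (snd (h t)))) (y j (snd (h t))))"
      by (intro sum.reindex_bij_betw[symmetric])
    also have "\<dots> = (\<Sum>t\<in>P. smul (u t) (g t))"
    proof (rule sum.cong)
      fix t assume t: "t \<in> P"
      then have "h t = (j, snd (h t))"
        by (simp add: P_def sh'_def prod_eq_iff)
      then have "a (snd (h t)) = lookup (v t) 0"
        using hinv[of t] t by (simp add: a_def P_def)
      moreover have "u t = cst (lookup (u t) 0)"
        using uh[of t] t by (intro homogeneous_0_eq) (simp add: P_def)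
      moreover have "lookup (u t) 0 = lookup (v t) 0"
        using t by (simp add: u_def hpart_def lookup_hom_part P_def)
      moreover have "g t = y j (snd (h t))"
        using t by (simp add: g_def P_def sh'_def)
      ultimately show "smul (cst (a (snd (h t)))) (y j (snd (h t))) = smul (u t) (g t)"
        by simp
    qed simp
    finally have eqP: "(\<Sum>l<n j. smul (cst (a l)) (y j l)) = (\<Sum>t\<in>P. smul (u t) (g t))" .
    have "combine g r' u = (\<Sum>t\<in>{..<r'} - P. smul (u t) (g t)) + (\<Sum>t\<in>P. smul (u t) (g t))"
      unfolding combine_def by (rule sum.subset_diff) (auto simp: P_def)
    then have "(\<Sum>t\<in>P. smul (u t) (g t)) = - (\<Sum>t\<in>{..<r'} - P. smul (u t) (g t))"
      unfolding u0 by (rule minus_unique[OF sym, symmetric])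
    also have "\<dots> = (\<Sum>t\<in>{..<r'} - P. smul (- u t) (g t))"
      by (simp add: sum_negf smul_simps)
    finally have "pt (\<Sum>l<n j. smul (cst (a l)) (y j l)) = (\<Sum>t\<in>{..<r'} - P. pt (smul (- u t) (g t)))"
      unfolding eqP by (simp only: pt_sum)
    also have "\<dots> \<in> ?B j"
    proof (rule kspace.subspace_sum[OF subspace_kbounds[OF gM]])
      fix t assume t: "t \<in> {..<r'} - P"
      then have tr: "t < r'" "sh' t \<noteq> j"
        by (auto simp: P_def)
      have "- u t \<in> poly_ring V"
        using free_moduleD(1)[OF uF, of t] by (simp add: poly_ring_def)
      moreover have "homogeneous (j - sh' t) (- u t)"
        by (rule homogeneous_uminus[OF uh])
      moreover have "lookup (- u t) 0 = 0"
        using homogeneous_lookup[OF uh, of 0 t] tr(2) by simp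
      moreover have "g t \<in> grade sh M (j - (j - sh' t))"
        using g[OF tr(1)] by simp
      ultimately show "pt (smul (- u t) (g t)) \<in> ?B j"
        by (rule smul_in_kbounds[OF M])
    qed
    finally have "(\<Sum>l<n j. kscale (a l) (b j l)) \<in> ?B j"
      unfolding sum_b .
    moreover have "h t0 = (j, snd (h t0))" "snd (h t0) < n j"
      using ht(2)[OF True] by (simp_all add: j_def sh'_def prod_eq_iff)
    ultimately show ?thesis
      using indep[where j = j and a = a and l = "snd (h t0)"] hinv[OF True] by (simp add: a_def)
  qed
  have "minimal_cover sh M r' sh' g"
    unfolding minimal_cover_def using g image minimal by blast
  then show ?thesis
    using ht(1) by blast
qed

end

section \<open>Minimal free resolutions and regularity\<close>

context sign_function
begin

definition ideal_module :: "('v, 'k) mpoly set \<Rightarrow> (nat \<Rightarrow> ('v, 'k) mpoly) set" where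
  "ideal_module J = {v. v 0 \<in> J \<and> (\<forall>s>0. v s = 0)}"

abbreviation koszul_dim :: "(int \<Rightarrow> (nat \<Rightarrow> ('v, 'k) mpoly) set) \<Rightarrow> int \<Rightarrow> int \<Rightarrow> nat \<Rightarrow> bool" where
  "koszul_dim M j p n \<equiv> has_quotient_dim (kcycles M j p) (kbounds M j p) n"

lemma koszul_dim_kernel:
  assumes "graded_submodule r sh M" "minimal_cover sh M r' sh' g" "0 \<le> p"
  shows "koszul_dim (grade sh' (kernel g r')) j p n \<longleftrightarrow> koszul_dim (grade sh M) j (p + 1) n"
proof -
  note iso = minimal_cover_connecting[OF assms, of j]
  show ?thesis
    using has_quotient_dim_transport[OF iso] has_quotient_dim_transport[OF quotient_iso_sym[OF iso]] by (rule iffI)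
qed

lemma koszul_dim_generators:
  assumes "graded_submodule r sh M" "minimal_cover sh M r' sh' g"
  shows "koszul_dim (grade sh M) j 0 (card {s. s < r' \<and> sh' s = j})"
  by (rule has_quotient_dim_transport[OF minimal_cover_generators[OF assms] has_quotient_dim_free])

text \<open>A minimal resolution in the form to which dimension shifting applies: each stage
  minimally covers the kernel of the preceding one.\<close>

definition resolution_tower ::
  "('v, 'k) mpoly set \<Rightarrow> (nat \<Rightarrow> nat) \<Rightarrow> (nat \<Rightarrow> nat \<Rightarrow> int) \<Rightarrow> (nat \<Rightarrow> nat \<Rightarrow> nat \<Rightarrow> ('v, 'k) mpoly) \<Rightarrow> bool" where
  "resolution_tower J rk sh g \<longleftrightarrow> minimal_cover (\<lambda>_. 0) (ideal_module J) (rk 0) (sh 0) (g 0) \<and>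
     (\<forall>i. minimal_cover (sh i) (kernel (g i) (rk i)) (rk (Suc i)) (sh (Suc i)) (g (Suc i)))"

text \<open>Passing to a kernel lowers the homological degree by one. Generators of stage i are
  counted by degree 0 homology of the preceding kernel, hence by degree i homology of J.\<close>

lemma tower_koszul_dim:
  assumes J: "graded_submodule 1 (\<lambda>_. 0) (ideal_module J)" and T: "resolution_tower J rk sh g"
  shows "koszul_dim (grade (\<lambda>_. 0) (ideal_module J)) j (int i) (card {s. s < rk i \<and> sh i s = j})"
proof -
  have T0: "minimal_cover (\<lambda>_. 0) (ideal_module J) (rk 0) (sh 0) (g 0)"
    and TS: "\<And>i. minimal_cover (sh i) (kernel (g i) (rk i)) (rk (Suc i)) (sh (Suc i)) (g (Suc i))"
    using T unfolding resolution_tower_def by blast+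
  have K: "graded_submodule (rk i) (sh i) (kernel (g i) (rk i)) \<and>
    (\<forall>p n. 0 \<le> p \<longrightarrow> koszul_dim (grade (sh i) (kernel (g i) (rk i))) j p n \<longleftrightarrow>
      koszul_dim (grade (\<lambda>_. 0) (ideal_module J)) j (p + int i + 1) n)" for i
  proof (induction i)
    case 0
    then show ?case
      using minimal_cover_kernel[OF J T0] koszul_dim_kernel[OF J T0] by simp
  next
    case (Suc i)
    then have gs: "graded_submodule (rk i) (sh i) (kernel (g i) (rk i))"
      by blast
    show ?case
      using minimal_cover_kernel[OF gs TS] koszul_dim_kernel[OF gs TS] Suc by (simp add: algebra_simps)
  qed
  show ?thesis
  proof (cases i)
    case 0
    then show ?thesis
      using koszul_dim_generators[OF J T0] by simp
  next
    case (Suc l)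
    have "koszul_dim (grade (sh l) (kernel (g l) (rk l))) j 0 (card {s. s < rk i \<and> sh i s = j})"
      unfolding Suc using koszul_dim_generators[OF _ TS] K by blast
    then have "koszul_dim (grade (\<lambda>_. 0) (ideal_module J)) j (0 + int l + 1) (card {s. s < rk i \<and> sh i s = j})"
      using K[of l] by blast
    then show ?thesis
      by (simp add: Suc algebra_simps)
  qed
qed

text \<open>Every stage inherits finiteness and the degree bound from J through the shift of Koszul
  homology, so the same N serves throughout.\<close>

lemma tower_exists:
  assumes J: "graded_submodule 1 (\<lambda>_. 0) (ideal_module J)"
    and fin: "\<And>j p. \<exists>n. koszul_dim (grade (\<lambda>_. 0) (ideal_module J)) j p n"
    and bounded: "\<And>j p. N < j \<Longrightarrow>
      kcycles (grade (\<lambda>_. 0) (ideal_module J)) j p \<subseteq> kbounds (grade (\<lambda>_. 0) (ideal_module J)) j p"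
  shows "\<exists>rk sh g. resolution_tower J rk sh g"
proof -
  let ?H = "\<lambda>j p n. koszul_dim (grade (\<lambda>_. 0) (ideal_module J)) j p n"
  \<comment> \<open>Nonnegative shifts belong to the invariant because the construction of a cover
    starts at degree 0.\<close>
  define good where "good = (\<lambda>i (r, sh, M). graded_submodule r sh M \<and> (\<forall>s<r. 0 \<le> sh s) \<and>
    (\<forall>j p n. 0 \<le> p \<longrightarrow> koszul_dim (grade sh M) j p n \<longleftrightarrow> ?H j (p + int i) n))"
  define nxt where "nxt = (\<lambda>(r::nat, sh, M) (r', sh', M'). \<exists>g. minimal_cover sh M r' sh' g \<and> M' = kernel g r')"
  have "\<exists>f. f 0 = (1, \<lambda>_. 0, ideal_module J) \<and> (\<forall>i. good i (f i)) \<and> (\<forall>i. nxt (f i) (f (Suc i)))"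
  proof -
    have base: "good 0 (1, \<lambda>_. 0, ideal_module J)"
      using J by (simp add: good_def)
    have step: "\<exists>y. good (Suc i) y \<and> nxt x y" if x: "good i x" for x i
    proof -
      obtain r sh M where x_eq: "x = (r, sh, M)"
        by (cases x)
      have M: "graded_submodule r sh M" and pos: "\<forall>s<r. 0 \<le> sh s"
        and H: "\<And>j p n. 0 \<le> p \<Longrightarrow> koszul_dim (grade sh M) j p n \<longleftrightarrow> ?H j (p + int i) n"
        using x by (auto simp: good_def x_eq)
      have "\<exists>n. koszul_dim (grade sh M) j 0 n" for j
        using fin[of j "0 + int i"] H[of 0 j] by blast
      moreover have "kcycles (grade sh M) j 0 \<subseteq> kbounds (grade sh M) j 0" if "N < j" for j
        using bounded[OF that, of "0 + int i"] H[of 0 j 0] unfolding has_quotient_dim_0_iff by blast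
      ultimately obtain r' sh' g where c: "minimal_cover sh M r' sh' g" "\<forall>t<r'. 0 \<le> sh' t"
        using minimal_cover_exists[OF M pos] by blast
      have "good (Suc i) (r', sh', kernel g r')"
        using c(2) minimal_cover_kernel[OF M c(1)] koszul_dim_kernel[OF M c(1)] H
        by (simp add: good_def algebra_simps)
      moreover have "nxt x (r', sh', kernel g r')"
        using c(1) by (auto simp: nxt_def x_eq)
      ultimately show ?thesis
        by blast
    qed
    \<comment> \<open>Dependent choice: the invariant at stage i is what provides a stage i +
      1.\<close>
    define f where "f = rec_nat (1, \<lambda>_. 0, ideal_module J) (\<lambda>i x. SOME y. good (Suc i) y \<and> nxt x y)"
    have f0: "f 0 = (1, \<lambda>_. 0, ideal_module J)" and fS: "f (Suc i) = (SOME y. good (Suc i) y \<and> nxt (f i) y)" for i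
      by (simp_all add: f_def)
    have fg: "good i (f i)" for i
    proof (induction i)
      case (Suc i)
      show ?case
        unfolding fS using someI_ex[OF step[OF Suc]] by blast
    qed (unfold f0, rule base)
    have "nxt (f i) (f (Suc i))" for i
      unfolding fS using someI_ex[OF step[OF fg[of i]]] by blast
    then show ?thesis
      using f0 fg by blast
  qed
  then obtain f where f0: "f 0 = (1, \<lambda>_. 0, ideal_module J)" and fn: "\<And>i. nxt (f i) (f (Suc i))"
    by blast
  define rk where "rk i = fst (f (Suc i))" for i
  define sh where "sh i = fst (snd (f (Suc i)))" for i
  have "\<exists>g. minimal_cover (fst (snd (f i))) (snd (snd (f i))) (rk i) (sh i) g \<and> snd (snd (f (Suc i))) = kernel g (rk i)" for i
    using fn[of i] by (simp add: nxt_def rk_def sh_def split_beta)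
  then obtain g where g: "\<And>i. minimal_cover (fst (snd (f i))) (snd (snd (f i))) (rk i) (sh i) (g i)"
    "\<And>i. snd (snd (f (Suc i))) = kernel (g i) (rk i)"
    by metis
  have "resolution_tower J rk sh g"
    unfolding resolution_tower_def
  proof (intro conjI allI)
    show "minimal_cover (\<lambda>_. 0) (ideal_module J) (rk 0) (sh 0) (g 0)"
      using g(1)[of 0] by (simp add: f0)
    show "minimal_cover (sh i) (kernel (g i) (rk i)) (rk (Suc i)) (sh (Suc i)) (g (Suc i))" for i
      using g(1)[of "Suc i"] unfolding g(2) by (simp add: sh_def)
  qed
  then show ?thesis
    by blast
qed

section \<open>Towers and the record of a free complex\<close>

text \<open>The augmentation counts as matrix 0, with a single row, so \<open>diff F l\<close>
  becomes matrix \<open>Suc l\<close>. Entries outside the ranks, arbitrary in the record, are set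
  to 0.\<close>

definition columns :: "('v, 'k) free_complex \<Rightarrow> nat \<Rightarrow> nat \<Rightarrow> nat \<Rightarrow> ('v, 'k) mpoly" where
  "columns F i t s = (case i of 0 \<Rightarrow> if s = 0 then aug F t else 0
     | Suc l \<Rightarrow> if s < rank F l then diff F l s t else 0)"

lemma free_mod_eq: "free_mod V F i = free_module (rank F i)"
  by (auto simp: free_mod_def free_module_def)

lemma combine_columns_0: "combine (columns F 0) (rank F 0) v = (\<lambda>s. if s = 0 then aug_map F v else 0)"
  by (rule ext) (simp add: combine_apply columns_def aug_map_def mult.commute)

lemma combine_columns_Suc: "combine (columns F (Suc i)) (rank F (Suc i)) v = diff_map F i v"
  by (rule ext) (simp add: combine_apply columns_def diff_map_def mult.commute)

lemma kernel_columns_0: "kernel (columns F 0) (rank F 0) = {v \<in> free_mod V F 0. aug_map F v = 0}"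
  by (auto simp: kernel_def combine_columns_0 free_mod_eq fun_eq_iff)

lemma kernel_columns_Suc:
  "kernel (columns F (Suc i)) (rank F (Suc i)) = {v \<in> free_mod V F (Suc i). diff_map F i v = (\<lambda>_. 0)}"
  by (auto simp: kernel_def combine_columns_Suc free_mod_eq fun_eq_iff)

lemma image_aug_map:
  "combine (columns F 0) (rank F 0) ` free_module (rank F 0) = ideal_module J \<longleftrightarrow>
    aug_map F ` free_mod V F 0 = J"
proof -
  have A: "combine (columns F 0) (rank F 0) ` free_module (rank F 0) =
    (\<lambda>p s. if s = 0 then p else 0) ` (aug_map F ` free_mod V F 0)"
    by (simp add: image_image combine_columns_0 free_mod_eq)
  have B: "ideal_module J = (\<lambda>p (s::nat). if s = 0 then p else 0) ` J"
    unfolding ideal_module_def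
  proof (intro equalityI subsetI)
    fix v :: "nat \<Rightarrow> ('v, 'k) mpoly" assume "v \<in> {v. v 0 \<in> J \<and> (\<forall>s>0. v s = 0)}"
    then show "v \<in> (\<lambda>p (s::nat). if s = 0 then p else 0) ` J"
      by (intro image_eqI[of _ _ "v 0"]) auto
  qed auto
  have inj: "inj (\<lambda>p (s::nat). if s = 0 then p else (0 :: ('v, 'k) mpoly))"
  proof (rule injI)
    fix p q :: "('v, 'k) mpoly"
    assume "(\<lambda>s::nat. if s = 0 then p else 0) = (\<lambda>s. if s = 0 then q else 0)"
    from fun_cong[OF this, of 0] show "p = q"
      by simp
  qed
  show ?thesis
    unfolding A B by (rule inj_image_eq_iff[OF inj])
qed

text \<open>Matrix entries in the ideal of the variables have no constant term, hence neither has
  any vector of the image, which by exactness is the preceding kernel.\<close>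

lemma tower_of_resolution:
  assumes F: "minimal_graded_free_resolution V J F"
  shows "resolution_tower J (rank F) (shift F) (columns F)"
proof -
  let ?D = "\<lambda>i. combine (columns F i) (rank F i)" and ?K = "\<lambda>i. kernel (columns F i) (rank F i)"
  note F' = F[unfolded minimal_graded_free_resolution_def graded_free_resolution_def]
  note R = conjunct1[OF F']
  have aug: "aug F t \<in> poly_ring V \<and> homogeneous (shift F 0 t) (aug F t)" if "t < rank F 0" for t
    using conjunct1[OF R] that by blast
  have diff: "diff F i s t \<in> poly_ring V \<and> homogeneous (shift F (Suc i) t - shift F i s) (diff F i s t)"
    if "s < rank F i" "t < rank F (Suc i)" for i s t
    using conjunct1[OF conjunct2[OF R]] that by blast
  note im0 = conjunct1[OF conjunct2[OF conjunct2[OF R]]]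
  note im1 = conjunct1[OF conjunct2[OF conjunct2[OF conjunct2[OF R]]]]
  note imS = spec[OF conjunct2[OF conjunct2[OF conjunct2[OF conjunct2[OF R]]]]]
  have min: "diff F i s t \<in> ideal_gen V (var ` V)" if "s < rank F i" "t < rank F (Suc i)" for i s t
    using conjunct2[OF F'] that by blast
  have image: "?D (Suc i) ` free_module (rank F (Suc i)) = ?K i" for i
  proof (cases i)
    case 0
    then show ?thesis
      using im1 by (simp add: combine_columns_Suc[abs_def] kernel_columns_0 flip: free_mod_eq)
  next
    case (Suc l)
    have "?D (Suc i) ` free_module (rank F (Suc i)) = diff_map F i ` free_mod V F (Suc i)"
      unfolding combine_columns_Suc free_mod_eq ..
    then show ?thesis
      using imS[of l] unfolding Suc kernel_columns_Suc by simp
  qed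
  have minimal: "lookup (v t) 0 = 0" if v: "v \<in> ?K i" for v i t
  proof -
    obtain w where "v = diff_map F i w"
      using v unfolding image[symmetric] combine_columns_Suc by blast
    moreover have "lookup (diff F i s t * q) 0 = 0" if "s < rank F i" "t < rank F (Suc i)" for s t q
      unfolding lookup_mult_0 using ideal_gen_vars_lookup_0[OF min[OF that]] by simp
    ultimately show ?thesis
      by (simp add: diff_map_def lookup_sum)
  qed
  show ?thesis
    unfolding resolution_tower_def minimal_cover_def
  proof (intro conjI allI impI ballI)
    show "columns F 0 t \<in> grade (\<lambda>_. 0) (ideal_module J) (shift F 0 t)" if t: "t < rank F 0" for t
    proof -
      have im: "?D 0 ` free_module (rank F 0) = ideal_module J"
        using im0 image_aug_map by blast
      have "columns F 0 t \<in> ideal_module J"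
        using imageI[OF unit_vec_free_module[OF t], of "?D 0"] unfolding im combine_unit_vec[OF t] .
      then show ?thesis
        using aug[OF t] by (simp add: grade_def columns_def)
    qed
    show "?D 0 ` free_module (rank F 0) = ideal_module J"
      using im0 image_aug_map by blast
    show "columns F (Suc i) t \<in> grade (shift F i) (?K i) (shift F (Suc i) t)" if t: "t < rank F (Suc i)" for i t
    proof -
      have "columns F (Suc i) t \<in> ?K i"
        using imageI[OF unit_vec_free_module[OF t], of "?D (Suc i)"] unfolding image combine_unit_vec[OF t] .
      then show ?thesis
        using diff[OF _ t] by (simp add: grade_def columns_def)
    qed
    show "?D (Suc i) ` free_module (rank F (Suc i)) = ?K i" for i
      by (rule image)
  qed (use minimal in blast)+
qed

text \<open>Each column is a vector of the preceding kernel, so its entries have no constant term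
  and lie in the ideal of the variables.\<close>

lemma resolution_of_tower:
  assumes J: "graded_submodule 1 (\<lambda>_. 0) (ideal_module J)" and T: "resolution_tower J rk sh g"
  shows "minimal_graded_free_resolution V J
    \<lparr>rank = rk, shift = sh, aug = (\<lambda>t. g 0 t 0), diff = (\<lambda>i s t. g (Suc i) t s)\<rparr>"
    (is "minimal_graded_free_resolution V J ?F")
proof -
  have T0: "minimal_cover (\<lambda>_. 0) (ideal_module J) (rk 0) (sh 0) (g 0)"
    and TS: "\<And>i. minimal_cover (sh i) (kernel (g i) (rk i)) (rk (Suc i)) (sh (Suc i)) (g (Suc i))"
    using T unfolding resolution_tower_def by blast+
  have g0: "g 0 t \<in> ideal_module J" "homogeneous (sh 0 t) (g 0 t 0)" if "t < rk 0" for t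
    using T0 that gradeD(2)[of "g 0 t" "\<lambda>_. 0" _ "sh 0 t" 0] by (auto simp: minimal_cover_def grade_def)
  have gS: "g (Suc i) t \<in> kernel (g i) (rk i)" "homogeneous (sh (Suc i) t - sh i s) (g (Suc i) t s)"
    if "t < rk (Suc i)" for i t s
    using TS[of i] that unfolding minimal_cover_def grade_def by blast+
  have min: "lookup (v t) 0 = 0" if "v \<in> kernel (g i) (rk i)" for v i t
    using that T0 TS[of "i - 1"] unfolding minimal_cover_def by (cases i) auto
  have gF: "g (Suc i) t \<in> free_module (rk i)" if "t < rk (Suc i)" for i t
    using gS(1)[OF that] by (simp add: kernel_def)
  have "combine (columns ?F i) (rk i) v = combine (g i) (rk i) v" for i v
  proof -
    have "columns ?F i t = g i t" if "t < rk i" for t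
    proof
      fix s
      show "columns ?F i t s = g i t s"
      proof (cases i)
        case 0
        then show ?thesis
          using g0(1)[of t] that by (auto simp: columns_def ideal_module_def)
      next
        case (Suc l)
        then show ?thesis
          using free_moduleD(2)[OF gF[of t l], of s] that by (simp add: columns_def)
      qed
    qed
    then show ?thesis
      by (simp add: combine_def)
  qed
  then have comb: "combine (columns ?F i) (rk i) = combine (g i) (rk i)" for i
    by blast
  then have ker: "kernel (columns ?F i) (rk i) = kernel (g i) (rk i)" for i
    by (simp add: kernel_def)
  have im: "combine (g (Suc i)) (rk (Suc i)) ` free_module (rk (Suc i)) = kernel (g i) (rk i)" for i
    using TS[of i] by (simp add: minimal_cover_def)
  have dm: "diff_map ?F i = combine (g (Suc i)) (rk (Suc i))" for i
    using combine_columns_Suc[of ?F i] comb[of "Suc i"] by (auto simp: fun_eq_iff)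
  have k0: "{v \<in> free_mod V ?F 0. aug_map ?F v = 0} = kernel (g 0) (rk 0)"
    using kernel_columns_0[of ?F] ker[of 0] by simp
  have kS: "{v \<in> free_mod V ?F (Suc i). diff_map ?F i v = (\<lambda>_. 0)} = kernel (g (Suc i)) (rk (Suc i))" for i
    using kernel_columns_Suc[of ?F i] ker[of "Suc i"] by simp
  show ?thesis
    unfolding minimal_graded_free_resolution_def graded_free_resolution_def
  proof (intro conjI allI impI)
    show "aug ?F t \<in> poly_ring V" if "t < rank ?F 0" for t
      using graded_submoduleD(1)[OF J] g0(1)[of t] that free_moduleD(1) by auto
    show "homogeneous (shift ?F 0 t) (aug ?F t)" if "t < rank ?F 0" for t
      using g0(2)[of t] that by simp
    show dR: "diff ?F i s t \<in> poly_ring V" if "s < rank ?F i" "t < rank ?F (Suc i)" for i s t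
      using free_moduleD(1)[OF gF[of t i], of s] that by simp
    show "homogeneous (shift ?F (Suc i) t - shift ?F i s) (diff ?F i s t)"
      if "s < rank ?F i" "t < rank ?F (Suc i)" for i s t
      using gS(2)[of t i s] that by simp
    show "aug_map ?F ` free_mod V ?F 0 = J"
      using image_aug_map[of ?F J] comb[of 0] T0 by (simp add: minimal_cover_def)
    show "diff_map ?F 0 ` free_mod V ?F 1 = {v \<in> free_mod V ?F 0. aug_map ?F v = 0}"
    proof -
      have "diff_map ?F 0 ` free_mod V ?F 1 = kernel (g 0) (rk 0)"
        unfolding dm free_mod_eq using im[of 0] by simp
      then show ?thesis
        unfolding k0 .
    qed
    show "diff_map ?F (Suc i) ` free_mod V ?F (Suc (Suc i)) =
        {v \<in> free_mod V ?F (Suc i). diff_map ?F i v = (\<lambda>_. 0)}" for i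
    proof -
      have "diff_map ?F (Suc i) ` free_mod V ?F (Suc (Suc i)) = kernel (g (Suc i)) (rk (Suc i))"
        unfolding dm free_mod_eq using im[of "Suc i"] by simp
      then show ?thesis
        unfolding kS .
    qed
    show "diff ?F i s t \<in> ideal_gen V (var ` V)" if "s < rank ?F i" "t < rank ?F (Suc i)" for i s t
      using ideal_gen_varsI[OF dR[OF that]] min[OF gS(1)[of t i], of s] that by simp
  qed
qed

text \<open>Every minimal resolution has the same count, the Koszul dimension, and a tower supplies
  one; so the definite description denotes that number.\<close>

lemma betti_eq:
  assumes J: "graded_submodule 1 (\<lambda>_. 0) (ideal_module J)"
    and unique: "\<And>j p n n'. koszul_dim (grade (\<lambda>_. 0) (ideal_module J)) j p n \<Longrightarrow>
      koszul_dim (grade (\<lambda>_. 0) (ideal_module J)) j p n' \<Longrightarrow> n = n'"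
    and fin: "\<And>j p. \<exists>n. koszul_dim (grade (\<lambda>_. 0) (ideal_module J)) j p n"
    and bounded: "\<And>j p. N < j \<Longrightarrow>
      kcycles (grade (\<lambda>_. 0) (ideal_module J)) j p \<subseteq> kbounds (grade (\<lambda>_. 0) (ideal_module J)) j p"
  shows "koszul_dim (grade (\<lambda>_. 0) (ideal_module J)) j (int i) (betti V J i j)"
proof -
  let ?P = "\<lambda>n. \<exists>F. minimal_graded_free_resolution V J F \<and> n = card {s. s < rank F i \<and> shift F i s = j}"
  have dim: "koszul_dim (grade (\<lambda>_. 0) (ideal_module J)) j (int i) n" if "?P n" for n
    using tower_koszul_dim[OF J tower_of_resolution] that by blast
  obtain rk sh g where "resolution_tower J rk sh g"
    using tower_exists[OF J fin bounded] by blast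
  from resolution_of_tower[OF J this] obtain n where n: "?P n"
    by blast
  have "betti V J i j = n"
    unfolding betti_def
  proof (rule the_equality[where P = ?P, OF n])
    show "n' = n" if "?P n'" for n'
      by (rule unique[OF dim[OF that] dim[OF n]])
  qed
  then show ?thesis
    using dim[OF n] by simp
qed

section \<open>Regularity of square-free monomial ideals\<close>

text \<open>The assumption \<open>sqfree\<close> says that an exponent 2 may be lowered to 1, which
  confines homology to square-free multidegrees. There, failure of exactness at i over \<sigma> is a
  nonzero Betti number with difference \<open>card \<sigma> - i\<close>.\<close>

lemma reg_monomial_ideal:
  fixes Q :: "('v \<Rightarrow>\<^sub>0 nat) \<Rightarrow> bool" and d :: int
  assumes up: "\<And>s t. Q t \<Longrightarrow> Q (s + t)"
    and sqfree: "\<And>t x. Q (t + single x 2) \<Longrightarrow> Q (t + single x 1)"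
    and upper: "\<And>\<sigma> i. \<sigma> \<subseteq> V \<Longrightarrow> i + d < int (card \<sigma>) \<Longrightarrow> acyclic_at \<sigma> (\<lambda>S. Q (indicator_exp (\<sigma> - S))) i"
    and lower: "\<sigma>0 \<subseteq> V" "int (card \<sigma>0) = int i0 + d" "\<not> acyclic_at \<sigma>0 (\<lambda>S. Q (indicator_exp (\<sigma>0 - S))) (int i0)"
  shows "reg V (monomial_ideal V Q :: ('v, 'k) mpoly set) = d"
proof -
  let ?J = "monomial_ideal V Q :: ('v, 'k) mpoly set"
  let ?M = "mono_module 1 (\<lambda>_. 0) Q"
  have J_eq: "grade (\<lambda>_. 0) (ideal_module ?J) = ?M"
    by (auto simp: grade_def ideal_module_def mono_module_def fun_eq_iff)
  have sub: "?J \<subseteq> poly_ring V"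
    by (auto simp: monomial_ideal_def)
  have mult: "q * p \<in> ?J" if "q \<in> poly_ring V" "p \<in> ?J" for q p
    by (rule monomial_ideal_mult[OF that]) (rule up)
  have J: "graded_submodule 1 (\<lambda>_. 0) (ideal_module ?J)"
    unfolding graded_submodule_def ideal_module_def free_module_def
    using sub by (auto simp: monomial_ideal_add mult hpart_def monomial_ideal_hom_part)
  have gM: "graded_module ?M"
    by (rule graded_module_mono_module) (rule up)
  have "\<exists>W. finite W \<and> kchains ?M j p \<subseteq> kspace.span W" for j p
    by (rule kchains_mono_module_finite_dim[of 1 "\<lambda>_. 0" Q j p]) blast
  then obtain W where W: "\<And>j p. finite (W j p) \<and> kchains ?M j p \<subseteq> kspace.span (W j p)"
    by metis
  have cyc: "kcycles ?M j p \<subseteq> kspace.span (W j p)" for j p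
    using W[of j p] by (auto simp: kcycles_def)
  have exists: "\<exists>n. koszul_dim ?M j p n" for j p
    using has_quotient_dim_exists[OF subspace_kcycles[OF gM] subspace_kbounds[OF gM] kbounds_kcycles[OF gM] _ cyc] W
    by blast
  have unique: "n = n'" if "koszul_dim ?M j p n" "koszul_dim ?M j p n'" for j p n n'
  proof -
    have "n + kspace.dim (kbounds ?M j p) = kspace.dim (kcycles ?M j p)" if "koszul_dim ?M j p n" for n
      using has_quotient_dim_unique[OF subspace_kcycles[OF gM] subspace_kbounds[OF gM] kbounds_kcycles[OF gM] _ cyc that] W
      by blast
    from this[OF that(1)] this[OF that(2)] show ?thesis
      by simp
  qed
  \<comment> \<open>An exponent of at least 2 survives division by x as an exponent of at least 1,
    so membership in the ideal is unaffected and x is a cone apex.\<close>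
  have cone: "acyclic_at (keys a) (\<lambda>S. Q (a - indicator_exp S)) p"
    if a: "keys a \<subseteq> V" "2 \<le> lookup a x" for a x p
  proof (rule acyclic_at_cone[OF a(1)])
    show "x \<in> keys a"
      using a(2) by (auto simp: in_keys_iff)
    fix S assume S: "S \<subseteq> keys a" "x \<notin> S" "Q (a - indicator_exp S)"
    have fS: "finite S"
      using finite_subset[OF S(1)] by simp
    let ?t = "a - indicator_exp S - single x 2"
    have "a - indicator_exp S = ?t + single x 2"
      "a - indicator_exp (insert x S) = ?t + single x 1"
      using a(2) S(2) fS
      by (auto intro!: poly_mapping_eqI simp: lookup_add lookup_minus lookup_indicator_exp lookup_single when_def)
    then show "Q (a - indicator_exp (insert x S))"
      using sqfree S(3) by metis
  qed
  have square_free: "a = indicator_exp (keys a)" if "\<not> (\<exists>x. 2 \<le> lookup a x)" for a :: "'v \<Rightarrow>\<^sub>0 nat"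
  proof (rule poly_mapping_eqI)
    fix x
    have "lookup a x < 2"
      using that by (simp add: not_le)
    then show "lookup a x = lookup (indicator_exp (keys a)) x"
      by (auto simp: lookup_indicator_exp in_keys_iff)
  qed
  have diff: "indicator_exp \<sigma> - indicator_exp S = indicator_exp (\<sigma> - S)" if "S \<subseteq> \<sigma>" "finite \<sigma>" for S \<sigma> :: "'v set"
    using that finite_subset[OF that]
    by (intro poly_mapping_eqI) (auto simp: lookup_minus lookup_indicator_exp)
  \<comment> \<open>The second alternative rules out square-free multidegrees by size; it supplies
    the degree bound that makes covers finitely generated.\<close>
  have acyc: "acyclic_at (keys a) (\<lambda>S. Q (a - indicator_exp S)) p"
    if a: "keys a \<subseteq> V" "p + d < int (mon_degree a) \<or> int (card V) < int (mon_degree a)" for a p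
  proof (cases "\<exists>x. 2 \<le> lookup a x")
    case True
    then show ?thesis
      using cone[OF a(1)] by blast
  next
    case False
    note sf = square_free[OF False]
    have "mon_degree a = card (keys a)"
      using arg_cong[OF sf, of mon_degree] by (simp add: mon_degree_indicator_exp)
    moreover have "card (keys a) \<le> card V"
      by (rule card_mono[OF finite_V a(1)])
    ultimately have "acyclic_at (keys a) (\<lambda>S. Q (indicator_exp (keys a - S))) p"
      using a by (intro upper) auto
    moreover have "a - indicator_exp S = indicator_exp (keys a - S)" if "S \<subseteq> keys a" for S
      using diff[OF that] sf by simp
    ultimately show ?thesis
      by (subst acyclic_at_cong) simp_all
  qed
  have bounded: "kcycles ?M j p \<subseteq> kbounds ?M j p" if "int (card V) < j" for j p
    by (rule mono_module_exact) (use acyc that in simp)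
  have betti: "koszul_dim ?M j (int i) (betti V ?J i j)" for i j
    using betti_eq[OF J, of "int (card V)" j i] unique exists bounded unfolding J_eq by blast
  have betti_0: "betti V ?J i j = 0 \<longleftrightarrow> kcycles ?M j (int i) \<subseteq> kbounds ?M j (int i)" for i j
    using betti[of j i] has_quotient_dim_subset has_quotient_dim_0_iff by metis
  have le: "j - int i \<le> d" if "betti V ?J i j \<noteq> 0" for i j
  proof (rule ccontr)
    assume "\<not> j - int i \<le> d"
    then have "kcycles ?M j (int i) \<subseteq> kbounds ?M j (int i)"
      by (intro mono_module_exact acyc) auto
    then show False
      using that betti_0 by simp
  qed
  \<comment> \<open>The bound from below makes the set of differences finite, as \<open>Max\<close>
    requires: coefficients of degree j - i vanish when that is negative.\<close>
  have ge: "0 \<le> j - int i" if "betti V ?J i j \<noteq> 0" for i j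
  proof (rule ccontr)
    assume neg: "\<not> 0 \<le> j - int i"
    have "kcycles ?M j (int i) \<subseteq> kbounds ?M j (int i)"
    proof
      fix c assume "c \<in> kcycles ?M j (int i)"
      then have c: "c \<in> kchains ?M j (int i)"
        by (simp add: kcycles_def)
      have "c = 0"
      proof (rule ext, rule ext)
        fix S s
        have "homogeneous (j - int i) (c S s)"
          using pchainsD(2)[OF component_pchains[OF c, of s], of S] by simp
        then have "c S s = 0"
          by (rule homogeneous_negative) (use neg in simp)
        then show "c S s = 0 S s"
          by simp
      qed
      then show "c \<in> kbounds ?M j (int i)"
        using kspace.subspace_0[OF subspace_kbounds[OF gM]] by simp
    qed
    then show False
      using that betti_0 by simp
  qed
  have f0: "finite \<sigma>0"
    by (rule finite_subset[OF lower(1) finite_V])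
  have "\<not> acyclic_at \<sigma>0 (\<lambda>S. Q (indicator_exp \<sigma>0 - indicator_exp S)) (int i0)"
    using lower(3) acyclic_at_cong[of \<sigma>0 "\<lambda>S. Q (indicator_exp \<sigma>0 - indicator_exp S)"] diff[OF _ f0] by simp
  then have "\<not> kcycles ?M (int (card \<sigma>0)) (int i0) \<subseteq> kbounds ?M (int (card \<sigma>0)) (int i0)"
    by (intro mono_module_not_exact[where a = "indicator_exp \<sigma>0"])
      (use lower(1) f0 in \<open>simp_all add: keys_indicator_exp mon_degree_indicator_exp\<close>)
  then have "betti V ?J i0 (int (card \<sigma>0)) \<noteq> 0"
    by (simp add: betti_0)
  moreover have "int (card \<sigma>0) - int i0 = d"
    using lower(2) by simp
  ultimately have mem: "d \<in> {j - int i | i j. betti V ?J i j \<noteq> 0}"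
    by blast
  have "{j - int i | i j. betti V ?J i j \<noteq> 0} \<subseteq> {0..d}"
    using le ge by auto
  then have "finite {j - int i | i j. betti V ?J i j \<noteq> 0}"
    by (rule finite_subset) simp
  then show ?thesis
    unfolding reg_def by (rule Max_eqI) (use le mem in auto)
qed

end

section \<open>Transfer along the isomorphism, and conclusion\<close>

text \<open>Levels and spine are pulled back from the model. The selected whisker is the one of
  index 1, which exists because every \<open>r i\<close> is at least 1.\<close>

lemma whiskered_path_graph_of_iso:
  assumes G: "simple_graph G" and r: "\<forall>i\<in>{1..m}. r i \<ge> 1" and iso: "graph_iso G (whiskered_path m r)"
    and sg: "sign_function (verts G) (sg :: 'v \<Rightarrow> 'v set \<Rightarrow> 'k::field)"
  shows "\<exists>lev x y. whiskered_path_graph (verts G) sg (edges G) m lev x y"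
proof -
  let ?W = "whiskered_path m r"
  obtain f where f: "bij_betw f (verts G) (verts ?W)"
    and adj: "\<And>u v. u \<in> verts G \<Longrightarrow> v \<in> verts G \<Longrightarrow> {u, v} \<in> edges G \<longleftrightarrow> {f u, f v} \<in> edges ?W"
    using iso unfolding graph_iso_def by blast
  define h where "h = inv_into (verts G) f"
  have fh: "f (h w) = w" and hV: "h w \<in> verts G" if "w \<in> verts ?W" for w
    using f that by (auto simp: h_def bij_betw_def f_inv_into_f inv_into_into)
  have hf: "h (f v) = v" if "v \<in> verts G" for v
    using f that by (simp add: h_def bij_betw_def)
  have fV: "f v \<in> verts ?W" if "v \<in> verts G" for v
    using f that by (auto simp: bij_betw_def)
  define lev where "lev v = (case f v of X i \<Rightarrow> i | Y i j \<Rightarrow> i)" for v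
  have XW: "X i \<in> verts ?W" "Y i 1 \<in> verts ?W" if "i \<in> {1..m}" for i
    using that r by (auto simp: whiskered_path_def)
  have sub: "e \<subseteq> verts G" "card e = 2" if "e \<in> edges G" for e
    using G that unfolding simple_graph_def by blast+
  have leaf: "\<exists>i j. f v = Y i j \<and> i \<in> {1..m} \<and> j \<in> {1..r i} \<and> lev v = i"
    if "v \<in> verts G" "v \<noteq> h (X (lev v))" for v
    using fV[OF that(1)] hf[OF that(1)] that(2) by (auto simp: whiskered_path_def lev_def)
  have "whiskered_path_graph (verts G) sg (edges G) m lev (\<lambda>i. h (X i)) (\<lambda>i. h (Y i 1))"
    unfolding whiskered_path_graph_def whiskered_path_graph_axioms_def
  proof (intro conjI allI impI sg)
    show "card e = 2" "e \<subseteq> verts G" if "e \<in> edges G" for e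
      using sub that by blast+
    show "lev v \<in> {1..m}" if "v \<in> verts G" for v
      using fV[OF that] by (auto simp: lev_def whiskered_path_def)
    show "h (X j) \<in> verts G" "lev (h (X j)) = j" if "j \<in> {1..m}" for j
      using XW[OF that] hV fh by (simp_all add: lev_def)
    show "h (Y j 1) \<in> verts G" "lev (h (Y j 1)) = j" "h (Y j 1) \<noteq> h (X j)" if "j \<in> {1..m}" for j
      using XW[OF that] hV fh[of "X j"] fh[of "Y j 1"] by (auto simp add: lev_def)
    show "{v, h (X (lev v))} \<in> edges G" if v: "v \<in> verts G" "v \<noteq> h (X (lev v))" for v
    proof -
      obtain i j where ij: "f v = Y i j" "i \<in> {1..m}" "j \<in> {1..r i}" "lev v = i"
        using leaf[OF v] by blast
      have "{Y i j, X i} \<in> edges ?W"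
        using ij by (auto simp: whiskered_path_def insert_commute)
      then show ?thesis
        using adj[OF v(1) hV[OF XW(1)[OF ij(2)]]] fh[OF XW(1)[OF ij(2)]] ij by simp
    qed
    show "w = h (X (lev v))" if v: "v \<in> verts G" "v \<noteq> h (X (lev v))" and e: "{v, w} \<in> edges G" for v w
    proof -
      obtain i j where ij: "f v = Y i j" "i \<in> {1..m}" "lev v = i"
        using leaf[OF v] by blast
      have w: "w \<in> verts G"
        using sub(1)[OF e] by simp
      have "{Y i j, f w} \<in> edges ?W"
        using adj[OF v(1) w] e ij by simp
      then have "f w = X i"
        by (auto simp: whiskered_path_def doubleton_eq_iff)
      then show ?thesis
        using hf[OF w] ij by simp
    qed
    show "{h (X j), h (X (Suc j))} \<in> edges G" if "1 \<le> j" "j < m" for j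
    proof -
      have j: "j \<in> {1..m}" "Suc j \<in> {1..m}"
        using that by auto
      have "{X j, X (Suc j)} \<in> edges ?W"
        using that by (auto simp: whiskered_path_def)
      then show ?thesis
        using adj[OF hV[OF XW(1)[OF j(1)]] hV[OF XW(1)[OF j(2)]]] fh[OF XW(1)[OF j(1)]] fh[OF XW(1)[OF j(2)]] by simp
    qed
    show "i = Suc j \<or> j = Suc i" if e: "{h (X i), h (X j)} \<in> edges G" and ij: "i \<in> {1..m}" "j \<in> {1..m}" for i j
    proof -
      have "{X i, X j} \<in> edges ?W"
        using e adj[OF hV[OF XW(1)[OF ij(1)]] hV[OF XW(1)[OF ij(2)]]] fh[OF XW(1)[OF ij(1)]] fh[OF XW(1)[OF ij(2)]] by simp
      then show ?thesis
        by (auto simp: whiskered_path_def doubleton_eq_iff)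
    qed
  qed
  then show ?thesis
    by blast
qed

theorem proposition3p4:
  fixes G :: "'v graph" and m :: nat
  assumes "m \<ge> 1" and "G \<in> whiskered_paths m"
  shows "matching_number G = m \<and>
         (\<forall>k. 1 \<le> k \<and> k \<le> matching_number G \<longrightarrow>
            reg (verts G) (sqfree_power (verts G) (edge_ideal G :: ('v, 'k::field) mpoly set) k)
              = 2 * int k + \<lfloor>(real m - real k) / 2\<rfloor>)"
proof -
  obtain r where G: "simple_graph G" and r: "\<forall>i\<in>{1..m}. r i \<ge> 1" and iso: "graph_iso G (whiskered_path m r)"
    using assms(2) unfolding whiskered_paths_def by blast
  have "finite (verts G)"
    using G by (simp add: simple_graph_def)
  then obtain sg :: "'v \<Rightarrow> 'v set \<Rightarrow> 'k" where sg: "sign_function (verts G) sg"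
    using sign_function_exists by blast
  obtain lev x y where "whiskered_path_graph (verts G) sg (edges G) m lev x y"
    using whiskered_path_graph_of_iso[OF G r iso sg] by blast
  then interpret whiskered_path_graph "verts G" sg "edges G" m lev x y .
  have m: "matching_number G = m"
    using Max_matching by (simp add: matching_number_def matching_def)
  have "reg (verts G) (sqfree_power (verts G) (edge_ideal G :: ('v, 'k) mpoly set) k)
      = 2 * int k + \<lfloor>(real m - real k) / 2\<rfloor>" if k: "1 \<le> k" "k \<le> m" for k
  proof -
    let ?Q = "\<lambda>t :: 'v \<Rightarrow>\<^sub>0 nat. has_matching (edges G) k (keys t)"
    have Q: "?Q (indicator_exp (\<sigma> - S)) \<longleftrightarrow> has_matching (edges G) k (\<sigma> - S)" if "\<sigma> \<subseteq> verts G" for \<sigma> S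
      using finite_sub[OF that] by (simp add: keys_indicator_exp)
    obtain \<sigma>0 where \<sigma>0: "\<sigma>0 \<subseteq> verts G" "\<not> acyc k \<sigma>0 (int ((m - k) div 2))"
      "int (card \<sigma>0) = int ((m - k) div 2) + reg_bound m k"
      using not_acyc_at_bound[OF k] by blast
    have "reg (verts G) (monomial_ideal (verts G) ?Q :: ('v, 'k) mpoly set) = reg_bound m k"
    proof (rule reg_monomial_ideal)
      show "?Q (s + t)" if "?Q t" for s t
        using that by (rule has_matching_mono) (simp add: keys_add_nat)
      \<comment> \<open>The predicate sees supports only, and these do not distinguish exponent 1
        from exponent 2.\<close>
      show "?Q (t + single x 1)" if "?Q (t + single x 2)" for t x
        using that by (simp add: keys_add_nat)
      show "acyclic_at \<sigma> (\<lambda>S. ?Q (indicator_exp (\<sigma> - S))) i"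
        if "\<sigma> \<subseteq> verts G" "i + reg_bound m k < int (card \<sigma>)" for \<sigma> i
        unfolding Q[OF that(1)] by (rule acyc_above_bound[OF that(1) k(2) that(2)])
      show "\<sigma>0 \<subseteq> verts G" "int (card \<sigma>0) = int ((m - k) div 2) + reg_bound m k"
        by (rule \<sigma>0)+
      show "\<not> acyclic_at \<sigma>0 (\<lambda>S. ?Q (indicator_exp (\<sigma>0 - S))) (int ((m - k) div 2))"
        unfolding Q[OF \<sigma>0(1)] by (rule \<sigma>0(2))
    qed
    \<comment> \<open>Since k \<le> m, the subtraction of naturals agrees with the real one, and
      \<open>div\<close> is the floor.\<close>
    moreover have "\<lfloor>(real m - real k) / 2\<rfloor> = int ((m - k) div 2)"
      using floor_divide_of_nat_eq[of "m - k" 2, where 'a = real] k by (simp add: of_nat_diff)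
    ultimately show ?thesis
      by (simp add: sqfree_power_eq[OF G] reg_bound_def)
  qed
  then show ?thesis
    using m by simp
qed

end
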